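(* Let the periodic cell $\varpi$ (equivalently, the periodic domain $\Pi$) be simply connected and satisfy the standing geometric assumptions and assumption (A) described in the context, and let $\eta\in[-\pi,\pi]$. Then the integral kernel $K_\eta$ of the orthogonal projection $P_\eta$ from $L^2(\varpi)$ onto $A^2_\eta(\varpi)$ is given, for $z,w\in\varpi$, by $$K_\eta(z,w)=\widetilde K(z,w)\sum_{n\in\mathbb Z}\frac{2n+\eta/\pi}{2\pi\big(\rho^{2n+\eta/\pi}-\rho^{-2n-\eta/\pi}\big)}\;e^{i(2\pi(n-1)+\eta)\left(\varphi(z)-\overline{\varphi(w)}\right)},$$ where $$\widetilde K(z,w)=4\pi^2e^{i2\pi(z-\bar w)}\,\phi'(e^{i2\pi z})\,\overline{\phi'(e^{i2\pi w})}.$$ (For $\eta=0$, $n=0$ the coefficient is understood as its limit value $1/(4\pi\log\rho)$.)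
   Context: Geometry. Identify $\mathbb C\cong\mathbb R^2$. Let $M>0$, $a<b$ be real and let $\varpi\subset\,]0,1[\,\times\,]-M,M[$ be a domain (the periodic cell) whose closure meets the lines $\mathrm{Re}\,z=0$ and $\mathrm{Re}\,z=1$ exactly in $\{0\}\times[a,b]$ and $\{1\}\times[a,b]$; put $J_-=\{0\}\times(a,b)$, $J_+=\{1\}\times(a,b)$. For $m\in\mathbb Z$ let $\varpi_m=\varpi+m$, and let the periodic domain $\Pi$ be the interior of $\bigcup_{m\in\mathbb Z}\mathrm{cl}(\varpi_m)$. It is assumed that $\varpi$ and $\Pi$ are Lipschitz domains with piecewise smooth boundaries ($\partial\varpi$ consists of finitely many curves $\gamma:[0,1]\to\mathbb C$ continuously differentiable on $[0,1]$). Spaces. $L^2(\varpi)$ is taken with respect to area measure $dA$, $A^2(\varpi)$ is its subspace of analytic functions. $A^2_{\eta,\mathrm{ext}}(\varpi)$ is the subspace of $A^2(\varpi)$ consisting of functions $f$ which extend analytically to a neighborhood in $\Pi$ of $\mathrm{cl}(\varpi)\cap\Pi$ and satisfy $f(1+iy)=e^{i\eta}f(iy)$ for all $a<y<b$; $A^2_\eta(\varpi)$ is its closure in $A^2(\varpi)$. The kernel $K_\eta:\varpi\times\varpi\to\mathbb C$ is defined by $P_\eta f(z)=\int_\varpi K_\eta(z,w)f(w)\,dA(w)$, with $K_\eta(z,\cdot)\in L^2(\varpi)$ for all $z\in\varpi$. Conformal maps. Let $E(z)=e^{i2\pi z}$ and $\mathcal D=\{E(z):z\in\varpi\cup J_+\cup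 J_-\}$, a doubly connected domain surrounding $0$ when $\varpi$ is simply connected. Let $\phi$ be a conformal mapping from $\mathcal D$ onto the annulus $\mathcal A=\{z:1/\rho<|z|<\rho\}$, with $\rho>1$ uniquely determined by $\mathcal D$, where $\phi$ takes the inner (outer) boundary component to the inner (outer) boundary component. Let $\mathcal D_|=E(\varpi)=\mathcal D\setminus(0,\infty)$, $\mathcal A_|=\phi(\mathcal D_|)$ and $\Gamma=\phi(\mathcal D\cap(0,\infty))$. Assumption (A): for some $0<\delta<1$, $\Gamma\subset\{z\in\mathbb C:\delta<\arg z<\pi-\delta\}$. Branch of the logarithm on $\mathcal A_|=\mathcal A\setminus\Gamma$: with $\varpi_+=\varpi\cap\{\mathrm{Re}\,z\ge1/2\}$ and $\varpi_-=\varpi\setminus\varpi_+$, $\arg$ is the continuous argument on $\mathcal A_|$ with values in $[0,3\pi]$ such that near each point of $\Gamma$ one has $\arg z<\pi$ for $z\in\phi(E(\varpi_-))$ and $\arg z>2\pi$ for $z\in\phi(E(\varpi_+))$; $\log z=\log|z|+i\arg z$. For $z\in\varpi$ put $$\varphi(z)=\frac1{i2\pi}\log\big(\phi(e^{i2\pi z})\big).$$ *)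

theory Defs
  imports "HOL-Complex_Analysis.Complex_Analysis"
begin

section \<open>Periodic cells and periodic domains\<close>

definition "domain" :: "complex set \<Rightarrow> bool" where
  "domain S \<longleftrightarrow> open S \<and> connected S \<and> S \<noteq> {}"

text \<open>Around each boundary point, in suitably rotated Cartesian coordinates, the domain is the part
  of a small rectangle lying strictly above the graph of a Lipschitz function. The domain need not
  be bounded.\<close>

definition lipschitz_domain :: "complex set \<Rightarrow> bool" where
  "lipschitz_domain S \<longleftrightarrow> domain S \<and>
     (\<forall>p\<in>frontier S. \<exists>u r h L (g :: real \<Rightarrow> real).
        norm u = 1 \<and> r > 0 \<and> h > 0 \<and> L-lipschitz_on {-r<..<r} g \<and>
        (\<forall>s. \<bar>s\<bar> < r \<longrightarrow> \<bar>g s\<bar> < h) \<and>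
        (\<forall>s t. \<bar>s\<bar> < r \<and> \<bar>t\<bar> < h \<longrightarrow> (p + u * Complex s t \<in> S \<longleftrightarrow> g s < t)))"

definition translate_cell :: "int \<Rightarrow> complex set \<Rightarrow> complex set" where
  "translate_cell m S = (\<lambda>z. z + of_int m) ` S"

definition periodic_domain :: "complex set \<Rightarrow> complex set" where
  "periodic_domain W = interior (\<Union>m. closure (translate_cell m W))"

definition piecewise_smooth_boundary :: "complex set \<Rightarrow> bool" where
  "piecewise_smooth_boundary S \<longleftrightarrow>
     (\<exists>C. finite C \<and> (\<forall>\<gamma>\<in>C. \<gamma> C1_differentiable_on {0..1}) \<and>
        frontier S = (\<Union>\<gamma>\<in>C. path_image \<gamma>))"

text \<open>The boundary of a periodic domain is unbounded, so finitely many curves can make it up only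
  modulo integer translations.\<close>

definition periodic_piecewise_smooth_boundary :: "complex set \<Rightarrow> bool" where
  "periodic_piecewise_smooth_boundary S \<longleftrightarrow>
     (\<exists>C. finite C \<and> (\<forall>\<gamma>\<in>C. \<gamma> C1_differentiable_on {0..1}) \<and>
        frontier S = (\<Union>m. translate_cell m (\<Union>\<gamma>\<in>C. path_image \<gamma>)))"

definition periodic_cell :: "real \<Rightarrow> real \<Rightarrow> real \<Rightarrow> complex set \<Rightarrow> bool" where
  "periodic_cell M a b W \<longleftrightarrow>
     domain W \<and>
     W \<subseteq> {z. 0 < Re z \<and> Re z < 1 \<and> - M < Im z \<and> Im z < M} \<and>
     closure W \<inter> {z. Re z = 0} = {Complex 0 y |y. a \<le> y \<and> y \<le> b} \<and>
     closure W \<inter> {z. Re z = 1} = {Complex 1 y |y. a \<le> y \<and> y \<le> b} \<and>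
     lipschitz_domain W \<and> piecewise_smooth_boundary W \<and>
     lipschitz_domain (periodic_domain W) \<and>
     periodic_piecewise_smooth_boundary (periodic_domain W)"

definition J_minus :: "real \<Rightarrow> real \<Rightarrow> complex set" where
  "J_minus a b = {Complex 0 y |y. a < y \<and> y < b}"

definition J_plus :: "real \<Rightarrow> real \<Rightarrow> complex set" where
  "J_plus a b = {Complex 1 y |y. a < y \<and> y < b}"


section \<open>Function spaces, projection and kernel\<close>

text \<open>Elements of \<open>L\<^sup>2(W)\<close> are represented by functions on the whole plane whose values outside \<open>W\<close>
  are irrelevant.\<close>

definition L2 :: "complex set \<Rightarrow> (complex \<Rightarrow> complex) set" where
  "L2 W = {f. f \<in> borel_measurable (lebesgue_on W) \<and>
              integrable (lebesgue_on W) (\<lambda>z. (norm (f z))\<^sup>2)}"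

definition L2_inner :: "complex set \<Rightarrow> (complex \<Rightarrow> complex) \<Rightarrow> (complex \<Rightarrow> complex) \<Rightarrow> complex" where
  "L2_inner W f g = (LINT z|lebesgue_on W. f z * cnj (g z))"

definition L2_norm :: "complex set \<Rightarrow> (complex \<Rightarrow> complex) \<Rightarrow> real" where
  "L2_norm W f = sqrt (LINT z|lebesgue_on W. (norm (f z))\<^sup>2)"

definition A2 :: "complex set \<Rightarrow> (complex \<Rightarrow> complex) set" where
  "A2 W = {f \<in> L2 W. f holomorphic_on W}"

definition A2_ext :: "real \<Rightarrow> real \<Rightarrow> complex set \<Rightarrow> real \<Rightarrow> (complex \<Rightarrow> complex) set" where
  "A2_ext a b W \<eta> = {f \<in> A2 W. \<exists>U g.
     open U \<and> closure W \<inter> periodic_domain W \<subseteq> U \<and> U \<subseteq> periodic_domain W \<and>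
     g holomorphic_on U \<and> (\<forall>z\<in>W. g z = f z) \<and>
     (\<forall>y. a < y \<and> y < b \<longrightarrow> g (Complex 1 y) = exp (\<i> * of_real \<eta>) * g (Complex 0 y))}"

definition A2_eta :: "real \<Rightarrow> real \<Rightarrow> complex set \<Rightarrow> real \<Rightarrow> (complex \<Rightarrow> complex) set" where
  "A2_eta a b W \<eta> =
     {f \<in> A2 W. \<forall>\<epsilon>>0. \<exists>g\<in>A2_ext a b W \<eta>. L2_norm W (\<lambda>z. f z - g z) < \<epsilon>}"

definition is_orthogonal_projection ::
    "complex set \<Rightarrow> (complex \<Rightarrow> complex) set \<Rightarrow> (complex \<Rightarrow> complex) \<Rightarrow> (complex \<Rightarrow> complex) \<Rightarrow> bool" where
  "is_orthogonal_projection W V f h \<longleftrightarrow>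
     h \<in> V \<and> (\<forall>g\<in>V. L2_inner W (\<lambda>z. f z - h z) g = 0)"

text \<open>The defining property of \<open>K\<^sub>\<eta>\<close>: the integral operator with kernel \<open>K\<close> is the
  orthogonal projection onto \<open>A\<^sup>2\<^sub>\<eta>(W)\<close>. This determines each \<open>K z\<close> only as an element of \<open>L\<^sup>2(W)\<close>,
  i.e. almost everywhere; the continuity clause selects the representative for which pointwise
  values make sense.\<close>

definition is_projection_kernel ::
    "real \<Rightarrow> real \<Rightarrow> complex set \<Rightarrow> real \<Rightarrow> (complex \<Rightarrow> complex \<Rightarrow> complex) \<Rightarrow> bool" where
  "is_projection_kernel a b W \<eta> K \<longleftrightarrow>
     (\<forall>z\<in>W. K z \<in> L2 W \<and> continuous_on W (K z)) \<and>
     (\<forall>f\<in>L2 W. is_orthogonal_projection W (A2_eta a b W \<eta>) f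
        (\<lambda>z. LINT w|lebesgue_on W. K z w * f w))"


section \<open>Conformal maps\<close>

definition E :: "complex \<Rightarrow> complex" where
  "E z = exp (\<i> * 2 * of_real pi * z)"

definition ring_domain :: "real \<Rightarrow> real \<Rightarrow> complex set \<Rightarrow> complex set" where
  "ring_domain a b W = E ` (W \<union> J_plus a b \<union> J_minus a b)"

definition annulus :: "real \<Rightarrow> complex set" where
  "annulus \<rho> = {z. 1 / \<rho> < norm z \<and> norm z < \<rho>}"

definition positive_axis :: "complex set" where
  "positive_axis = complex_of_real ` {0<..}"

text \<open>For a bounded doubly connected \<open>D\<close>, the bounded component of the complement is \<open>inside D\<close> and
  the unbounded one is \<open>outside D\<close>; their frontiers are the inner and the outer boundary component.\<close>

definition conformal_onto_annulus :: "complex set \<Rightarrow> real \<Rightarrow> (complex \<Rightarrow> complex) \<Rightarrow> bool" where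
  "conformal_onto_annulus D \<rho> \<phi> \<longleftrightarrow>
     \<phi> holomorphic_on D \<and> bij_betw \<phi> D (annulus \<rho>) \<and>
     (\<forall>p\<in>frontier (inside D). ((\<lambda>z. norm (\<phi> z)) \<longlongrightarrow> 1 / \<rho>) (at p within D)) \<and>
     (\<forall>p\<in>frontier (outside D). ((\<lambda>z. norm (\<phi> z)) \<longlongrightarrow> \<rho>) (at p within D))"

definition Gamma_curve :: "real \<Rightarrow> real \<Rightarrow> complex set \<Rightarrow> (complex \<Rightarrow> complex) \<Rightarrow> complex set" where
  "Gamma_curve a b W \<phi> = \<phi> ` (ring_domain a b W \<inter> positive_axis)"

definition assumption_A :: "real \<Rightarrow> real \<Rightarrow> complex set \<Rightarrow> (complex \<Rightarrow> complex) \<Rightarrow> bool" where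
  "assumption_A a b W \<phi> \<longleftrightarrow>
     (\<exists>\<delta>. 0 < \<delta> \<and> \<delta> < 1 \<and> Gamma_curve a b W \<phi> \<subseteq> {z. \<delta> < Arg z \<and> Arg z < pi - \<delta>})"

definition cell_right :: "complex set \<Rightarrow> complex set" where
  "cell_right W = W \<inter> {z. Re z \<ge> 1/2}"

definition cell_left :: "complex set \<Rightarrow> complex set" where
  "cell_left W = W - cell_right W"

text \<open>The function \<open>\<theta>\<close> is the branch of the argument on the slit annulus \<open>\<phi> ` E ` W\<close>.\<close>

definition is_arg_branch ::
    "real \<Rightarrow> real \<Rightarrow> complex set \<Rightarrow> (complex \<Rightarrow> complex) \<Rightarrow> (complex \<Rightarrow> real) \<Rightarrow> bool" where
  "is_arg_branch a b W \<phi> \<theta> \<longleftrightarrow>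
     continuous_on (\<phi> ` E ` W) \<theta> \<and>
     (\<forall>z\<in>\<phi> ` E ` W. z = of_real (norm z) * cis (\<theta> z) \<and> \<theta> z \<in> {0..3*pi}) \<and>
     (\<forall>p\<in>Gamma_curve a b W \<phi>. \<forall>\<^sub>F z in nhds p.
        (z \<in> \<phi> ` E ` cell_left W \<longrightarrow> \<theta> z < pi) \<and>
        (z \<in> \<phi> ` E ` cell_right W \<longrightarrow> \<theta> z > 2 * pi))"

definition log_branch :: "(complex \<Rightarrow> real) \<Rightarrow> complex \<Rightarrow> complex" where
  "log_branch \<theta> z = of_real (ln (norm z)) + \<i> * of_real (\<theta> z)"

definition varphi :: "(complex \<Rightarrow> complex) \<Rightarrow> (complex \<Rightarrow> real) \<Rightarrow> complex \<Rightarrow> complex" where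
  "varphi \<phi> \<theta> z = 1 / (\<i> * 2 * of_real pi) * log_branch \<theta> (\<phi> (E z))"


section \<open>Ingredients of the kernel formula\<close>

definition K_tilde :: "(complex \<Rightarrow> complex) \<Rightarrow> complex \<Rightarrow> complex \<Rightarrow> complex" where
  "K_tilde \<phi> z w = 4 * of_real pi ^ 2 * exp (\<i> * 2 * of_real pi * (z - cnj w)) *
     deriv \<phi> (E z) * cnj (deriv \<phi> (E w))"

definition kernel_coeff :: "real \<Rightarrow> real \<Rightarrow> int \<Rightarrow> real" where
  "kernel_coeff \<rho> \<eta> n =
     (if \<eta> = 0 \<and> n = 0 then 1 / (4 * pi * ln \<rho>)
      else (2 * of_int n + \<eta> / pi) /
           (2 * pi * (\<rho> powr (2 * of_int n + \<eta> / pi) - \<rho> powr (- 2 * of_int n - \<eta> / pi))))"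

end

theory Submission
  imports Defs
begin

text \<open>Let \<open>\<Lambda>\<close> be the holomorphic branch of \<open>log (\<phi> (E z))\<close> on the periodic domain with
  \<open>\<Lambda> (z + 1) = \<Lambda> z + 2 * pi * \<i>\<close>. The functions \<open>\<Lambda>' * exp ((n + \<eta> / (2 * pi)) * \<Lambda>)\<close>, with \<open>n\<close> an
  integer, are \<open>\<eta>\<close>-quasiperiodic. The substitution \<open>s = \<Lambda> z\<close> (modulo \<open>2 * pi * \<i>\<close>) turns the inner
  product of \<open>L\<^sup>2(W)\<close> into an integral over the rectangle \<open>]-ln \<rho>, ln \<rho>[ \<times> ]0, 2 * pi[\<close>, where these
  functions become exponentials; they are therefore orthogonal, and the reciprocals of their squared
  norms are the coefficients of the formula. A quasiperiodic \<open>g\<close> is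
  \<open>\<Lambda>' * exp (\<eta> * \<Lambda> / (2 * pi))\<close> times a function \<open>h (\<phi> (E z))\<close> with \<open>h\<close> holomorphic on the
  annulus. Its Fourier coefficients are the Laurent coefficients of \<open>h\<close>, so its Fourier series
  converges pointwise to \<open>g\<close>; this is the completeness of the system, and the projection kernel is the
  reproducing kernel of the orthonormal system.\<close>

text \<open>The argument on \<open>W\<close> may take any values in \<open>{0..3*pi}\<close>, so
  \<open>\<Lambda>\<close> need not map \<open>W\<close> into the rectangle. The integrals involve
  only the derivative of the logarithm and functions of its exponential, and neither sees a locally
  constant multiple of \<open>2 * pi * \<i>\<close>; hence \<open>\<Lambda>\<close> may be exchanged
  there for a logarithm \<open>\<Lambda>0\<close> cut along the positive axis. Assumption (A) keeps
  \<Gamma> in the upper half plane and acts twice: the branch continues across the integer lines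
  with increment exactly \<open>2 * pi * \<i>\<close>, and \<Gamma> stays off the cut of
  \<open>\<Lambda>0\<close>, so that its image is a null set. The Lipschitz condition permits the
  gluing of cells: \<open>W\<close> fills half discs at the points of its vertical sides, and no
  further boundary point of \<open>W\<close> is interior to the periodic domain. Completeness is
  verified for \<open>A2_ext\<close> only, whose closure is \<open>A2_eta\<close>; it is proved
  pointwise, and convergence in norm is deduced from it. Absolute convergence makes it harmless that
  the integers are enumerated by \<open>int_decode\<close>, which allows the use of series over
  \<open>nat\<close>.\<close>

section \<open>Change of variables in the plane\<close>

unbundle no fps_syntax

text \<open>The substitution rule with Jacobian determinants concerns \<open>real^2\<close>; this
  identification carries the area measure of the complex plane over to it. Agreement on boxes
  suffices, because boxes determine Lebesgue measure.\<close>

lemma lborel_distr_vec2: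
  "distr lborel borel (\<lambda>v::real^2. Complex (v $ 1) (v $ 2)) = lborel"
proof (rule lborel_eqI[symmetric])
  fix l u :: complex
  assume le: "\<And>b. b \<in> Basis \<Longrightarrow> l \<bullet> b \<le> u \<bullet> b"
  have 1: "Re l \<le> Re u" "Im l \<le> Im u"
    using le[of 1] le[of \<i>] by (auto simp: Basis_complex_def)
  have eq: "(\<lambda>v::real^2. Complex (v $ 1) (v $ 2)) -` box l u
      = box (vector [Re l, Im l]) (vector [Re u, Im u])"
    by (auto simp: box_def Basis_complex_def Basis_vec_def inner_axis forall_2 exhaust_2)
  have meas: "(\<lambda>v::real^2. Complex (v $ 1) (v $ 2)) \<in> borel_measurable borel"
    by (intro borel_measurable_continuous_onI)
       (auto simp: Complex_eq intro!: continuous_intros)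
  have "emeasure (distr lborel borel (\<lambda>v::real^2. Complex (v $ 1) (v $ 2))) (box l u)
      = emeasure lborel (box (vector [Re l, Im l]) (vector [Re u, Im u]) :: (real^2) set)"
    using meas by (subst emeasure_distr) (auto simp: eq)
  also have "\<dots> = ennreal ((Re u - Re l) * (Im u - Im l))"
    using 1
    by (subst emeasure_lborel_box)
       (auto simp: Basis_vec_def inner_axis forall_2 exhaust_2 UNION_singleton_eq_range 
          prod.reindex inj_on_def axis_eq_axis UNIV_2)
  also have "\<dots> = ennreal (\<Prod>b\<in>Basis. (u - l) \<bullet> b)"
    by (simp add: Basis_complex_def)
  finally show "emeasure (distr lborel borel (\<lambda>v::real^2. Complex (v $ 1) (v $ 2))) (box l u)
      = ennreal (\<Prod>b\<in>Basis. (u - l) \<bullet> b)" .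
qed auto

text \<open>Counterpart with a product measure, for iterated integrals over the rectangle.\<close>

lemma lborel_distr_Complex:
  "distr (lborel \<Otimes>\<^sub>M lborel) borel (\<lambda>(x, y). Complex x y) = lborel"
proof (rule lborel_eqI[symmetric])
  fix l u :: complex
  assume le: "\<And>b. b \<in> Basis \<Longrightarrow> l \<bullet> b \<le> u \<bullet> b"
  have 1: "Re l \<le> Re u" "Im l \<le> Im u"
    using le[of 1] le[of \<i>] by (auto simp: Basis_complex_def)
  have eq: "(\<lambda>(x, y). Complex x y) -` box l u = {Re l<..<Re u} \<times> {Im l<..<Im u}"
    by (auto simp: box_def Basis_complex_def)
  have meas: "(\<lambda>(x, y). Complex x y) \<in> borel_measurable (borel :: (real \<times> real) measure)"
    by (intro borel_measurable_continuous_onI)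
       (auto simp: Complex_eq case_prod_beta intro!: continuous_intros)
  have "emeasure (distr (lborel \<Otimes>\<^sub>M lborel) borel (\<lambda>(x, y). Complex x y)) (box l u)
      = emeasure (lborel \<Otimes>\<^sub>M lborel) ({Re l<..<Re u} \<times> {Im l<..<Im u})"
    using meas by (subst emeasure_distr) (auto simp: eq lborel_prod)
  also have "\<dots> = ennreal (\<Prod>b\<in>Basis. (u - l) \<bullet> b)"
    using 1 by (subst lborel.emeasure_pair_measure_Times)
      (auto simp: Basis_complex_def ennreal_mult)
  finally show "emeasure (distr (lborel \<Otimes>\<^sub>M lborel) borel (\<lambda>(x, y). Complex x y)) (box l u)
      = ennreal (\<Prod>b\<in>Basis. (u - l) \<bullet> b)" .
qed auto

text \<open>Image measures and Fubini's theorem are applied to Borel measures, while the function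
  spaces use completed Lebesgue measure. Continuity on an open set makes the extension by zero Borel
  measurable, and then the completion changes neither integrability nor the integral.\<close>

lemma integral_lebesgue_on_eq_lborel:
  fixes G :: "'a::euclidean_space \<Rightarrow> 'b::{banach, second_countable_topology}"
  assumes "open S" "continuous_on S G"
  shows "integrable (lebesgue_on S) G \<longleftrightarrow> integrable lborel (\<lambda>x. indicator S x *\<^sub>R G x)"
    and "integral\<^sup>L (lebesgue_on S) G = integral\<^sup>L lborel (\<lambda>x. indicator S x *\<^sub>R G x)"
proof -
  have m: "(\<lambda>x. indicator S x *\<^sub>R G x) \<in> borel_measurable lborel"
    using assms by (auto intro!: borel_measurable_continuous_on_indicator)
  show "integrable (lebesgue_on S) G \<longleftrightarrow> integrable lborel (\<lambda>x. indicator S x *\<^sub>R G x)"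
    using assms m by (subst integrable_restrict_space) (auto simp: set_integrable_def integrable_completion)
  show "integral\<^sup>L (lebesgue_on S) G = integral\<^sup>L lborel (\<lambda>x. indicator S x *\<^sub>R G x)"
    using assms m by (subst integral_restrict_space) (auto simp: set_lebesgue_integral_def integral_completion)
qed

lemma integral_lebesgue_on_vec2:
  fixes G :: "complex \<Rightarrow> 'b::{banach, second_countable_topology}"
  defines "T \<equiv> (\<lambda>v::real^2. Complex (v $ 1) (v $ 2))"
  assumes "open S" "continuous_on S G"
  shows "integrable (lebesgue_on S) G \<longleftrightarrow> integrable (lebesgue_on (T -` S)) (G \<circ> T)"
    and "integral\<^sup>L (lebesgue_on S) G = integral\<^sup>L (lebesgue_on (T -` S)) (G \<circ> T)"
proof -
  have cT: "continuous_on A T" for A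
    unfolding T_def by (auto simp: Complex_eq intro!: continuous_intros)
  then have mT: "T \<in> borel_measurable lborel"
    by (simp add: borel_measurable_continuous_onI)
  have oT: "open (T -` S)"
    using assms(2) cT[of UNIV] by (simp add: open_vimage)
  have cG: "continuous_on (T -` S) (G \<circ> T)"
    by (rule continuous_on_compose[OF cT]) (rule continuous_on_subset[OF assms(3)], auto)
  have m: "(\<lambda>x. indicator S x *\<^sub>R G x) \<in> borel_measurable borel"
    using assms by (auto intro!: borel_measurable_continuous_on_indicator)
  have d: "lborel = distr lborel borel T"
    unfolding T_def by (rule lborel_distr_vec2[symmetric])
  have ind: "(\<lambda>x. indicator (T -` S) x *\<^sub>R (G \<circ> T) x) = (\<lambda>x. indicator S (T x) *\<^sub>R G (T x))"
    by (auto simp: indicator_def)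
  show "integrable (lebesgue_on S) G \<longleftrightarrow> integrable (lebesgue_on (T -` S)) (G \<circ> T)"
    unfolding integral_lebesgue_on_eq_lborel(1)[OF assms(2,3)] integral_lebesgue_on_eq_lborel(1)[OF oT cG] ind
    by (subst d) (rule integrable_distr_eq, use mT m in auto)
  show "integral\<^sup>L (lebesgue_on S) G = integral\<^sup>L (lebesgue_on (T -` S)) (G \<circ> T)"
    unfolding integral_lebesgue_on_eq_lborel(2)[OF assms(2,3)] integral_lebesgue_on_eq_lborel(2)[OF oT cG] ind
    by (subst d) (rule integral_distr, use mT m in auto)
qed

text \<open>Multiplication by a complex number is a linear map of the plane whose determinant is the
  squared modulus, so this is the real Jacobian of a holomorphic map. Integrability is an
  equivalence since it is transported in both directions: to the cell in order to see that the basis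
  functions are square integrable, and to the rectangle before Fubini's theorem.\<close>

lemma holomorphic_change_of_variables:
  assumes "open S" and holf: "f holomorphic_on S" and inj: "inj_on f S"
    and contF: "continuous_on (f ` S) F"
  shows "integrable (lebesgue_on S) (\<lambda>z. (norm (deriv f z))\<^sup>2 *\<^sub>R F (f z)) \<longleftrightarrow>
           integrable (lebesgue_on (f ` S)) (F :: complex \<Rightarrow> complex)"
    and "integral\<^sup>L (lebesgue_on S) (\<lambda>z. (norm (deriv f z))\<^sup>2 *\<^sub>R F (f z)) =
           integral\<^sup>L (lebesgue_on (f ` S)) F"
proof -
  define T where "T = (\<lambda>v::real^2. Complex (v $ 1) (v $ 2))"
  define V :: "complex \<Rightarrow> real^2" where "V = (\<lambda>z. \<chi> i. if i = 1 then Re z else Im z)"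
  have TV: "T (V z) = z" for z
    by (simp add: T_def V_def)
  have VT: "V (T x) = x" for x
    by (simp add: T_def V_def vec_eq_iff forall_2)
  have blV: "bounded_linear V"
    by (rule linear_conv_bounded_linear[THEN iffD1])
       (auto simp: V_def linear_iff vec_eq_iff)
  have blT: "bounded_linear T"
    by (rule linear_conv_bounded_linear[THEN iffD1])
       (auto simp: T_def linear_iff complex_eq_iff)
  define S' where "S' = T -` S"
  define g where "g = (\<lambda>x. V (f (T x)))"
  define g' where "g' = (\<lambda>x h. V (deriv f (T x) * T h))"
  define jac where "jac = (\<lambda>x. \<bar>det (matrix (g' x))\<bar>)"
  have jac: "jac x = (norm (deriv f (T x)))\<^sup>2" for x
  proof -
    have n: "(norm w)\<^sup>2 = Re w * Re w + Im w * Im w" for w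
      using cmod_power2[of w] by (simp only: power2_eq_square)
    show ?thesis
      unfolding jac_def g'_def n
      by (simp add: det_2 matrix_def V_def T_def axis_def)
  qed
  have opS': "open S'"
    unfolding S'_def using blT \<open>open S\<close> by (intro open_vimage) (auto intro: linear_continuous_on)
  have der: "(g has_derivative g' x) (at x within S')" if "x \<in> S'" for x
  proof -
    have "(f has_field_derivative deriv f (T x)) (at (T x))"
      using holf \<open>open S\<close> that holomorphic_derivI unfolding S'_def by blast
    then have f: "(f has_derivative (*) (deriv f (T x))) (at (T x))"
      by (simp add: has_field_derivative_def)
    have "(g has_derivative g' x) (at x)"
      unfolding g_def g'_def
      by (rule bounded_linear.has_derivative[OF blV has_derivative_compose[OF bounded_linear_imp_has_derivative[OF blT] f]])
    then show ?thesis
      by (rule has_derivative_at_withinI)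
  qed
  have injg: "inj_on g S'"
    by (rule inj_onI) (metis S'_def TV VT g_def inj inj_onD vimageE)
  have img: "g ` S' = T -` (f ` S)"
    unfolding g_def S'_def by (auto simp: TV image_iff) (metis TV VT vimageI)
  have opfS: "open (f ` S)"
    using open_mapping_thm3 holf inj \<open>open S\<close> by blast
  have contf: "continuous_on S f"
    using holf holomorphic_on_imp_continuous_on by blast
  have contd: "continuous_on S (deriv f)"
    by (simp add: \<open>open S\<close> holf holomorphic_deriv holomorphic_on_imp_continuous_on)
  define G where "G = (\<lambda>z. (norm (deriv f z))\<^sup>2 *\<^sub>R F (f z))"
  have contG: "continuous_on S G"
    unfolding G_def
    by (intro continuous_intros contd continuous_on_compose2[OF contF contf]) auto
  \<comment> \<open>The substitution rule is applied to functions with values in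
    \<open>real^2\<close> as well, hence the outer \<open>V\<close>. As \<open>V\<close> has the
    bounded inverse \<open>T\<close>, integrability is unaffected.\<close>
  have intV: "integrable M (\<lambda>x. V (u x)) \<longleftrightarrow> integrable M u"
    for M :: "(real^2) measure" and u :: "real^2 \<Rightarrow> complex"
    using integrable_bounded_linear[OF blV, of M u] integrable_bounded_linear[OF blT, of M "\<lambda>x. V (u x)"]
    by (auto simp: TV)
  have key: "((\<lambda>x. jac x *\<^sub>R V (F (T (g x)))) absolutely_integrable_on S' \<and>
           integral S' (\<lambda>x. jac x *\<^sub>R V (F (T (g x)))) = b
     \<longleftrightarrow> (\<lambda>x. V (F (T x))) absolutely_integrable_on (g ` S') \<and> integral (g ` S') (\<lambda>x. V (F (T x))) = b)" for b
    unfolding jac_def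
    by (rule has_absolute_integral_change_of_variables[OF _ der injg]) (use opS' in auto)
  have e1: "(\<lambda>x. jac x *\<^sub>R V (F (T (g x)))) = (\<lambda>x. V ((G \<circ> T) x))"
    by (auto simp: fun_eq_iff jac g_def TV G_def linear_cmul[OF bounded_linear.linear[OF blV]])
  have e2: "(\<lambda>x. V (F (T x))) = (\<lambda>x. V ((F \<circ> T) x))"
    by auto
  have ai: "u absolutely_integrable_on A \<longleftrightarrow> integrable (lebesgue_on A) u"
    if "open A" for A and u :: "real^2 \<Rightarrow> real^2"
    using that by (subst integrable_restrict_space) (auto simp: set_integrable_def)
  have opg: "open (g ` S')"
    unfolding img using blT opfS by (intro open_vimage) (auto intro: linear_continuous_on)
  have key': "integrable (lebesgue_on S') (G \<circ> T) \<and> integral S' (\<lambda>x. V ((G \<circ> T) x)) = b \<longleftrightarrow>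
      integrable (lebesgue_on (g ` S')) (F \<circ> T) \<and> integral (g ` S') (\<lambda>x. V ((F \<circ> T) x)) = b" for b
    using key[of b] unfolding e1 e2 ai[OF opS'] ai[OF opg] intV .
  then have iff: "integrable (lebesgue_on S') (G \<circ> T) \<longleftrightarrow> integrable (lebesgue_on (g ` S')) (F \<circ> T)"
    by blast
  show "integrable (lebesgue_on S) (\<lambda>z. (norm (deriv f z))\<^sup>2 *\<^sub>R F (f z)) \<longleftrightarrow>
           integrable (lebesgue_on (f ` S)) F"
    using iff unfolding G_def[symmetric]
    using integral_lebesgue_on_vec2(1)[OF \<open>open S\<close> contG] integral_lebesgue_on_vec2(1)[OF opfS contF]
    by (simp add: T_def[symmetric] img S'_def[symmetric])
  have "integral\<^sup>L (lebesgue_on S') (G \<circ> T) = integral\<^sup>L (lebesgue_on (g ` S')) (F \<circ> T)"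
  proof (cases "integrable (lebesgue_on S') (G \<circ> T)")
    case True
    have l: "integral A (\<lambda>x. V (u x)) = V (integral\<^sup>L (lebesgue_on A) u)"
      if "open A" "integrable (lebesgue_on A) u" for A and u :: "real^2 \<Rightarrow> complex"
    proof -
      have "integral A (\<lambda>x. V (u x)) = integral\<^sup>L (lebesgue_on A) (\<lambda>x. V (u x))"
        using that intV[of "lebesgue_on A" u]
        by (intro lebesgue_integral_eq_integral[symmetric]) auto
      then show ?thesis
        using integral_bounded_linear[OF blV that(2)] by simp
    qed
    have "integral S' (\<lambda>x. V ((G \<circ> T) x)) = integral (g ` S') (\<lambda>x. V ((F \<circ> T) x))"
      using key' True by blast
    then have "V (integral\<^sup>L (lebesgue_on S') (G \<circ> T)) = V (integral\<^sup>L (lebesgue_on (g ` S')) (F \<circ> T))"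
      unfolding l[OF opS' True] l[OF opg iff[THEN iffD1, OF True]] .
    then show ?thesis
      by (metis TV)
  next
    \<comment> \<open>Neither function is integrable, so both integrals have the default value
      0.\<close>
    case False
    then show ?thesis
      using iff not_integrable_integral_eq by metis
  qed
  then show "integral\<^sup>L (lebesgue_on S) (\<lambda>z. (norm (deriv f z))\<^sup>2 *\<^sub>R F (f z)) =
           integral\<^sup>L (lebesgue_on (f ` S)) F"
    unfolding G_def[symmetric]
    using integral_lebesgue_on_vec2(2)[OF \<open>open S\<close> contG] integral_lebesgue_on_vec2(2)[OF opfS contF]
    by (simp add: T_def[symmetric] img S'_def[symmetric])
qed

text \<open>The logarithm matches the cell with the rectangle only up to null sets; this removes the
  defects.\<close>

lemma integrable_lebesgue_on_negligible_diff:
  fixes F :: "'a::euclidean_space \<Rightarrow> 'b::euclidean_space"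
  assumes "S \<in> sets lebesgue" "T \<in> sets lebesgue" "T \<subseteq> S" "negligible (S - T)"
  shows "integrable (lebesgue_on S) F \<longleftrightarrow> integrable (lebesgue_on T) F"
    and "integral\<^sup>L (lebesgue_on S) F = integral\<^sup>L (lebesgue_on T) F"
proof -
  have neg: "negligible {x \<in> T - S. F x \<noteq> 0}" "negligible {x \<in> S - T. F x \<noteq> 0}"
    using assms by (auto intro: negligible_subset)
  have ai: "F absolutely_integrable_on A \<longleftrightarrow> integrable (lebesgue_on A) F"
    if "A \<in> sets lebesgue" for A
    using that by (subst integrable_restrict_space) (auto simp: set_integrable_def)
  show iff: "integrable (lebesgue_on S) F \<longleftrightarrow> integrable (lebesgue_on T) F"
    using absolutely_integrable_spike_set_eq[OF neg(2,1)] ai assms(1,2) by metis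
  show "integral\<^sup>L (lebesgue_on S) F = integral\<^sup>L (lebesgue_on T) F"
  proof (cases "integrable (lebesgue_on S) F")
    case True
    then show ?thesis
      using iff integral_spike_set[OF neg(2,1)] assms(1,2)
      by (simp add: lebesgue_integral_eq_integral)
  next
    case False
    then show ?thesis
      using iff not_integrable_integral_eq by metis
  qed
qed

lemma Fubini_rectangle:
  fixes F :: "complex \<Rightarrow> 'b::{banach, second_countable_topology}" and a b c d :: real
  defines "R \<equiv> {z. a < Re z \<and> Re z < b \<and> c < Im z \<and> Im z < d}"
  assumes "integrable (lebesgue_on R) F" "continuous_on R F"
  shows "integral\<^sup>L (lebesgue_on R) F = 
    (LINT x:{a<..<b}|lborel. (LINT y:{c<..<d}|lborel. F (Complex x y)))"
proof -
  have op: "open R"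
    unfolding R_def by (intro open_Collect_conj open_Collect_less continuous_intros)
  have int: "integrable lborel (\<lambda>x. indicator R x *\<^sub>R F x)"
    using assms(2,3) op integral_lebesgue_on_eq_lborel(1) by blast
  have m: "(\<lambda>(x, y). Complex x y) \<in> borel_measurable (lborel \<Otimes>\<^sub>M lborel)"
  proof -
    have "(\<lambda>(x, y). Complex x y) \<in> borel_measurable (borel :: (real \<times> real) measure)"
      by (intro borel_measurable_continuous_onI)
         (auto simp: Complex_eq case_prod_beta intro!: continuous_intros)
    then show ?thesis
      by (simp add: lborel_prod)
  qed
  have mF: "(\<lambda>x. indicator R x *\<^sub>R F x) \<in> borel_measurable borel"
    using int by auto
  note d = lborel_distr_Complex[symmetric]
  have int2: "integrable (lborel \<Otimes>\<^sub>M lborel) (\<lambda>(x, y). indicator R (Complex x y) *\<^sub>R F (Complex x y))"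
    using int integrable_distr_eq[OF m mF] unfolding d[symmetric] by (simp add: case_prod_unfold)
  have "integral\<^sup>L (lebesgue_on R) F = integral\<^sup>L lborel (\<lambda>x. indicator R x *\<^sub>R F x)"
    using assms(3) op integral_lebesgue_on_eq_lborel(2) by blast
  also have "\<dots> = integral\<^sup>L (lborel \<Otimes>\<^sub>M lborel) (\<lambda>(x, y). indicator R (Complex x y) *\<^sub>R F (Complex x y))"
    using integral_distr[OF m mF] unfolding d[symmetric] by (simp add: case_prod_unfold)
  also have "\<dots> = (LINT x|lborel. LINT y|lborel. indicator R (Complex x y) *\<^sub>R F (Complex x y))"
    using lborel_pair.integral_fst'[OF int2] by simp
  also have "\<dots> = (LINT x:{a<..<b}|lborel. (LINT y:{c<..<d}|lborel. F (Complex x y)))"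
    unfolding set_lebesgue_integral_def
    by (intro Bochner_Integration.integral_cong refl) (auto simp: R_def indicator_def)
  finally show ?thesis .
qed

section \<open>Orthonormal series in \<open>L\<^sup>2\<close>\<close>

lemma borel_measurable_cnj:
  "f \<in> borel_measurable M \<Longrightarrow> (\<lambda>x. cnj (f x)) \<in> borel_measurable M"
  by (rule measurable_compose[of f M borel cnj])
     (auto intro!: borel_measurable_continuous_onI continuous_intros)

lemma holomorphic_borel_measurable_lebesgue_on:
  assumes "open S" "f holomorphic_on S"
  shows "f \<in> borel_measurable (lebesgue_on S)"
  using assms by (intro continuous_imp_measurable_on_sets_lebesgue holomorphic_on_imp_continuous_on) auto

lemma L2_mult_integrable:
  assumes "f \<in> L2 S" "g \<in> L2 S"
  shows "integrable (lebesgue_on S) (\<lambda>z. f z * cnj (g z))"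
proof (rule Bochner_Integration.integrable_bound)
  show "integrable (lebesgue_on S) (\<lambda>z. (norm (f z))\<^sup>2 + (norm (g z))\<^sup>2)"
    using assms by (auto simp: L2_def)
  show "(\<lambda>z. f z * cnj (g z)) \<in> borel_measurable (lebesgue_on S)"
    using assms by (auto simp: L2_def intro!: borel_measurable_times borel_measurable_cnj)
  have "norm (f z * cnj (g z)) \<le> norm ((norm (f z))\<^sup>2 + (norm (g z))\<^sup>2)" for z
  proof -
    have "0 \<le> norm (f z) * norm (g z)"
      by simp
    then have "norm (f z) * norm (g z) \<le> (norm (f z))\<^sup>2 + (norm (g z))\<^sup>2"
      using sum_squares_bound[of "norm (f z)" "norm (g z)"] by linarith
    then show ?thesis
      by (simp add: norm_mult)
  qed
  then show "AE x in lebesgue_on S. norm (f x * cnj (g x)) \<le> norm ((norm (f x))\<^sup>2 + (norm (g x))\<^sup>2)"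
    by simp
qed

lemma L2_add:
  assumes "f \<in> L2 S" "g \<in> L2 S"
  shows "(\<lambda>z. f z + g z) \<in> L2 S"
proof -
  have "integrable (lebesgue_on S) (\<lambda>z. (norm (f z + g z))\<^sup>2)"
  proof (rule Bochner_Integration.integrable_bound)
    show "integrable (lebesgue_on S) (\<lambda>z. 2 * (norm (f z))\<^sup>2 + 2 * (norm (g z))\<^sup>2)"
      using assms by (auto simp: L2_def)
    show "(\<lambda>z. (norm (f z + g z))\<^sup>2) \<in> borel_measurable (lebesgue_on S)"
      using assms by (auto simp: L2_def)
    have "norm ((norm (f z + g z))\<^sup>2) \<le> norm (2 * (norm (f z))\<^sup>2 + 2 * (norm (g z))\<^sup>2)" for z
    proof -
      have "(norm (f z + g z))\<^sup>2 \<le> (norm (f z) + norm (g z))\<^sup>2"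
        by (simp add: norm_triangle_ineq power_mono)
      also have "\<dots> \<le> 2 * (norm (f z))\<^sup>2 + 2 * (norm (g z))\<^sup>2"
        using sum_squares_bound[of "norm (f z)" "norm (g z)"] by (simp add: power2_sum)
      finally show ?thesis
        by simp
    qed
    then show "AE z in lebesgue_on S. norm ((norm (f z + g z))\<^sup>2) \<le> norm (2 * (norm (f z))\<^sup>2 + 2 * (norm (g z))\<^sup>2)"
      by simp
  qed
  then show ?thesis
    using assms by (auto simp: L2_def)
qed

lemma L2_cmult: "f \<in> L2 S \<Longrightarrow> (\<lambda>z. c * f z) \<in> L2 S"
  by (auto simp: L2_def norm_mult power_mult_distrib)

lemma L2_cnj: "f \<in> L2 S \<Longrightarrow> (\<lambda>z. cnj (f z)) \<in> L2 S"
  by (auto simp: L2_def intro!: borel_measurable_cnj)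

lemma L2_diff:
  assumes "f \<in> L2 S" "g \<in> L2 S"
  shows "(\<lambda>z. f z - g z) \<in> L2 S"
  using L2_add[OF assms(1) L2_cmult[OF assms(2), of "-1"]] by simp

lemma L2_sum:
  assumes "\<And>i. i \<in> I \<Longrightarrow> f i \<in> L2 S"
  shows "(\<lambda>z. \<Sum>i\<in>I. f i z) \<in> L2 S"
  using assms
proof (induction I rule: infinite_finite_induct)
  case (insert i I)
  then show ?case
    using L2_add[of "f i" S "\<lambda>z. \<Sum>i\<in>I. f i z"] by simp
qed (simp_all add: L2_def)

lemma L2_inner_diff_left:
  assumes "f \<in> L2 S" "g \<in> L2 S" "h \<in> L2 S"
  shows "L2_inner S (\<lambda>z. f z - g z) h = L2_inner S f h - L2_inner S g h"
  unfolding L2_inner_def using L2_mult_integrable assms by (simp add: left_diff_distrib)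

lemma L2_inner_diff_right:
  assumes "f \<in> L2 S" "g \<in> L2 S" "h \<in> L2 S"
  shows "L2_inner S h (\<lambda>z. f z - g z) = L2_inner S h f - L2_inner S h g"
  unfolding L2_inner_def using L2_mult_integrable assms by (simp add: right_diff_distrib)

lemma L2_inner_cmult_left: "L2_inner S (\<lambda>z. c * f z) g = c * L2_inner S f g"
  unfolding L2_inner_def by (simp add: mult.assoc)

lemma L2_inner_cmult_right: "L2_inner S f (\<lambda>z. c * g z) = cnj c * L2_inner S f g"
  unfolding L2_inner_def by (simp add: mult.left_commute)

lemma L2_inner_sum_left:
  assumes "\<And>i. i \<in> I \<Longrightarrow> f i \<in> L2 S" "g \<in> L2 S"
  shows "L2_inner S (\<lambda>z. \<Sum>i\<in>I. f i z) g = (\<Sum>i\<in>I. L2_inner S (f i) g)"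
  unfolding L2_inner_def sum_distrib_right
  by (rule Bochner_Integration.integral_sum) (use assms L2_mult_integrable in auto)

lemma L2_inner_cnj: "cnj (L2_inner S f g) = L2_inner S g f"
  unfolding L2_inner_def by (simp add: mult.commute flip: Bochner_Integration.integral_cnj)

lemma L2_inner_sum_right:
  assumes "\<And>i. i \<in> I \<Longrightarrow> f i \<in> L2 S" "g \<in> L2 S"
  shows "L2_inner S g (\<lambda>z. \<Sum>i\<in>I. f i z) = (\<Sum>i\<in>I. L2_inner S g (f i))"
  using arg_cong[of _ _ cnj, OF L2_inner_sum_left[OF assms]] by (simp add: L2_inner_cnj)

lemma L2_inner_self: "L2_inner S f f = of_real (LINT z|lebesgue_on S. (norm (f z))\<^sup>2)"
  unfolding L2_inner_def by (simp add: integral_complex_of_real flip: complex_norm_square of_real_power)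

lemma L2_norm_power2: "(L2_norm S f)\<^sup>2 = (LINT z|lebesgue_on S. (norm (f z))\<^sup>2)"
  unfolding L2_norm_def by simp

lemma L2_norm_nonneg [simp]: "0 \<le> L2_norm S f"
  unfolding L2_norm_def by simp

lemma L2_inner_self_norm: "L2_inner S f f = of_real ((L2_norm S f)\<^sup>2)"
  by (simp add: L2_inner_self L2_norm_power2)

lemma L2_norm_diff_power2:
  assumes "f \<in> L2 S" "g \<in> L2 S"
  shows "(L2_norm S (\<lambda>z. f z - g z))\<^sup>2 = (L2_norm S f)\<^sup>2 - 2 * Re (L2_inner S f g) + (L2_norm S g)\<^sup>2"
proof -
  have "complex_of_real ((L2_norm S (\<lambda>z. f z - g z))\<^sup>2) =
      L2_inner S f f - L2_inner S g f - (L2_inner S f g - L2_inner S g g)"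
    using assms by (subst L2_inner_self_norm[symmetric]) (simp add: L2_diff L2_inner_diff_left L2_inner_diff_right)
  also have "L2_inner S g f = cnj (L2_inner S f g)"
    by (simp add: L2_inner_cnj)
  finally have "Re (complex_of_real ((L2_norm S (\<lambda>z. f z - g z))\<^sup>2)) =
      Re (L2_inner S f f - cnj (L2_inner S f g) - (L2_inner S f g - L2_inner S g g))"
    by (rule arg_cong)
  then show ?thesis
    by (simp add: L2_inner_self_norm)
qed

lemma L2_Cauchy_Schwarz:
  assumes "f \<in> L2 S" "g \<in> L2 S"
  shows "norm (L2_inner S f g) \<le> L2_norm S f * L2_norm S g"
proof -
  define c where "c = L2_inner S f g"
  define n where "n = (L2_norm S g)\<^sup>2"
  \<comment> \<open>The squared norm of \<open>f - t * c * g\<close>, a quadratic polynomial in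
    \<open>t\<close> that is never negative. The factor \<open>c\<close> makes its linear
    coefficient real.\<close>
  have *: "0 \<le> (L2_norm S f)\<^sup>2 - 2 * t * (norm c)\<^sup>2 + t\<^sup>2 * (norm c)\<^sup>2 * n" for t :: real
  proof -
    have "(L2_norm S (\<lambda>z. t * c * g z))\<^sup>2 = t\<^sup>2 * (norm c)\<^sup>2 * n"
      by (simp add: n_def L2_norm_power2 norm_mult power_mult_distrib)
    moreover have "Re (L2_inner S f (\<lambda>z. t * c * g z)) = t * (norm c)\<^sup>2"
      by (subst L2_inner_cmult_right, unfold cmod_power2)
         (simp add: c_def[symmetric] power2_eq_square algebra_simps)
    ultimately show ?thesis
      using L2_norm_diff_power2[OF assms(1) L2_cmult[OF assms(2), of "t * c"]]
      by (metis mult.assoc zero_le_power2)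
  qed
  have "(norm c)\<^sup>2 \<le> (L2_norm S f)\<^sup>2 * n"
  proof (cases "n = 0")
    case True
    have "c = 0"
    proof (rule ccontr)
      assume "c \<noteq> 0"
      \<comment> \<open>For \<open>n = 0\<close> the polynomial is affine in \<open>t\<close>. At
        this \<open>t\<close> its value would be minus the squared norm of \<open>f\<close>, minus
        2.\<close>
      then have "((L2_norm S f)\<^sup>2 + 1) / (norm c)\<^sup>2 * (norm c)\<^sup>2 = (L2_norm S f)\<^sup>2 + 1"
        by simp
      then have "0 \<le> (L2_norm S f)\<^sup>2 - 2 * ((L2_norm S f)\<^sup>2 + 1)"
        using *[of "((L2_norm S f)\<^sup>2 + 1) / (norm c)\<^sup>2"] unfolding True mult_zero_right add_0_right
        by (simp only: mult.assoc)
      then have "(L2_norm S f)\<^sup>2 + 2 \<le> 0"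
        by (simp add: algebra_simps)
      moreover have "(L2_norm S f)\<^sup>2 + 2 > 0"
        by (rule add_nonneg_pos) simp_all
      ultimately show False
        by linarith
    qed
    then show ?thesis
      using True by simp
  next
    case False
    then have "n > 0"
      unfolding n_def by simp
    then show ?thesis
      using *[of "1 / n"] by (simp add: field_simps power2_eq_square)
  qed
  then have "(norm c)\<^sup>2 \<le> (L2_norm S f * L2_norm S g)\<^sup>2"
    by (simp add: n_def power_mult_distrib)
  then show ?thesis
    unfolding c_def by (rule power2_le_imp_le) simp
qed

lemma L2_norm_diff_le:
  assumes "f \<in> L2 S" "g \<in> L2 S"
  shows "L2_norm S (\<lambda>z. f z - g z) \<le> L2_norm S f + L2_norm S g"
proof (rule power2_le_imp_le)
  have "\<bar>Re (L2_inner S f g)\<bar> \<le> L2_norm S f * L2_norm S g"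
    using L2_Cauchy_Schwarz[OF assms] abs_Re_le_cmod order_trans by blast
  then show "(L2_norm S (\<lambda>z. f z - g z))\<^sup>2 \<le> (L2_norm S f + L2_norm S g)\<^sup>2"
    unfolding L2_norm_diff_power2[OF assms] power2_sum by simp
qed simp

text \<open>The set where a continuous \<open>f\<close> does not vanish is open, and a nonempty open
  set is not negligible. This turns statements in L2 into statements about values at single
  points.\<close>

lemma L2_norm_eq_0_imp:
  assumes "f \<in> L2 S" "L2_norm S f = 0" "open S" "continuous_on S f" "z \<in> S"
  shows "f z = 0"
proof -
  have "(LINT z|lebesgue_on S. (norm (f z))\<^sup>2) = 0"
    using assms(2) L2_norm_power2[of S f] by simp
  then have "AE z in lebesgue_on S. f z = 0"
    using assms(1) by (subst (asm) integral_nonneg_eq_0_iff_AE) (auto simp: L2_def)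
  then have ae: "AE x in lebesgue. x \<in> S \<longrightarrow> f x = 0"
    using \<open>open S\<close> by (subst (asm) AE_restrict_space_iff) auto
  have op: "open {x \<in> S. f x \<noteq> 0}"
  proof -
    have "{x \<in> S. f x \<noteq> 0} = S \<inter> f -` (- {0})"
      by auto
    then show ?thesis
      using continuous_open_preimage[OF assms(4,3), of "- {0}"] open_delete[of UNIV 0]
      by (simp add: Compl_eq_Diff_UNIV)
  qed
  have "negligible {x \<in> S. f x \<noteq> 0}"
    unfolding negligible_iff_null_sets using ae op by (subst AE_iff_null_sets) auto
  then have "{x \<in> S. f x \<noteq> 0} = {}"
    using op open_not_negligible by blast
  then show ?thesis
    using assms(5) by blast
qed

section \<open>Orthonormal systems and pointwise convergent series\<close>

definition orthonormal_on :: "complex set \<Rightarrow> (nat \<Rightarrow> complex \<Rightarrow> complex) \<Rightarrow> bool" where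
  "orthonormal_on S e \<longleftrightarrow>
     (\<forall>k. e k \<in> L2 S) \<and> (\<forall>j k. L2_inner S (e j) (e k) = (if j = k then 1 else 0))"

lemma orthonormal_onD:
  assumes "orthonormal_on S e"
  shows "e k \<in> L2 S" "L2_inner S (e j) (e k) = (if j = k then 1 else 0)"
  using assms unfolding orthonormal_on_def by blast+

lemma orthonormal_combination_in_L2:
  "orthonormal_on S e \<Longrightarrow> (\<lambda>z. \<Sum>k\<in>I. c k * e k z) \<in> L2 S"
  by (intro L2_sum L2_cmult orthonormal_onD)

lemma L2_inner_orthonormal_combination:
  assumes "orthonormal_on S e" "finite I" "f \<in> L2 S"
  shows "L2_inner S f (\<lambda>z. \<Sum>k\<in>I. c k * e k z) = (\<Sum>k\<in>I. cnj (c k) * L2_inner S f (e k))"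
    and "L2_inner S (\<lambda>z. \<Sum>k\<in>I. c k * e k z) f = (\<Sum>k\<in>I. c k * L2_inner S (e k) f)"
proof -
  have 1: "(\<lambda>z. c k * e k z) \<in> L2 S" for k
    using assms(1) by (intro L2_cmult orthonormal_onD)
  show "L2_inner S f (\<lambda>z. \<Sum>k\<in>I. c k * e k z) = (\<Sum>k\<in>I. cnj (c k) * L2_inner S f (e k))"
    using assms(3) by (subst L2_inner_sum_right[OF 1]) (simp_all add: L2_inner_cmult_right)
  show "L2_inner S (\<lambda>z. \<Sum>k\<in>I. c k * e k z) f = (\<Sum>k\<in>I. c k * L2_inner S (e k) f)"
    using assms(3) by (subst L2_inner_sum_left[OF 1]) (simp_all add: L2_inner_cmult_left)
qed

lemma L2_norm_orthonormal_combination: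
  assumes "orthonormal_on S e" "finite I"
  shows "(L2_norm S (\<lambda>z. \<Sum>k\<in>I. c k * e k z))\<^sup>2 = (\<Sum>k\<in>I. (norm (c k))\<^sup>2)"
proof -
  have i: "L2_inner S (e k) (\<lambda>z. \<Sum>k\<in>I. c k * e k z) = cnj (c k)" if "k \<in> I" for k
  proof -
    have "L2_inner S (e k) (\<lambda>z. \<Sum>k\<in>I. c k * e k z) = (\<Sum>j\<in>I. if k = j then cnj (c j) else 0)"
      using assms by (simp add: L2_inner_orthonormal_combination orthonormal_onD if_distrib cong: if_cong)
    then show ?thesis
      using that assms(2) by simp
  qed
  have "complex_of_real ((L2_norm S (\<lambda>z. \<Sum>k\<in>I. c k * e k z))\<^sup>2) = (\<Sum>k\<in>I. c k * cnj (c k))"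
    unfolding L2_inner_self_norm[symmetric]
    using assms i orthonormal_combination_in_L2[OF assms(1), of c I]
    by (subst L2_inner_orthonormal_combination(2)) auto
  also have "\<dots> = complex_of_real (\<Sum>k\<in>I. (norm (c k))\<^sup>2)"
    by (simp only: complex_norm_square of_real_sum)
  finally show ?thesis
    using of_real_eq_iff by blast
qed

lemma Bessel_inequality:
  assumes "orthonormal_on S e" "finite I" "f \<in> L2 S"
  shows "(\<Sum>k\<in>I. (norm (L2_inner S f (e k)))\<^sup>2) \<le> (L2_norm S f)\<^sup>2"
proof -
  define c where "c = (\<lambda>k. L2_inner S f (e k))"
  define g where "g = (\<lambda>z. \<Sum>k\<in>I. c k * e k z)"
  have "L2_inner S f g = (\<Sum>k\<in>I. cnj (c k) * c k)"
    unfolding g_def c_def using assms by (subst L2_inner_orthonormal_combination(1)) auto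
  also have "\<dots> = complex_of_real (\<Sum>k\<in>I. (norm (c k))\<^sup>2)"
    by (simp only: complex_norm_square of_real_sum mult.commute)
  finally have fg: "Re (L2_inner S f g) = (\<Sum>k\<in>I. (norm (c k))\<^sup>2)"
    by simp
  have "0 \<le> (L2_norm S (\<lambda>z. f z - g z))\<^sup>2"
    by simp
  also have "\<dots> = (L2_norm S f)\<^sup>2 - 2 * Re (L2_inner S f g) + (L2_norm S g)\<^sup>2"
    using assms orthonormal_combination_in_L2 unfolding g_def by (intro L2_norm_diff_power2) auto
  also have "(L2_norm S g)\<^sup>2 = (\<Sum>k\<in>I. (norm (c k))\<^sup>2)"
    unfolding g_def using assms by (intro L2_norm_orthonormal_combination) auto
  finally show ?thesis
    unfolding fg c_def by linarith
qed

lemma Bessel_summable: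
  assumes "orthonormal_on S e" "f \<in> L2 S"
  shows "summable (\<lambda>k. (norm (L2_inner S f (e k)))\<^sup>2)"
  by (rule summableI_nonneg_bounded[where x = "(L2_norm S f)\<^sup>2"])
     (use Bessel_inequality[OF assms(1) _ assms(2)] in auto)

text \<open>Fatou's lemma replaces the completeness of \<open>L\<^sup>2\<close>, since all limits are given pointwise.\<close>

lemma L2_Fatou:
  assumes meas: "\<And>n. F n \<in> L2 S"
    and lim: "\<And>z. z \<in> S \<Longrightarrow> (\<lambda>n. F n z) \<longlonglongrightarrow> G z"
    and bound: "\<forall>\<^sub>F n in sequentially. (L2_norm S (F n))\<^sup>2 \<le> B" and S: "S \<in> sets lebesgue"
  shows "G \<in> L2 S" "(L2_norm S G)\<^sup>2 \<le> B"
proof -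
  obtain n where "(L2_norm S (F n))\<^sup>2 \<le> B"
    using eventually_happens[OF bound] by auto
  then have B: "B \<ge> 0"
    by (rule order_trans[OF zero_le_power2])
  have mF: "F n \<in> borel_measurable (lebesgue_on S)" for n
    using meas[of n] by (simp add: L2_def)
  have G: "G \<in> borel_measurable (lebesgue_on S)"
    by (rule borel_measurable_LIMSEQ_metric[where f = F]) (use mF lim in auto)
  have m: "(\<lambda>z. ennreal ((norm (F n z))\<^sup>2)) \<in> borel_measurable (lebesgue_on S)" for n
    using mF[of n] by measurable
  have "(\<integral>\<^sup>+z. ennreal ((norm (G z))\<^sup>2) \<partial>lebesgue_on S) =
        (\<integral>\<^sup>+z. liminf (\<lambda>n. ennreal ((norm (F n z))\<^sup>2)) \<partial>lebesgue_on S)"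
  proof (rule nn_integral_cong)
    fix z assume "z \<in> space (lebesgue_on S)"
    then have "(\<lambda>n. ennreal ((norm (F n z))\<^sup>2)) \<longlonglongrightarrow> ennreal ((norm (G z))\<^sup>2)"
      using lim by (intro tendsto_ennrealI tendsto_power tendsto_norm) auto
    then show "ennreal ((norm (G z))\<^sup>2) = liminf (\<lambda>n. ennreal ((norm (F n z))\<^sup>2))"
      by (intro lim_imp_Liminf[symmetric]) auto
  qed
  also have "\<dots> \<le> liminf (\<lambda>n. \<integral>\<^sup>+z. ennreal ((norm (F n z))\<^sup>2) \<partial>lebesgue_on S)"
    by (rule nn_integral_liminf[OF m])
  also have "\<dots> \<le> ennreal B"
  proof -
    have "(\<integral>\<^sup>+z. ennreal ((norm (F n z))\<^sup>2) \<partial>lebesgue_on S) = ennreal ((L2_norm S (F n))\<^sup>2)" for n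
      using meas[of n] unfolding L2_norm_power2 by (intro nn_integral_eq_integral) (auto simp: L2_def)
    then have "\<forall>\<^sub>F n in sequentially. (\<integral>\<^sup>+z. ennreal ((norm (F n z))\<^sup>2) \<partial>lebesgue_on S) \<le> ennreal B"
      using bound B by (auto elim!: eventually_mono simp: ennreal_leI)
    then show ?thesis
      by (intro order_trans[OF Liminf_le_Limsup[OF trivial_limit_sequentially] Limsup_bounded])
  qed
  finally have le: "(\<integral>\<^sup>+z. ennreal ((norm (G z))\<^sup>2) \<partial>lebesgue_on S) \<le> ennreal B" .
  have int: "integrable (lebesgue_on S) (\<lambda>z. (norm (G z))\<^sup>2)"
    using G le by (intro integrableI_bounded) (auto simp: le_less_trans)
  then show "G \<in> L2 S"
    using G by (simp add: L2_def)
  have "ennreal ((L2_norm S G)\<^sup>2) \<le> ennreal B"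
    using le int unfolding L2_norm_power2 by (subst nn_integral_eq_integral[symmetric]) auto
  then show "(L2_norm S G)\<^sup>2 \<le> B"
    using B by simp
qed

text \<open>Pointwise convergence is given, convergence in norm is derived. A block
  \<open>N..<n\<close> of the series has as its squared norm the same block of the coefficient
  series, which is at most the tail from \<open>N\<close> on; Fatou's lemma lets \<open>n\<close>
  tend to infinity.\<close>

lemma orthonormal_series_L2:
  assumes on: "orthonormal_on S e" and S: "S \<in> sets lebesgue"
    and c: "summable (\<lambda>k. (norm (c k))\<^sup>2)"
    and F: "\<And>z. z \<in> S \<Longrightarrow> (\<lambda>k. c k * e k z) sums F z"
  shows "F \<in> L2 S"
    and "(L2_norm S (\<lambda>z. F z - (\<Sum>k<N. c k * e k z)))\<^sup>2 \<le> (\<Sum>k. (norm (c (k + N)))\<^sup>2)"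
proof -
  have s: "summable (\<lambda>k. (norm (c (k + N)))\<^sup>2)"
    by (rule summable_ignore_initial_segment[OF c])
  have 1: "(\<lambda>z. (\<Sum>k=N..<n. c k * e k z)) \<in> L2 S" for n
    by (rule orthonormal_combination_in_L2[OF on])
  have 2: "(\<lambda>n. (\<Sum>k=N..<n. c k * e k z)) \<longlonglongrightarrow> F z - (\<Sum>k<N. c k * e k z)" if "z \<in> S" for z
  proof -
    have "(\<lambda>n. (\<Sum>k<n. c k * e k z) - (\<Sum>k<N. c k * e k z)) \<longlonglongrightarrow> F z - (\<Sum>k<N. c k * e k z)"
      using F[OF that] unfolding sums_def by (intro tendsto_intros)
    moreover have "\<forall>\<^sub>F n in sequentially. (\<Sum>k<n. c k * e k z) - (\<Sum>k<N. c k * e k z) = (\<Sum>k=N..<n. c k * e k z)"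
      using eventually_ge_at_top[of N]
    proof eventually_elim
      case (elim n)
      then show ?case
        using sum.atLeastLessThan_concat[of 0 N n "\<lambda>k. c k * e k z"] by (simp add: atLeast0LessThan algebra_simps)
    qed
    ultimately show ?thesis
      using tendsto_cong by fast
  qed
  have 3: "(L2_norm S (\<lambda>z. \<Sum>k=N..<n. c k * e k z))\<^sup>2 \<le> (\<Sum>k. (norm (c (k + N)))\<^sup>2)" for n
  proof -
    have "(L2_norm S (\<lambda>z. \<Sum>k=N..<n. c k * e k z))\<^sup>2 = (\<Sum>k=N..<n. (norm (c k))\<^sup>2)"
      by (rule L2_norm_orthonormal_combination[OF on]) auto
    also have "\<dots> = (\<Sum>k<n-N. (norm (c (k + N)))\<^sup>2)"
    proof (cases "N \<le> n")
      case True
      then show ?thesis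
        using sum.shift_bounds_nat_ivl[of "\<lambda>k. (norm (c k))\<^sup>2" 0 N "n - N"] by (simp add: atLeast0LessThan)
    qed auto
    also have "\<dots> \<le> (\<Sum>k. (norm (c (k + N)))\<^sup>2)"
      by (rule sum_le_suminf[OF s]) auto
    finally show ?thesis .
  qed
  have D: "(\<lambda>z. F z - (\<Sum>k<N. c k * e k z)) \<in> L2 S"
    by (rule L2_Fatou(1)[OF 1 2 _ S, where B = "\<Sum>k. (norm (c (k + N)))\<^sup>2"]) (use 3 in auto)
  show "(L2_norm S (\<lambda>z. F z - (\<Sum>k<N. c k * e k z)))\<^sup>2 \<le> (\<Sum>k. (norm (c (k + N)))\<^sup>2)"
    by (rule L2_Fatou(2)[OF 1 2 _ S]) (use 3 in auto)
  show "F \<in> L2 S"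
    using L2_add[OF D orthonormal_combination_in_L2[OF on, of c "{..<N}"]] by simp
qed

lemma orthonormal_series_tendsto:
  assumes on: "orthonormal_on S e" and S: "S \<in> sets lebesgue"
    and c: "summable (\<lambda>k. (norm (c k))\<^sup>2)"
    and F: "\<And>z. z \<in> S \<Longrightarrow> (\<lambda>k. c k * e k z) sums F z"
  shows "(\<lambda>N. L2_norm S (\<lambda>z. F z - (\<Sum>k<N. c k * e k z))) \<longlonglongrightarrow> 0"
proof -
  have lim: "(\<lambda>N. sqrt (\<Sum>k. (norm (c (k + N)))\<^sup>2)) \<longlonglongrightarrow> 0"
    using tendsto_real_sqrt[OF suminf_exist_split2[OF c]] by simp
  have le: "norm (L2_norm S (\<lambda>z. F z - (\<Sum>k<N. c k * e k z))) \<le> sqrt (\<Sum>k. (norm (c (k + N)))\<^sup>2)" for N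
    using orthonormal_series_L2(2)[OF assms] by (simp add: real_le_rsqrt)
  show ?thesis
    by (rule Lim_null_comparison[OF _ lim]) (use le in auto)
qed

lemma orthonormal_series_inner:
  assumes on: "orthonormal_on S e" and S: "S \<in> sets lebesgue"
    and c: "summable (\<lambda>k. (norm (c k))\<^sup>2)"
    and F: "\<And>z. z \<in> S \<Longrightarrow> (\<lambda>k. c k * e k z) sums F z"
    and g: "g \<in> L2 S"
  shows "(\<lambda>k. c k * L2_inner S (e k) g) sums L2_inner S F g"
  unfolding sums_def
proof (rule LIM_zero_cancel)
  have "(\<lambda>N. L2_norm S (\<lambda>z. F z - (\<Sum>k<N. c k * e k z)) * L2_norm S g) \<longlonglongrightarrow> 0"
    using tendsto_mult_right[OF orthonormal_series_tendsto[OF assms(1-4)], of "L2_norm S g"] by simp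
  then show "(\<lambda>N. (\<Sum>k<N. c k * L2_inner S (e k) g) - L2_inner S F g) \<longlonglongrightarrow> 0"
  proof (rule Lim_null_comparison[rotated], intro always_eventually allI)
    fix N
    have L: "F \<in> L2 S" "(\<lambda>z. \<Sum>k<N. c k * e k z) \<in> L2 S"
      using orthonormal_series_L2(1)[OF assms(1-4)] orthonormal_combination_in_L2[OF on] by auto
    have "(\<Sum>k<N. c k * L2_inner S (e k) g) - L2_inner S F g = - L2_inner S (\<lambda>z. F z - (\<Sum>k<N. c k * e k z)) g"
      using L g by (simp add: L2_inner_diff_left L2_inner_orthonormal_combination(2)[OF on])
    then show "norm ((\<Sum>k<N. c k * L2_inner S (e k) g) - L2_inner S F g)
        \<le> L2_norm S (\<lambda>z. F z - (\<Sum>k<N. c k * e k z)) * L2_norm S g"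
      using L2_Cauchy_Schwarz[OF L2_diff[OF L] g] by simp
  qed
qed

lemma summable_mult_of_square_summable:
  fixes c d :: "nat \<Rightarrow> complex"
  assumes "summable (\<lambda>k. (norm (c k))\<^sup>2)" "summable (\<lambda>k. (norm (d k))\<^sup>2)"
  shows "summable (\<lambda>k. norm (c k * d k))"
proof (rule summable_comparison_test')
  show "summable (\<lambda>k. (norm (c k))\<^sup>2 + (norm (d k))\<^sup>2)"
    by (intro summable_add assms)
  show "norm (norm (c k * d k)) \<le> (norm (c k))\<^sup>2 + (norm (d k))\<^sup>2" for k
  proof -
    have "0 \<le> norm (c k) * norm (d k)"
      by simp
    then have "norm (c k) * norm (d k) \<le> (norm (c k))\<^sup>2 + (norm (d k))\<^sup>2"
      using sum_squares_bound[of "norm (c k)" "norm (d k)"] by linarith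
    then show ?thesis
      by (simp add: norm_mult)
  qed
qed

text \<open>By the Cauchy-Schwarz inequality for sequences, the tail from \<open>n\<close> on is at
  most the square root of the tail of the squared coefficients times \<open>sqrt B\<close>,
  uniformly on a closed disc. So the partial sums converge locally uniformly. Bounding partial sums
  in \<open>bound\<close> avoids presupposing summability.\<close>

lemma orthonormal_series_holomorphic:
  assumes S: "open S" and hol: "\<And>k. e k holomorphic_on S"
    and bound: "\<And>C. compact C \<Longrightarrow> C \<subseteq> S \<Longrightarrow> \<exists>B. \<forall>z\<in>C. \<forall>N. (\<Sum>k<N. (norm (e k z))\<^sup>2) \<le> B"
    and c: "summable (\<lambda>k. (norm (c k))\<^sup>2)"
  shows "(\<lambda>z. \<Sum>k. c k * e k z) holomorphic_on S"
    and "z \<in> S \<Longrightarrow> summable (\<lambda>k. (norm (e k z))\<^sup>2)"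
proof -
  have *: "summable (\<lambda>k. (norm (e k z))\<^sup>2)" "(\<Sum>k. (norm (e k z))\<^sup>2) \<le> B"
    if "\<forall>N. (\<Sum>k<N. (norm (e k z))\<^sup>2) \<le> B" for z B
  proof -
    show "summable (\<lambda>k. (norm (e k z))\<^sup>2)"
      by (rule summableI_nonneg_bounded) (use that in auto)
    then show "(\<Sum>k. (norm (e k z))\<^sup>2) \<le> B"
      using that by (intro suminf_le_const) auto
  qed
  show "summable (\<lambda>k. (norm (e k z))\<^sup>2)" if "z \<in> S" for z
    using bound[of "{z}"] that * by auto
  show "(\<lambda>z. \<Sum>k. c k * e k z) holomorphic_on S"
  proof (rule holomorphic_uniform_sequence[OF S])
    show "(\<lambda>z. \<Sum>k<n. c k * e k z) holomorphic_on S" for n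
      by (intro holomorphic_intros hol)
    fix z assume "z \<in> S"
    then obtain d where d: "d > 0" "cball z d \<subseteq> S"
      using S open_contains_cball by blast
    obtain B where B: "\<And>w N. w \<in> cball z d \<Longrightarrow> (\<Sum>k<N. (norm (e k w))\<^sup>2) \<le> B"
      using bound[OF compact_cball d(2)] by blast
    have unif: "uniform_limit (cball z d) (\<lambda>n w. \<Sum>k<n. c k * e k w) (\<lambda>w. \<Sum>k. c k * e k w) sequentially"
    proof (rule uniform_limitI)
      fix \<epsilon> :: real assume "\<epsilon> > 0"
      define t where "t = (\<lambda>n. \<Sum>k. (norm (c (k + n)))\<^sup>2)"
      have "(\<lambda>n. sqrt (t n) * sqrt B) \<longlonglongrightarrow> sqrt 0 * sqrt B"
        unfolding t_def by (intro tendsto_intros suminf_exist_split2[OF c])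
      then have "\<forall>\<^sub>F n in sequentially. sqrt (t n) * sqrt B < \<epsilon>"
        using \<open>\<epsilon> > 0\<close> by (simp add: order_tendstoD(2))
      then show "\<forall>\<^sub>F n in sequentially. \<forall>w\<in>cball z d. dist (\<Sum>k<n. c k * e k w) (\<Sum>k. c k * e k w) < \<epsilon>"
      proof eventually_elim
        case (elim n)
        show ?case
        proof
          fix w assume w: "w \<in> cball z d"
          have sw: "summable (\<lambda>k. (norm (e k w))\<^sup>2)"
            using * B[OF w] by blast
          have sm: "summable (\<lambda>k. norm (c k * e k w))"
            by (rule summable_mult_of_square_summable[OF c sw])
          have le: "norm (\<Sum>k<m. c (k + n) * e (k + n) w) \<le> sqrt (t n) * sqrt B" for m
          proof -
            have "norm (\<Sum>k<m. c (k + n) * e (k + n) w) \<le> (\<Sum>k<m. \<bar>norm (c (k + n))\<bar> * \<bar>norm (e (k + n) w)\<bar>)"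
              by (rule sum_norm_le) (simp add: norm_mult)
            also have "\<dots> \<le> L2_set (\<lambda>k. norm (c (k + n))) {..<m} * L2_set (\<lambda>k. norm (e (k + n) w)) {..<m}"
              by (rule L2_set_mult_ineq)
            also have "\<dots> \<le> sqrt (t n) * sqrt B"
            proof (rule mult_mono)
              have "(\<Sum>k<m. (norm (c (k + n)))\<^sup>2) \<le> t n"
                unfolding t_def by (rule sum_le_suminf[OF summable_ignore_initial_segment[OF c]]) auto
              then show "L2_set (\<lambda>k. norm (c (k + n))) {..<m} \<le> sqrt (t n)"
                unfolding L2_set_def by simp
              have "(\<Sum>k<m. (norm (e (k + n) w))\<^sup>2) = (\<Sum>k=n..<n+m. (norm (e k w))\<^sup>2)"
                using sum.shift_bounds_nat_ivl[of "\<lambda>k. (norm (e k w))\<^sup>2" 0 n m] by (simp add: atLeast0LessThan add.commute)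
              also have "\<dots> \<le> (\<Sum>k<n+m. (norm (e k w))\<^sup>2)"
                by (rule sum_mono2) auto
              also have "\<dots> \<le> B"
                by (rule B[OF w])
              finally show "L2_set (\<lambda>k. norm (e (k + n) w)) {..<m} \<le> sqrt B"
                unfolding L2_set_def by simp
              show "0 \<le> sqrt (t n)"
                unfolding t_def by (simp add: suminf_nonneg summable_ignore_initial_segment[OF c])
            qed (simp add: L2_set_nonneg)
            finally show ?thesis .
          qed
          have "(\<lambda>m. \<Sum>k<m. c (k + n) * e (k + n) w) \<longlonglongrightarrow> (\<Sum>k. c (k + n) * e (k + n) w)"
            using summable_norm_cancel[OF sm] by (intro summable_LIMSEQ summable_ignore_initial_segment)
          then have "norm (\<Sum>k. c (k + n) * e (k + n) w) \<le> sqrt (t n) * sqrt B"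
            by (intro tendsto_upperbound[OF tendsto_norm]) (use le in auto)
          moreover have "(\<Sum>k. c k * e k w) = (\<Sum>k. c (k + n) * e (k + n) w) + (\<Sum>k<n. c k * e k w)"
            using suminf_split_initial_segment[OF summable_norm_cancel[OF sm], of n] by simp
          ultimately show "dist (\<Sum>k<n. c k * e k w) (\<Sum>k. c k * e k w) < \<epsilon>"
            using elim by (simp add: dist_norm)
        qed
      qed
    qed
    show "\<exists>d>0. cball z d \<subseteq> S \<and> uniform_limit (cball z d) (\<lambda>n w. \<Sum>k<n. c k * e k w) (\<lambda>w. \<Sum>k. c k * e k w) sequentially"
      using d unif by blast
  qed
qed

section \<open>Projection kernels\<close>

lemma A2_extD: "f \<in> A2_ext a b W \<eta> \<Longrightarrow> f \<in> L2 W" "f \<in> A2_ext a b W \<eta> \<Longrightarrow> f holomorphic_on W"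
  by (auto simp: A2_ext_def A2_def)

lemma A2_etaD: "f \<in> A2_eta a b W \<eta> \<Longrightarrow> f \<in> L2 W" "f \<in> A2_eta a b W \<eta> \<Longrightarrow> f holomorphic_on W"
  by (auto simp: A2_eta_def A2_def)

lemma A2_ext_linear_combination:
  assumes "f \<in> A2_ext a b W \<eta>" "g \<in> A2_ext a b W \<eta>"
  shows "(\<lambda>z. c * f z + d * g z) \<in> A2_ext a b W \<eta>"
proof -
  obtain U1 f1 where 1: "open U1" "closure W \<inter> periodic_domain W \<subseteq> U1" "U1 \<subseteq> periodic_domain W"
     "f1 holomorphic_on U1" "\<forall>z\<in>W. f1 z = f z"
     "\<forall>y. a < y \<and> y < b \<longrightarrow> f1 (Complex 1 y) = exp (\<i> * of_real \<eta>) * f1 (Complex 0 y)"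
    using assms(1) unfolding A2_ext_def by blast
  obtain U2 g2 where 2: "open U2" "closure W \<inter> periodic_domain W \<subseteq> U2" "U2 \<subseteq> periodic_domain W"
     "g2 holomorphic_on U2" "\<forall>z\<in>W. g2 z = g z"
     "\<forall>y. a < y \<and> y < b \<longrightarrow> g2 (Complex 1 y) = exp (\<i> * of_real \<eta>) * g2 (Complex 0 y)"
    using assms(2) unfolding A2_ext_def by blast
  have "(\<lambda>z. c * f z + d * g z) \<in> A2 W"
    using A2_extD[OF assms(1)] A2_extD[OF assms(2)] unfolding A2_def
    by (auto intro!: L2_add L2_cmult holomorphic_intros)
  moreover have "(\<lambda>z. c * f1 z + d * g2 z) holomorphic_on U1 \<inter> U2"
    using 1(4) 2(4) by (auto intro!: holomorphic_intros intro: holomorphic_on_subset)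
  moreover have "\<forall>y. a < y \<and> y < b \<longrightarrow> c * f1 (Complex 1 y) + d * g2 (Complex 1 y) =
      exp (\<i> * of_real \<eta>) * (c * f1 (Complex 0 y) + d * g2 (Complex 0 y))"
    using 1(6) 2(6) by (auto simp: algebra_simps)
  ultimately show ?thesis
    unfolding A2_ext_def mem_Collect_eq
    using 1(1-3,5) 2(1-3,5)
    by (intro conjI exI[of _ "U1 \<inter> U2"] exI[of _ "\<lambda>z. c * f1 z + d * g2 z"]) auto
qed

lemma A2_ext_zero: "(\<lambda>z. 0) \<in> A2_ext a b W \<eta>"
  unfolding A2_ext_def A2_def
  by (auto simp: L2_def periodic_domain_def intro!: exI[of _ "periodic_domain W"] exI[of _ "\<lambda>z. 0"])

lemma A2_ext_sum:
  assumes "\<And>i. i \<in> I \<Longrightarrow> f i \<in> A2_ext a b W \<eta>"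
  shows "(\<lambda>z. \<Sum>i\<in>I. c i * f i z) \<in> A2_ext a b W \<eta>"
  using assms
proof (induction I rule: infinite_finite_induct)
  case (insert i I)
  then have "(\<lambda>z. c i * f i z + 1 * (\<Sum>i\<in>I. c i * f i z)) \<in> A2_ext a b W \<eta>"
    by (intro A2_ext_linear_combination) auto
  then show ?case
    using insert.hyps by simp
qed (simp_all add: A2_ext_zero)

lemma A2_eta_diff:
  assumes "f \<in> A2_eta a b W \<eta>" "g \<in> A2_eta a b W \<eta>"
  shows "(\<lambda>z. f z - g z) \<in> A2_eta a b W \<eta>"
  unfolding A2_eta_def mem_Collect_eq
proof (intro conjI allI impI)
  show "(\<lambda>z. f z - g z) \<in> A2 W"
    using A2_etaD[OF assms(1)] A2_etaD[OF assms(2)] unfolding A2_def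
    by (auto intro!: L2_diff holomorphic_intros)
  fix \<epsilon> :: real assume "\<epsilon> > 0"
  then obtain f' g' where f': "f' \<in> A2_ext a b W \<eta>" "L2_norm W (\<lambda>z. f z - f' z) < \<epsilon> / 2"
    and g': "g' \<in> A2_ext a b W \<eta>" "L2_norm W (\<lambda>z. g z - g' z) < \<epsilon> / 2"
    using assms half_gt_zero unfolding A2_eta_def by blast
  have "(\<lambda>z. f' z - g' z) \<in> A2_ext a b W \<eta>"
    using A2_ext_linear_combination[OF f'(1) g'(1), of 1 "-1"] by simp
  moreover have "L2_norm W (\<lambda>z. (f z - f' z) - (g z - g' z)) < \<epsilon>"
    using f' g' A2_etaD(1)[OF assms(1)] A2_etaD(1)[OF assms(2)] A2_extD(1)
      L2_norm_diff_le[of "\<lambda>z. f z - f' z" W "\<lambda>z. g z - g' z"] L2_diff by fastforce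
  then have "L2_norm W (\<lambda>z. f z - g z - (f' z - g' z)) < \<epsilon>"
    by (simp add: algebra_simps)
  ultimately show "\<exists>h\<in>A2_ext a b W \<eta>. L2_norm W (\<lambda>z. f z - g z - h z) < \<epsilon>"
    by (intro bexI[of _ "\<lambda>z. f' z - g' z"])
qed

text \<open>Two projections of the same \<open>f\<close> differ by an element of
  \<open>A2_eta\<close> that is orthogonal to itself, hence zero, and by holomorphy zero at the
  given point \<open>z\<close>. With the conjugate of \<open>K z - K' z\<close> as test function,
  the difference at \<open>z\<close> is the squared norm of \<open>K z - K' z\<close>; continuity
  then gives equality at every \<open>w\<close>.\<close>

lemma projection_kernel_unique:
  assumes W: "open W" and K: "is_projection_kernel a b W \<eta> K" and K': "is_projection_kernel a b W \<eta> K'"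
    and z: "z \<in> W" and w: "w \<in> W"
  shows "K z w = K' z w"
proof -
  have L: "K z \<in> L2 W" "K' z \<in> L2 W" "continuous_on W (K z)" "continuous_on W (K' z)"
    using K K' z unfolding is_projection_kernel_def by auto
  define d where "d = (\<lambda>w. K z w - K' z w)"
  have d: "d \<in> L2 W" "continuous_on W d"
    unfolding d_def using L by (auto intro!: L2_diff continuous_intros)
  define f where "f = (\<lambda>w. cnj (d w))"
  have f: "f \<in> L2 W"
    unfolding f_def by (rule L2_cnj[OF d(1)])
  define h where "h = (\<lambda>z. LINT w|lebesgue_on W. K z w * f w)"
  define h' where "h' = (\<lambda>z. LINT w|lebesgue_on W. K' z w * f w)"
  have P: "is_orthogonal_projection W (A2_eta a b W \<eta>) f h"
    "is_orthogonal_projection W (A2_eta a b W \<eta>) f h'"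
    using K K' f unfolding is_projection_kernel_def h_def h'_def by auto
  define u where "u = (\<lambda>z. h z - h' z)"
  have h: "h \<in> L2 W" "h' \<in> L2 W"
    using P A2_etaD unfolding is_orthogonal_projection_def by auto
  have u: "u \<in> A2_eta a b W \<eta>"
    using P unfolding is_orthogonal_projection_def u_def by (auto intro: A2_eta_diff)
  have "L2_inner W (\<lambda>z. f z - h' z) u - L2_inner W (\<lambda>z. f z - h z) u = 0"
    using P u unfolding is_orthogonal_projection_def by auto
  then have "L2_inner W u u = 0"
    using f h A2_etaD(1)[OF u] by (simp add: L2_inner_diff_left u_def)
  then have "L2_norm W u = 0"
    by (simp add: L2_inner_self_norm)
  then have "u z = 0"
    using A2_etaD[OF u] W z holomorphic_on_imp_continuous_on by (intro L2_norm_eq_0_imp[of u W]) auto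
  have i: "integrable (lebesgue_on W) (\<lambda>w. k w * f w)" if "k \<in> L2 W" for k
    using L2_mult_integrable[OF that L2_cnj[OF f]] by simp
  have "L2_inner W d d = h z - h' z"
    unfolding h_def h'_def using i[OF L(1)] i[OF L(2)]
    by (subst Bochner_Integration.integral_diff[symmetric]) (auto simp: L2_inner_def d_def f_def algebra_simps)
  then have "L2_norm W d = 0"
    using \<open>u z = 0\<close> unfolding u_def by (simp add: L2_inner_self_norm)
  then have "d w = 0"
    using d W w by (intro L2_norm_eq_0_imp[of d W]) auto
  then show ?thesis
    by (simp add: d_def)
qed

text \<open>Integrating against the kernel produces the Fourier series of \<open>f\<close>, which
  lies in the closure. Completeness is required in its pointwise form and only on the dense subspace
  \<open>A2_ext\<close>: the remainder \<open>f - h\<close> is orthogonal to every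
  \<open>e k\<close>, hence to \<open>A2_ext\<close> by termwise integration, hence to the closure
  by continuity.\<close>

lemma projection_kernel_orthonormal:
  assumes W: "open W" and on: "orthonormal_on W e" and ext: "\<And>k. e k \<in> A2_ext a b W \<eta>"
    and bound: "\<And>C. compact C \<Longrightarrow> C \<subseteq> W \<Longrightarrow> \<exists>B. \<forall>z\<in>C. \<forall>N. (\<Sum>k<N. (norm (e k z))\<^sup>2) \<le> B"
    and complete: "\<And>g z. g \<in> A2_ext a b W \<eta> \<Longrightarrow> z \<in> W \<Longrightarrow> (\<lambda>k. L2_inner W g (e k) * e k z) sums g z"
  shows "is_projection_kernel a b W \<eta> (\<lambda>z w. \<Sum>k. e k z * cnj (e k w))"
    and "z \<in> W \<Longrightarrow> w \<in> W \<Longrightarrow> summable (\<lambda>k. norm (e k z * cnj (e k w)))"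
proof -
  have hol: "e k holomorphic_on W" for k
    using ext A2_extD(2) by blast
  have setW: "W \<in> sets lebesgue"
    using W by auto
  \<comment> \<open>Summability of the squares does not refer to coefficients, so zero coefficients
    may be inserted.\<close>
  have sq: "summable (\<lambda>k. (norm (e k z))\<^sup>2)" if "z \<in> W" for z
    by (rule orthonormal_series_holomorphic(2)[OF W hol bound _ that, of "\<lambda>_. 0"]) auto
  show smK: "summable (\<lambda>k. norm (e k z * cnj (e k w)))" if "z \<in> W" "w \<in> W" for z w
    by (rule summable_mult_of_square_summable) (use sq that in auto)
  \<comment> \<open>The conjugated kernel is an orthonormal series in the variable \<open>w\<close>,
    holomorphic in it, so the lemmas on such series apply.\<close>
  define F where "F = (\<lambda>z w. \<Sum>k. cnj (e k z) * e k w)"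
  have F: "(\<lambda>k. cnj (e k z) * e k w) sums F z w" if "z \<in> W" "w \<in> W" for z w
    unfolding F_def using smK[OF that] summable_norm_cancel[of "\<lambda>k. cnj (e k z) * e k w"]
    by (intro summable_sums) (simp add: norm_mult)
  have K: "(\<Sum>k. e k z * cnj (e k w)) = cnj (F z w)" if "z \<in> W" "w \<in> W" for z w
    using sums_cnj[THEN iffD2, OF F[OF that]] by (simp add: sums_iff)
  have sqc: "summable (\<lambda>k. (norm (cnj (e k z)))\<^sup>2)" if "z \<in> W" for z
    using sq[OF that] by simp
  have FL: "F z \<in> L2 W" if "z \<in> W" for z
    by (rule orthonormal_series_L2(1)[OF on setW sqc[OF that] F[OF that]])
  have FH: "F z holomorphic_on W" if "z \<in> W" for z
    unfolding F_def by (rule orthonormal_series_holomorphic(1)[OF W hol bound sqc[OF that]])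
  show "is_projection_kernel a b W \<eta> (\<lambda>z w. \<Sum>k. e k z * cnj (e k w))"
    unfolding is_projection_kernel_def
  proof (intro conjI ballI)
    fix z assume z: "z \<in> W"
    have m: "(\<lambda>w. \<Sum>k. e k z * cnj (e k w)) \<in> borel_measurable (lebesgue_on W)
        \<longleftrightarrow> (\<lambda>w. cnj (F z w)) \<in> borel_measurable (lebesgue_on W)"
      by (rule measurable_cong) (simp add: K z)
    have i: "integrable (lebesgue_on W) (\<lambda>w. (norm (\<Sum>k. e k z * cnj (e k w)))\<^sup>2)
        \<longleftrightarrow> integrable (lebesgue_on W) (\<lambda>w. (norm (cnj (F z w)))\<^sup>2)"
      by (rule Bochner_Integration.integrable_cong) (simp_all add: K z)
    show "(\<lambda>w. \<Sum>k. e k z * cnj (e k w)) \<in> L2 W"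
      using L2_cnj[OF FL[OF z]] m i unfolding L2_def by blast
    have "continuous_on W (\<lambda>w. cnj (F z w))"
      using holomorphic_on_imp_continuous_on[OF FH[OF z]] by (intro continuous_intros)
    then show "continuous_on W (\<lambda>w. \<Sum>k. e k z * cnj (e k w))"
      by (rule continuous_on_eq) (simp add: K z)
  next
    fix f assume f: "f \<in> L2 W"
    define h where "h = (\<lambda>z. LINT w|lebesgue_on W. (\<Sum>k. e k z * cnj (e k w)) * f w)"
    define c where "c = (\<lambda>k. L2_inner W f (e k))"
    have c: "summable (\<lambda>k. (norm (c k))\<^sup>2)"
      unfolding c_def by (rule Bessel_summable[OF on f])
    have h: "(\<lambda>k. c k * e k z) sums h z" if z: "z \<in> W" for z
    proof -
      have "h z = L2_inner W f (F z)"
        unfolding h_def L2_inner_def by (rule Bochner_Integration.integral_cong) (auto simp: K z)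
      moreover have "(\<lambda>k. cnj (cnj (e k z) * L2_inner W (e k) f)) sums cnj (L2_inner W (F z) f)"
        unfolding sums_cnj by (rule orthonormal_series_inner[OF on setW sqc[OF z] F[OF z] f])
      ultimately show ?thesis
        by (simp add: L2_inner_cnj c_def mult.commute)
    qed
    have hL: "h \<in> L2 W"
      by (rule orthonormal_series_L2(1)[OF on setW c h])
    have "(\<lambda>z. \<Sum>k. c k * e k z) holomorphic_on W"
      by (rule orthonormal_series_holomorphic(1)[OF W hol bound c])
    then have "h holomorphic_on W"
      by (rule holomorphic_transform) (use h in \<open>simp add: sums_iff\<close>)
    then have hA: "h \<in> A2 W"
      using hL by (simp add: A2_def)
    have hV: "h \<in> A2_eta a b W \<eta>"
      unfolding A2_eta_def mem_Collect_eq
    proof (intro conjI hA allI impI)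
      fix \<epsilon> :: real assume "\<epsilon> > 0"
      have "(\<lambda>N. L2_norm W (\<lambda>z. h z - (\<Sum>k<N. c k * e k z))) \<longlonglongrightarrow> 0"
        by (rule orthonormal_series_tendsto[OF on setW c h])
      then have "\<forall>\<^sub>F N in sequentially. L2_norm W (\<lambda>z. h z - (\<Sum>k<N. c k * e k z)) < \<epsilon>"
        using \<open>\<epsilon> > 0\<close> by (rule order_tendstoD(2))
      then obtain N where "L2_norm W (\<lambda>z. h z - (\<Sum>k<N. c k * e k z)) < \<epsilon>"
        using eventually_happens by fastforce
      moreover have "(\<lambda>z. \<Sum>k<N. c k * e k z) \<in> A2_ext a b W \<eta>"
        by (rule A2_ext_sum) (rule ext)
      ultimately show "\<exists>g\<in>A2_ext a b W \<eta>. L2_norm W (\<lambda>z. h z - g z) < \<epsilon>"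
        by (intro bexI[of _ "\<lambda>z. \<Sum>k<N. c k * e k z"])
    qed
    define d where "d = (\<lambda>z. f z - h z)"
    have dL: "d \<in> L2 W"
      unfolding d_def by (rule L2_diff[OF f hL])
    have de: "L2_inner W (e k) d = 0" for k
    proof -
      have eL: "e k \<in> L2 W"
        using on orthonormal_onD(1) by blast
      have "(\<lambda>j. c j * L2_inner W (e j) (e k)) sums L2_inner W h (e k)"
        by (rule orthonormal_series_inner[OF on setW c h eL])
      moreover have "(\<lambda>j. c j * L2_inner W (e j) (e k)) = (\<lambda>j. if j = k then c k else 0)"
        by (auto simp: orthonormal_onD(2)[OF on])
      ultimately have "L2_inner W h (e k) = c k"
        using sums_single[of k "\<lambda>_. c k"] sums_unique2 by auto
      then have "L2_inner W d (e k) = 0"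
        unfolding d_def using f hL eL by (simp add: L2_inner_diff_left c_def)
      then show ?thesis
        using L2_inner_cnj[of W d "e k"] by simp
    qed
    have dext: "L2_inner W d g = 0" if g: "g \<in> A2_ext a b W \<eta>" for g
    proof -
      have "(\<lambda>k. L2_inner W g (e k) * L2_inner W (e k) d) sums L2_inner W g d"
        by (rule orthonormal_series_inner[OF on setW Bessel_summable[OF on A2_extD(1)[OF g]] complete[OF g] dL])
      then have "L2_inner W g d = 0"
        by (simp add: de sums_iff)
      then show ?thesis
        using L2_inner_cnj[of W g d] by simp
    qed
    have "L2_inner W d g = 0" if g: "g \<in> A2_eta a b W \<eta>" for g
    proof (rule ccontr)
      assume nz: "L2_inner W d g \<noteq> 0"
      \<comment> \<open>The summand 1 covers a remainder \<open>d\<close> of norm zero and makes the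
        final inequality strict.\<close>
      define \<epsilon> where "\<epsilon> = norm (L2_inner W d g) / (L2_norm W d + 1)"
      have pos: "L2_norm W d + 1 > 0"
        using L2_norm_nonneg[of W d] by linarith
      then have "\<epsilon> > 0"
        unfolding \<epsilon>_def using nz by simp
      then obtain g' where g': "g' \<in> A2_ext a b W \<eta>" "L2_norm W (\<lambda>z. g z - g' z) < \<epsilon>"
        using g unfolding A2_eta_def by blast
      have "L2_inner W d g = L2_inner W d (\<lambda>z. g z - g' z)"
        using dext[OF g'(1)] dL A2_etaD(1)[OF g] A2_extD(1)[OF g'(1)] by (simp add: L2_inner_diff_right)
      then have "norm (L2_inner W d g) \<le> L2_norm W d * L2_norm W (\<lambda>z. g z - g' z)"
        using L2_Cauchy_Schwarz[OF dL L2_diff[OF A2_etaD(1)[OF g] A2_extD(1)[OF g'(1)]]] by simp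
      also have "\<dots> \<le> L2_norm W d * \<epsilon>"
        using g'(2) by (intro mult_left_mono) auto
      also have "\<dots> < (L2_norm W d + 1) * \<epsilon>"
        using \<open>\<epsilon> > 0\<close> by (simp add: algebra_simps)
      also have "\<dots> = norm (L2_inner W d g)"
        unfolding \<epsilon>_def using pos by simp
      finally show False
        by simp
    qed
    then show "is_orthogonal_projection W (A2_eta a b W \<eta>) f
        (\<lambda>z. LINT w|lebesgue_on W. (\<Sum>k. e k z * cnj (e k w)) * f w)"
      using hV unfolding is_orthogonal_projection_def h_def[symmetric] d_def by blast
  qed
qed

section \<open>Laurent expansion in an annulus\<close>

lemma contour_integral_circlepath_annulus:
  assumes hol: "f holomorphic_on {z. r < norm z \<and> norm z < R}"
    and s: "0 < s" "r < s" "s < R" and t: "0 < t" "r < t" "t < R"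
  shows "contour_integral (circlepath 0 s) f = contour_integral (circlepath 0 t) f"
proof (rule Cauchy_theorem_homotopic_loops[OF _ _ hol])
  show "open {z::complex. r < norm z \<and> norm z < R}"
    by (intro open_Collect_conj open_Collect_less continuous_intros)
  show "homotopic_loops {z. r < norm z \<and> norm z < R} (circlepath 0 s) (circlepath 0 t)"
  proof (rule homotopic_loops_linear)
    fix x y :: real
    show "closed_segment (circlepath 0 s x) (circlepath 0 t x) \<subseteq> {z. r < norm z \<and> norm z < R}"
    proof
      fix z assume "z \<in> closed_segment (circlepath 0 s x) (circlepath 0 t x)"
      then obtain u where u: "0 \<le> u" "u \<le> 1"
        and z: "z = (1 - u) *\<^sub>R circlepath 0 s x + u *\<^sub>R circlepath 0 t x"
        unfolding in_segment by auto
      have "z = of_real ((1 - u) * s + u * t) * exp (2 * of_real pi * \<i> * of_real x)"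
        unfolding z circlepath by (simp add: scaleR_conv_of_real algebra_simps)
      moreover have "norm (exp (2 * of_real pi * \<i> * of_real x)) = 1"
        by (simp add: norm_exp_eq_Re)
      moreover have "0 \<le> (1 - u) * s + u * t"
        using u s t by simp
      ultimately have n: "norm z = (1 - u) * s + u * t"
        by (simp only: norm_mult norm_of_real mult_1_right abs_of_nonneg)
      have "(1 - u) * s + u * t < R" "r < (1 - u) * s + u * t"
        using convex_bound_lt[of s R t "1 - u" u] convex_bound_lt[of "- s" "- r" "- t" "1 - u" u] u s t
        by auto
      with n show "z \<in> {z. r < norm z \<and> norm z < R}"
        by simp
    qed
  qed auto
qed auto

text \<open>The difference quotient of \<open>f\<close> at \<open>z\<close> extends holomorphically
  over \<open>z\<close>, so its integrals over the two circles agree. The term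
  \<open>f z / (w - z)\<close> accounts for the right-hand side: its integral is nonzero only over
  the circle that encloses \<open>z\<close>.\<close>

lemma Cauchy_integral_annulus:
  assumes hol: "f holomorphic_on {z. r < norm z \<and> norm z < R}"
    and st: "0 < s" "r < s" "t < R" "s < norm z" "norm z < t"
  shows "contour_integral (circlepath 0 t) (\<lambda>w. f w / (w - z))
       - contour_integral (circlepath 0 s) (\<lambda>w. f w / (w - z)) = 2 * of_real pi * \<i> * f z"
proof -
  define A where "A = {z::complex. r < norm z \<and> norm z < R}"
  have A: "open A"
    unfolding A_def by (intro open_Collect_conj open_Collect_less continuous_intros)
  define k where "k = (\<lambda>w. if w = z then deriv f z else (f w - f z) / (w - z))"
  have "k holomorphic_on A"
    unfolding k_def using pole_lemma_open[OF hol[folded A_def] A] .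
  then have eq: "contour_integral (circlepath 0 t) k = contour_integral (circlepath 0 s) k"
    unfolding A_def by (rule contour_integral_circlepath_annulus) (use st in auto)
  have k: "contour_integral (circlepath 0 u) k =
      contour_integral (circlepath 0 u) (\<lambda>w. f w / (w - z)) - f z * contour_integral (circlepath 0 u) (\<lambda>w. 1 / (w - z))"
    if u: "0 < u" "r < u" "u < R" "u \<noteq> norm z" for u
  proof -
    have sub: "path_image (circlepath 0 u) \<subseteq> A" and nz: "z \<notin> path_image (circlepath 0 u)"
      using u by (auto simp: A_def)
    have cf: "continuous_on (path_image (circlepath 0 u)) f"
      using hol sub unfolding A_def by (meson holomorphic_on_imp_continuous_on continuous_on_subset)
    have 1: "(\<lambda>w. f w / (w - z)) contour_integrable_on circlepath 0 u"
      by (rule contour_integrable_continuous_circlepath) (use cf nz in \<open>auto intro!: continuous_intros\<close>)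
    have 2: "(\<lambda>w. 1 / (w - z)) contour_integrable_on circlepath 0 u"
      by (rule contour_integrable_continuous_circlepath) (use nz in \<open>auto intro!: continuous_intros\<close>)
    have "contour_integral (circlepath 0 u) k =
        contour_integral (circlepath 0 u) (\<lambda>w. f w / (w - z) - f z * (1 / (w - z)))"
      by (rule contour_integral_eq) (use nz in \<open>auto simp: k_def diff_divide_distrib\<close>)
    also have "\<dots> = contour_integral (circlepath 0 u) (\<lambda>w. f w / (w - z))
        - contour_integral (circlepath 0 u) (\<lambda>w. f z * (1 / (w - z)))"
      by (rule contour_integral_diff[OF 1 contour_integrable_lmul[OF 2]])
    also have "contour_integral (circlepath 0 u) (\<lambda>w. f z * (1 / (w - z))) =
        f z * contour_integral (circlepath 0 u) (\<lambda>w. 1 / (w - z))"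
      by (rule contour_integral_lmul[OF 2])
    finally show ?thesis .
  qed
  have t: "contour_integral (circlepath 0 t) (\<lambda>w. 1 / (w - z)) = 2 * of_real pi * \<i>"
    using Cauchy_integral_circlepath_simple[of "\<lambda>_. 1" 0 t z] st by (auto intro!: contour_integral_unique)
  have "((\<lambda>w. 1 / (w - z)) has_contour_integral 0) (circlepath 0 s)"
    by (rule Cauchy_theorem_disc_simple[where a = 0 and e = "norm z"])
       (use st in \<open>auto intro!: holomorphic_intros\<close>)
  then have s: "contour_integral (circlepath 0 s) (\<lambda>w. 1 / (w - z)) = 0"
    by (rule contour_integral_unique)
  show ?thesis
    using eq k[of t] k[of s] s t st by (simp add: algebra_simps)
qed

definition laurent_coeff :: "(complex \<Rightarrow> complex) \<Rightarrow> real \<Rightarrow> int \<Rightarrow> complex" where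
  "laurent_coeff f r n = contour_integral (circlepath 0 r) (\<lambda>w. f w / w powi (n + 1)) / (2 * of_real pi * \<i>)"

lemma laurent_coeff_indep:
  assumes "f holomorphic_on {z. r < norm z \<and> norm z < R}" "0 \<le> r"
    and s: "r < s" "s < R" and t: "r < t" "t < R"
  shows "laurent_coeff f s n = laurent_coeff f t n"
proof -
  have "(\<lambda>w. f w / w powi (n + 1)) holomorphic_on {z. r < norm z \<and> norm z < R}"
    using assms(1,2) by (auto intro!: holomorphic_intros)
  then show ?thesis
    unfolding laurent_coeff_def
    using contour_integral_circlepath_annulus[of _ r R s t] s t assms(2) by simp
qed

text \<open>\<open>E N\<close> below is the remainder after \<open>N\<close> terms; it tends to zero
  because its integrand is at most \<open>B * \<kappa> ^ N / (1 - \<kappa>)\<close>. Both halves of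
  the Laurent series are instances.\<close>

lemma contour_integral_geometric_series:
  assumes t: "t > 0" and cg: "continuous_on (sphere 0 t) g" and cq: "continuous_on (sphere 0 t) q"
    and q: "\<And>w. w \<in> sphere 0 t \<Longrightarrow> norm (q w) \<le> \<kappa>" and \<kappa>: "0 \<le> \<kappa>" "\<kappa> < 1"
  shows "(\<lambda>n. contour_integral (circlepath 0 t) (\<lambda>w. g w * q w ^ n)) sums
     contour_integral (circlepath 0 t) (\<lambda>w. g w / (1 - q w))"
proof -
  have img: "path_image (circlepath 0 t) = sphere 0 t"
    using t by simp
  have cc: "h contour_integrable_on circlepath 0 t" if "continuous_on (sphere 0 t) h" for h
    by (rule contour_integrable_continuous_circlepath) (use that img in simp)
  obtain B where B: "\<And>w. w \<in> sphere 0 t \<Longrightarrow> norm (g w) \<le> B" "B \<ge> 0"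
  proof -
    have "bounded (g ` sphere 0 t)"
      by (intro compact_imp_bounded compact_continuous_image cg) auto
    then obtain B where "\<forall>w\<in>sphere 0 t. norm (g w) \<le> B"
      unfolding bounded_iff by auto
    then show ?thesis
      by (intro that[of "max B 0"]) (auto intro: max.coboundedI1)
  qed
  have nz: "1 - q w \<noteq> 0" if "w \<in> sphere 0 t" for w
    using q[OF that] \<kappa> by auto
  define E where "E = (\<lambda>N. contour_integral (circlepath 0 t) (\<lambda>w. g w * q w ^ N / (1 - q w)))"
  have cn: "continuous_on (sphere 0 t) (\<lambda>w. g w * q w ^ N / (1 - q w))" for N
    using nz by (intro continuous_intros cg cq) auto
  have cs: "continuous_on (sphere 0 t) (\<lambda>w. g w * q w ^ N)" for N
    by (intro continuous_intros cg cq)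
  have step: "E 0 = (\<Sum>n<N. contour_integral (circlepath 0 t) (\<lambda>w. g w * q w ^ n)) + E N" for N
  proof (induction N)
    case (Suc N)
    have "E N = contour_integral (circlepath 0 t) (\<lambda>w. g w * q w ^ N + g w * q w ^ Suc N / (1 - q w))"
      unfolding E_def
    proof (rule contour_integral_eq)
      fix w assume "w \<in> path_image (circlepath 0 t)"
      then have "1 - q w \<noteq> 0"
        using nz[of w] img by blast
      then show "g w * q w ^ N / (1 - q w) = g w * q w ^ N + g w * q w ^ Suc N / (1 - q w)"
        by (simp add: field_simps)
    qed
    also have "\<dots> = contour_integral (circlepath 0 t) (\<lambda>w. g w * q w ^ N) + E (Suc N)"
      unfolding E_def by (rule contour_integral_add[OF cc[OF cs] cc[OF cn]])
    finally show ?case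
      using Suc by simp
  qed simp
  have "E \<longlonglongrightarrow> 0"
  proof (rule Lim_null_comparison)
    have "(\<lambda>N. B * \<kappa> ^ N / (1 - \<kappa>) * (2 * pi * t)) \<longlonglongrightarrow> B * 0 / (1 - \<kappa>) * (2 * pi * t)"
      by (intro tendsto_intros LIMSEQ_power_zero) (use \<kappa> in auto)
    then show "(\<lambda>N. B * \<kappa> ^ N / (1 - \<kappa>) * (2 * pi * t)) \<longlonglongrightarrow> 0"
      by simp
    have "norm (E N) \<le> B * \<kappa> ^ N / (1 - \<kappa>) * (2 * pi * t)" for N
    proof (rule has_contour_integral_bound_circlepath)
      show "((\<lambda>w. g w * q w ^ N / (1 - q w)) has_contour_integral E N) (circlepath 0 t)"
        unfolding E_def by (rule has_contour_integral_integral[OF cc[OF cn]])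
      show "0 \<le> B * \<kappa> ^ N / (1 - \<kappa>)"
        using B \<kappa> by auto
      fix w :: complex assume "norm (w - 0) = t"
      then have w: "w \<in> sphere 0 t"
        by simp
      have "1 - \<kappa> \<le> norm (1 - q w)"
        using q[OF w] norm_triangle_ineq2[of 1 "q w"] by simp
      moreover have "norm (g w) * norm (q w) ^ N \<le> B * \<kappa> ^ N"
        by (intro mult_mono power_mono B q w) (use \<kappa> B in auto)
      ultimately have "norm (g w) * norm (q w) ^ N / norm (1 - q w) \<le> B * \<kappa> ^ N / (1 - \<kappa>)"
        using \<kappa> B by (intro frac_le) auto
      then show "norm (g w * q w ^ N / (1 - q w)) \<le> B * \<kappa> ^ N / (1 - \<kappa>)"
        by (simp add: norm_mult norm_divide norm_power)
    qed (use t in auto)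
    then show "\<forall>\<^sub>F N in sequentially. norm (E N) \<le> B * \<kappa> ^ N / (1 - \<kappa>) * (2 * pi * t)"
      by simp
  qed
  then have "(\<lambda>N. E 0 - E N) \<longlonglongrightarrow> E 0 - 0"
    by (intro tendsto_intros)
  moreover have "E 0 - E N = (\<Sum>n<N. contour_integral (circlepath 0 t) (\<lambda>w. g w * q w ^ n))" for N
    using step[of N] by simp
  ultimately show ?thesis
    unfolding sums_def E_def by simp
qed

text \<open>In Cauchy's formula for two circles with \<open>z\<close> between them,
  \<open>1 / (w - z)\<close> is expanded in powers of \<open>z / w\<close> on the outer circle and
  of \<open>w / z\<close> on the inner one. The halves stay separate because each converges as an
  ordinary series; \<open>- int n - 1\<close> runs through the negative integers from -1
  downwards.\<close>

lemma laurent_expansion: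
  assumes hol: "f holomorphic_on {z. r < norm z \<and> norm z < R}" and r: "0 \<le> r"
    and z: "r < norm z" "norm z < R" and u: "r < u" "u < R"
  obtains S1 S2 where "(\<lambda>n. laurent_coeff f u (int n) * z ^ n) sums S1"
    and "(\<lambda>n. laurent_coeff f u (- int n - 1) * z powi (- int n - 1)) sums S2"
    and "f z = S1 + S2"
proof -
  define p where "p = 2 * of_real pi * \<i>"
  have p: "p \<noteq> 0"
    by (simp add: p_def)
  obtain s where s: "r < s" "s < norm z"
    using dense[OF z(1)] by blast
  obtain t where t: "norm z < t" "t < R"
    using dense[OF z(2)] by blast
  have pos: "0 < s" "0 < norm z" "0 < t" "r < t" "s < R"
    using s t r by linarith+
  have z0: "z \<noteq> 0"
    using pos by auto
  \<comment> \<open>The circles depend on \<open>z\<close>, but the coefficients do not depend on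
    the radius, so the fixed radius \<open>u\<close> serves for all \<open>z\<close>.\<close>
  have coeff: "laurent_coeff f u = laurent_coeff f s" "laurent_coeff f u = laurent_coeff f t"
    by (rule ext, rule laurent_coeff_indep[OF hol r]; use u s t pos in simp)+
  have cf: "continuous_on (sphere 0 v) f" if "r < v" "v < R" for v
    by (rule continuous_on_subset[OF holomorphic_on_imp_continuous_on[OF hol]]) (use that in auto)
  have nz: "w \<noteq> 0" "w \<noteq> z" if "w \<in> sphere 0 v" "v \<in> {s, t}" for w v
  proof -
    have "norm w = v"
      using that(1) by simp
    then have "norm w = s \<or> norm w = t"
      using that(2) by auto
    then show "w \<noteq> 0" "w \<noteq> z"
      using s t pos by auto
  qed
  have img: "path_image (circlepath 0 v) = sphere 0 v" if "v \<in> {s, t}" for v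
    using that pos by auto
  have ci: "g contour_integrable_on circlepath 0 v" if "continuous_on (sphere 0 v) g" "v \<in> {s, t}" for g v
    by (rule contour_integrable_continuous_circlepath) (use that img in simp)
  have 1: "(\<lambda>n. contour_integral (circlepath 0 t) (\<lambda>w. f w / w * (z / w) ^ n)) sums
     contour_integral (circlepath 0 t) (\<lambda>w. (f w / w) / (1 - z / w))"
    by (rule contour_integral_geometric_series[where \<kappa> = "norm z / t"])
       (use t pos cf[of t] nz in \<open>auto intro!: continuous_intros simp: norm_divide\<close>)
  have 2: "(\<lambda>n. contour_integral (circlepath 0 s) (\<lambda>w. f w / z * (w / z) ^ n)) sums
     contour_integral (circlepath 0 s) (\<lambda>w. (f w / z) / (1 - w / z))"
    by (rule contour_integral_geometric_series[where \<kappa> = "s / norm z"])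
       (use s pos z0 cf[of s] nz in \<open>auto intro!: continuous_intros simp: norm_divide\<close>)
  have 1: "(\<lambda>n. p * (laurent_coeff f u (int n) * z ^ n)) sums
     contour_integral (circlepath 0 t) (\<lambda>w. f w / (w - z))"
  proof -
    have "contour_integral (circlepath 0 t) (\<lambda>w. f w / w * (z / w) ^ n) = p * (laurent_coeff f u (int n) * z ^ n)" for n
    proof -
      have "contour_integral (circlepath 0 t) (\<lambda>w. f w / w * (z / w) ^ n) =
          contour_integral (circlepath 0 t) (\<lambda>w. z ^ n * (f w / w powi (int n + 1)))"
        by (rule contour_integral_eq) (simp add: power_int_add power_int_def nat_add_distrib power_divide)
      also have "\<dots> = z ^ n * contour_integral (circlepath 0 t) (\<lambda>w. f w / w powi (int n + 1))"
        by (intro contour_integral_lmul ci) (use cf[of t] nz t pos in \<open>auto intro!: continuous_intros\<close>)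
      finally show ?thesis
        unfolding coeff(2) laurent_coeff_def p_def[symmetric] using p by simp
    qed
    moreover have "contour_integral (circlepath 0 t) (\<lambda>w. (f w / w) / (1 - z / w)) =
        contour_integral (circlepath 0 t) (\<lambda>w. f w / (w - z))"
    proof (rule contour_integral_eq)
      fix w assume "w \<in> path_image (circlepath 0 t)"
      then have w: "w \<in> sphere 0 t"
        using pos by simp
      have "w \<noteq> 0" "w \<noteq> z"
        using nz[OF w] by blast+
      then show "(f w / w) / (1 - z / w) = f w / (w - z)"
        by (simp add: field_simps)
    qed
    ultimately show ?thesis
      using 1 by simp
  qed
  have 2: "(\<lambda>n. p * (laurent_coeff f u (- int n - 1) * z powi (- int n - 1))) sums
     (- contour_integral (circlepath 0 s) (\<lambda>w. f w / (w - z)))"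
  proof -
    have "contour_integral (circlepath 0 s) (\<lambda>w. f w / z * (w / z) ^ n) =
        p * (laurent_coeff f u (- int n - 1) * z powi (- int n - 1))" for n
    proof -
      have zp: "z powi (- int n - 1) = inverse (z * z ^ n)"
        using z0 by (simp add: power_int_diff power_int_minus field_simps)
      have "contour_integral (circlepath 0 s) (\<lambda>w. f w / z * (w / z) ^ n) =
          contour_integral (circlepath 0 s) (\<lambda>w. z powi (- int n - 1) * (f w / w powi (- int n - 1 + 1)))"
        unfolding zp by (rule contour_integral_eq) (simp add: power_int_minus power_divide divide_simps)
      also have "\<dots> = z powi (- int n - 1) * contour_integral (circlepath 0 s) (\<lambda>w. f w / w powi (- int n - 1 + 1))"
        by (intro contour_integral_lmul ci) (use cf[of s] nz s pos in \<open>auto intro!: continuous_intros\<close>)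
      finally show ?thesis
        unfolding coeff(1) laurent_coeff_def p_def[symmetric] using p by simp
    qed
    moreover have "contour_integral (circlepath 0 s) (\<lambda>w. (f w / z) / (1 - w / z)) =
        contour_integral (circlepath 0 s) (\<lambda>w. - (f w / (w - z)))"
    proof (rule contour_integral_eq)
      fix w assume "w \<in> path_image (circlepath 0 s)"
      then have w: "w \<in> sphere 0 s"
        using pos by simp
      have "w \<noteq> z"
        using nz[OF w] by blast
      then have "w - z \<noteq> 0" "z - w \<noteq> 0"
        by auto
      then show "(f w / z) / (1 - w / z) = - (f w / (w - z))"
        using z0 by (simp add: divide_simps) (simp add: algebra_simps)
    qed
    moreover have "\<dots> = - contour_integral (circlepath 0 s) (\<lambda>w. f w / (w - z))"
      by (rule contour_integral_neg)
    ultimately show ?thesis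
      using 2 by simp
  qed
  have C: "contour_integral (circlepath 0 t) (\<lambda>w. f w / (w - z))
       - contour_integral (circlepath 0 s) (\<lambda>w. f w / (w - z)) = p * f z"
    unfolding p_def by (rule Cauchy_integral_annulus[OF hol]) (use s t pos in auto)
  show ?thesis
  proof (rule that)
    show "(\<lambda>n. laurent_coeff f u (int n) * z ^ n) sums
        (contour_integral (circlepath 0 t) (\<lambda>w. f w / (w - z)) / p)"
      using sums_divide[OF 1, of p] p by simp
    show "(\<lambda>n. laurent_coeff f u (- int n - 1) * z powi (- int n - 1)) sums
        (- contour_integral (circlepath 0 s) (\<lambda>w. f w / (w - z)) / p)"
      using sums_divide[OF 2, of p] p by simp
    show "f z = contour_integral (circlepath 0 t) (\<lambda>w. f w / (w - z)) / p +
        - contour_integral (circlepath 0 s) (\<lambda>w. f w / (w - z)) / p"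
      using C p by (simp add: field_simps)
  qed
qed

text \<open>The circle integral in terms of the angle: in this form the coefficient appears as the
  inner integral over the rectangle. The endpoints are left out because the rectangle is
  open.\<close>

lemma laurent_coeff_eq_integral:
  assumes r: "r > 0" and cont: "continuous_on (sphere 0 r) f"
  shows "(LBINT t:{0<..<2*pi}. f (of_real r * cis t) * cis (- of_int n * t)) =
           2 * of_real pi * of_real (r powi n) * laurent_coeff f r n"
proof -
  define g where "g = (\<lambda>t. f (of_real r * cis t) * cis (- of_int n * t))"
  have cg: "continuous_on {0..2*pi} g"
    unfolding g_def
    by (intro continuous_intros continuous_on_compose2[OF cont]) (use r in \<open>auto simp: norm_mult\<close>)
  have "contour_integral (circlepath 0 r) (\<lambda>w. f w / w powi (n + 1)) =
      integral {0..2*pi} (\<lambda>t. f (0 + of_real r * cis t) / (0 + of_real r * cis t) powi (n + 1) * of_real r * \<i> * cis t)"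
    unfolding circlepath_def by (rule contour_integral_part_circlepath_eq) simp
  also have "\<dots> = integral {0..2*pi} (\<lambda>t. \<i> * of_real (r powi (- n)) * g t)"
  proof (rule Henstock_Kurzweil_Integration.integral_cong)
    fix t :: real
    have c: "cis t powi (n + 1) = cis t * cis (of_int n * t)"
      by (simp add: cis_power_int cis_mult algebra_simps)
    have "(of_real r * cis t) powi (n + 1) = of_real r * cis t * (of_real (r powi n) * cis (of_int n * t))"
      using r by (simp add: power_int_mult_distrib c power_int_add)
    then show "f (0 + of_real r * cis t) / (0 + of_real r * cis t) powi (n + 1) * of_real r * \<i> * cis t =
        \<i> * of_real (r powi (- n)) * g t"
      using r unfolding g_def by (simp add: field_simps power_int_minus cis_mult flip: cis_inverse)
  qed
  also have "\<dots> = \<i> * of_real (r powi (- n)) * integral {0..2*pi} g"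
    by simp
  finally have 1: "contour_integral (circlepath 0 r) (\<lambda>w. f w / w powi (n + 1)) =
     \<i> * of_real (r powi (- n)) * integral {0..2*pi} g" .
  have "set_integrable lborel {0..2*pi} g"
    using cg by (rule borel_integrable_atLeastAtMost')
  then have "set_integrable lborel {0<..<2*pi} g"
    by (rule set_integrable_subset) auto
  then have "integral {0..2*pi} g = (LBINT t:{0<..<2*pi}. g t)"
    by (simp add: set_borel_integral_eq_integral(2) integral_open_interval_real)
  then show ?thesis
    unfolding laurent_coeff_def 1 g_def using r by (simp add: power_int_minus field_simps)
qed

section \<open>Geometry of the periodic cell\<close>

text \<open>The definition describes \<open>W\<close> itself in a chart; the addition is the
  statement about its closure. The part of the chart strictly below the graph is open and disjoint
  from \<open>W\<close>, hence disjoint from \<open>closure W\<close>.\<close>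

lemma lipschitz_chart:
  assumes "lipschitz_domain W" "p \<in> frontier W"
  obtains u r h g where "norm u = 1" "0 < r" "0 < h"
    and "\<And>s t. \<bar>s\<bar> < r \<Longrightarrow> \<bar>t\<bar> < h \<Longrightarrow> p + u * Complex s t \<in> W \<longleftrightarrow> g s < t"
    and "\<And>s t. \<bar>s\<bar> < r \<Longrightarrow> \<bar>t\<bar> < h \<Longrightarrow> p + u * Complex s t \<in> closure W \<Longrightarrow> g s \<le> t"
proof -
  obtain u r h L and g :: "real \<Rightarrow> real" where u: "norm u = 1" and rh: "r > 0" "h > 0"
    and L: "L-lipschitz_on {-r<..<r} g"
    and iff: "\<And>s t. \<bar>s\<bar> < r \<Longrightarrow> \<bar>t\<bar> < h \<Longrightarrow> p + u * Complex s t \<in> W \<longleftrightarrow> g s < t"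
    using assms unfolding lipschitz_domain_def by blast
  have uu: "cnj u * u = 1"
    using complex_norm_square[of u] u by (simp add: mult.commute)
  define c where "c = (\<lambda>z. cnj u * (z - p))"
  have c: "p + u * Complex (Re (c z)) (Im (c z)) = z" for z
    unfolding c_def complex_surj using uu by (simp add: mult.assoc[symmetric] mult.commute[of u])
  have cinv: "c (p + u * w) = w" for w
    unfolding c_def using uu by (simp add: mult.assoc[symmetric])
  have cc: "continuous_on A c" for A
    unfolding c_def by (intro continuous_intros)
  define B where "B = {z. \<bar>Re (c z)\<bar> < r \<and> \<bar>Im (c z)\<bar> < h}"
  have B: "open B"
    unfolding B_def by (intro open_Collect_conj open_Collect_less continuous_intros cc)
  have "continuous_on B (\<lambda>z. g (Re (c z)) - Im (c z))"
    by (intro continuous_intros cc continuous_on_compose2[OF lipschitz_on_continuous_on[OF L]])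
       (auto simp: B_def abs_less_iff)
  then have op: "open (B \<inter> (\<lambda>z. g (Re (c z)) - Im (c z)) -` {0<..})"
    using B by (intro continuous_open_preimage) auto
  have dis: "B \<inter> (\<lambda>z. g (Re (c z)) - Im (c z)) -` {0<..} \<inter> W = {}"
    using iff[of "Re (c z)" "Im (c z)" for z] c by (auto simp: B_def)
  have cl: "g s \<le> t" if "\<bar>s\<bar> < r" "\<bar>t\<bar> < h" "p + u * Complex s t \<in> closure W" for s t
  proof (rule ccontr)
    assume "\<not> g s \<le> t"
    then have "p + u * Complex s t \<in> B \<inter> (\<lambda>z. g (Re (c z)) - Im (c z)) -` {0<..}"
      using that by (simp add: B_def cinv)
    then show False
      using that(3) open_Int_closure_eq_empty[OF op] dis by blast
  qed
  show ?thesis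
    by (rule that[OF u rh]) (use iff cl in auto)
qed

text \<open>The straight segment and the graph of the chart are both one-dimensional, so near \<open>p\<close> they
  coincide and the half disc cannot contain further boundary points.\<close>

lemma lipschitz_half_disc:
  fixes \<sigma> :: real
  assumes lip: "lipschitz_domain W" and \<epsilon>: "\<epsilon> > 0"
    and seg: "\<And>\<tau>. \<bar>\<tau>\<bar> < \<epsilon> \<Longrightarrow> p + \<i> * of_real \<tau> \<in> frontier W"
    and half: "W \<subseteq> {z. 0 < \<sigma> * (Re z - Re p)}"
  obtains \<delta> where "\<delta> > 0" "ball p \<delta> \<inter> {z. 0 < \<sigma> * (Re z - Re p)} \<subseteq> W"
proof -
  have "open W"
    using lip by (simp add: lipschitz_domain_def domain_def)
  then have fr: "frontier W = closure W - W"
    by (simp add: frontier_def interior_open)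
  have pf: "p \<in> frontier W"
    using seg[of 0] \<epsilon> by simp
  obtain u r h g where u: "norm u = 1" and rh: "0 < r" "0 < h"
    and iff: "\<And>s t. \<bar>s\<bar> < r \<Longrightarrow> \<bar>t\<bar> < h \<Longrightarrow> p + u * Complex s t \<in> W \<longleftrightarrow> g s < t"
    and cl: "\<And>s t. \<bar>s\<bar> < r \<Longrightarrow> \<bar>t\<bar> < h \<Longrightarrow> p + u * Complex s t \<in> closure W \<Longrightarrow> g s \<le> t"
    using lipschitz_chart[OF lip pf] by metis
  have uu: "u * cnj u = 1"
    using complex_norm_square[of u] u by simp
  have graph: "g s = t" if "\<bar>s\<bar> < r" "\<bar>t\<bar> < h" "p + u * Complex s t \<in> frontier W" for s t
    using iff[of s t] cl[of s t] that fr by auto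
  define v where "v = cnj u * \<i>"
  have nv: "norm v = 1"
    using u by (simp add: v_def norm_mult)
  have v1: "\<bar>Re v\<bar> \<le> 1" "\<bar>Im v\<bar> \<le> 1"
    using abs_Re_le_cmod[of v] abs_Im_le_cmod[of v] nv by auto
  have uv: "u * (of_real \<tau> * v) = \<i> * of_real \<tau>" for \<tau>
  proof -
    have "u * (of_real \<tau> * v) = (u * cnj u) * (\<i> * of_real \<tau>)"
      unfolding v_def by (simp only: mult_ac)
    then show ?thesis
      by (simp add: uu)
  qed
  have line: "g (\<tau> * Re v) = \<tau> * Im v" if "\<bar>\<tau>\<bar> < \<epsilon>" "\<bar>\<tau> * Re v\<bar> < r" "\<bar>\<tau> * Im v\<bar> < h" for \<tau>
  proof -
    have "Complex (\<tau> * Re v) (\<tau> * Im v) = of_real \<tau> * v"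
      by (simp add: complex_eq_iff)
    then show ?thesis
      using graph[of "\<tau> * Re v" "\<tau> * Im v"] that seg[of \<tau>] uv[of \<tau>] by simp
  qed
  have small: "\<bar>\<tau> * x\<bar> < y" if "\<bar>x\<bar> \<le> 1" "\<bar>\<tau>\<bar> < y" for \<tau> x y :: real
  proof -
    have "\<bar>\<tau> * x\<bar> \<le> \<bar>\<tau>\<bar> * 1"
      unfolding abs_mult by (intro mult_left_mono that) auto
    then show ?thesis
      using that by simp
  qed
  \<comment> \<open>If the vertical direction were the graph direction of the chart, the graph would
    take two values over 0.\<close>
  have \<alpha>: "Re v \<noteq> 0"
  proof
    assume 0: "Re v = 0"
    define \<tau> where "\<tau> = min \<epsilon> h / 2"
    have \<tau>: "0 < \<tau>" "\<tau> < \<epsilon>" "\<tau> < h"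
      using \<epsilon> rh by (auto simp: \<tau>_def)
    have "g 0 = \<tau> * Im v"
      using line[of \<tau>] \<tau> rh 0 small[of "Im v" \<tau> h] v1 by simp
    moreover have "g 0 = 0"
      using line[of 0] \<epsilon> rh by simp
    ultimately have "Im v = 0"
      using \<tau> by simp
    with 0 have "v = 0"
      by (simp add: complex_eq_iff)
    then show False
      using nv by simp
  qed
  \<comment> \<open>The factor \<open>\<bar>Re v\<bar>\<close> ensures that every abscissa of
    modulus below \<open>\<delta>\<close> has the form \<open>\<tau> * Re v\<close> with a
    \<open>\<tau>\<close> small enough for \<open>line\<close>.\<close>
  define \<delta> where "\<delta> = \<bar>Re v\<bar> * min \<epsilon> (min r h)"
  have \<delta>: "\<delta> > 0"
    unfolding \<delta>_def using \<alpha> \<epsilon> rh by simp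
  have \<delta>': "\<delta> \<le> r" "\<delta> \<le> h"
  proof -
    have "\<delta> \<le> 1 * min \<epsilon> (min r h)"
      unfolding \<delta>_def using v1 \<epsilon> rh by (intro mult_right_mono) auto
    then show "\<delta> \<le> r" "\<delta> \<le> h"
      by auto
  qed
  define H where "H = ball p \<delta> \<inter> {z. 0 < \<sigma> * (Re z - Re p)}"
  have "convex {z. \<sigma> * Re p < inner (complex_of_real \<sigma>) z}"
    by (rule convex_halfspace_gt)
  moreover have "{z. \<sigma> * Re p < inner (complex_of_real \<sigma>) z} = {z. 0 < \<sigma> * (Re z - Re p)}"
    by (auto simp: inner_complex_def algebra_simps)
  ultimately have "connected H"
    unfolding H_def by (intro convex_connected convex_Int) auto
  moreover have "H \<inter> frontier W = {}"
  proof (rule ccontr)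
    assume "H \<inter> frontier W \<noteq> {}"
    then obtain q where q: "q \<in> H" "q \<in> frontier W"
      by blast
    define c where "c = cnj u * (q - p)"
    have qc: "q = p + u * c"
      unfolding c_def using uu by (simp add: mult.assoc[symmetric])
    have "norm c < \<delta>"
      using q(1) u unfolding H_def c_def by (simp add: norm_mult dist_norm norm_minus_commute)
    then have c: "\<bar>Re c\<bar> < \<delta>" "\<bar>Im c\<bar> < \<delta>"
      using abs_Re_le_cmod[of c] abs_Im_le_cmod[of c] by auto
    have 1: "g (Re c) = Im c"
      using graph[of "Re c" "Im c"] c \<delta>' q(2) qc by simp
    define \<tau> where "\<tau> = Re c / Re v"
    have "\<bar>\<tau>\<bar> < min \<epsilon> (min r h)"
      using c(1) \<alpha> unfolding \<tau>_def \<delta>_def abs_divide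
      by (subst pos_divide_less_eq) (simp_all only: zero_less_abs_iff mult.commute not_False_eq_True)
    then have \<tau>: "\<bar>\<tau>\<bar> < \<epsilon>" "\<bar>\<tau> * Re v\<bar> < r" "\<bar>\<tau> * Im v\<bar> < h"
      using small v1 by auto
    have "Re c = \<tau> * Re v"
      using \<alpha> by (simp add: \<tau>_def)
    moreover from this have "Im c = \<tau> * Im v"
      using line[OF \<tau>] 1 by simp
    ultimately have "c = of_real \<tau> * v"
      by (simp add: complex_eq_iff)
    then have "q = p + \<i> * of_real \<tau>"
      using qc uv by simp
    then show False
      using q(1) by (simp add: H_def)
  qed
  moreover have "H \<inter> W \<noteq> {}"
  proof -
    have "p \<in> closure W"
      using pf fr by auto
    then obtain w where "w \<in> W" "dist w p < \<delta>"
      using closure_approachable \<delta> by blast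
    then show ?thesis
      using half by (auto simp: H_def dist_commute)
  qed
  ultimately have "H \<subseteq> W"
    using connected_Int_frontier by blast
  then show ?thesis
    using that \<delta> unfolding H_def by blast
qed

section \<open>The exponential map, the cell and its translates\<close>

lemma E_eq_iff: "E z = E w \<longleftrightarrow> (\<exists>m::int. z = w + of_int m)"
proof -
  have "E z = E w \<longleftrightarrow> (\<exists>m::int. \<i> * 2 * of_real pi * z = \<i> * 2 * of_real pi * w + (of_int (2 * m) * of_real pi) * \<i>)"
    unfolding E_def exp_eq by simp
  also have "\<dots> \<longleftrightarrow> (\<exists>m::int. \<i> * 2 * of_real pi * z = \<i> * 2 * of_real pi * (w + of_int m))"
    by (simp add: algebra_simps)
  also have "\<dots> \<longleftrightarrow> (\<exists>m::int. z = w + of_int m)"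
    by simp
  finally show ?thesis .
qed

lemma E_holomorphic: "E holomorphic_on S"
  unfolding E_def by (intro holomorphic_intros)

lemma E_has_field_derivative: "(E has_field_derivative 2 * of_real pi * \<i> * E z) (at z)"
  unfolding E_def by (auto intro!: derivative_eq_intros)

locale cell =
  fixes M a b :: real and W :: "complex set"
  assumes ab: "a < b" and cell: "periodic_cell M a b W"
begin

lemma open_W: "open W" and lip_W: "lipschitz_domain W"
  and W_strip: "\<And>z. z \<in> W \<Longrightarrow> 0 < Re z" "\<And>z. z \<in> W \<Longrightarrow> Re z < 1"
  using cell by (auto simp: periodic_cell_def domain_def)

lemma closure_W_left: "z \<in> closure W \<Longrightarrow> Re z = 0 \<Longrightarrow> a \<le> Im z \<and> Im z \<le> b"
proof -
  assume "z \<in> closure W" "Re z = 0"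
  then have "z \<in> {Complex 0 y |y. a \<le> y \<and> y \<le> b}"
    using cell unfolding periodic_cell_def by blast
  then show ?thesis
    by auto
qed

lemma closure_W_right: "z \<in> closure W \<Longrightarrow> Re z = 1 \<Longrightarrow> a \<le> Im z \<and> Im z \<le> b"
proof -
  assume "z \<in> closure W" "Re z = 1"
  then have "z \<in> {Complex 1 y |y. a \<le> y \<and> y \<le> b}"
    using cell unfolding periodic_cell_def by blast
  then show ?thesis
    by auto
qed

lemma closure_W_strip: "z \<in> closure W \<Longrightarrow> 0 \<le> Re z \<and> Re z \<le> 1"
proof -
  have "W \<subseteq> {z. 0 \<le> Re z \<and> Re z \<le> 1}"
    using W_strip by force
  then have "closure W \<subseteq> {z. 0 \<le> Re z \<and> Re z \<le> 1}"
    by (intro closure_minimal closed_Collect_conj closed_Collect_le continuous_intros)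
  then show "z \<in> closure W \<Longrightarrow> 0 \<le> Re z \<and> Re z \<le> 1"
    by blast
qed

lemma frontier_W: "frontier W = closure W - W"
  using open_W by (simp add: frontier_def interior_open)

lemma J_frontier:
  assumes "a < y" "y < b"
  shows "Complex 0 y \<in> frontier W" "Complex 1 y \<in> frontier W"
proof -
  have "Complex 0 y \<in> closure W" "Complex 1 y \<in> closure W"
    using cell assms unfolding periodic_cell_def by force+
  moreover have "Complex 0 y \<notin> W" "Complex 1 y \<notin> W"
    using W_strip by force+
  ultimately show "Complex 0 y \<in> frontier W" "Complex 1 y \<in> frontier W"
    by (auto simp: frontier_W)
qed

text \<open>Near a point of the left side the plane consists of \<open>W\<close>, the translate of
  \<open>W\<close> by -1, and the side itself; consecutive cells are glued by this. The half disc on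
  the left comes from the right side of \<open>W\<close>. A radius below 1/2 keeps the points on the
  proper side of the line \<open>Re z = 1/2\<close> that separates \<open>cell_left\<close> from
  \<open>cell_right\<close>.\<close>

lemma half_discs:
  assumes "a < y" "y < b"
  obtains \<delta> where "\<delta> > 0" "\<delta> < 1/2"
    "\<And>z. z \<in> ball (Complex 0 y) \<delta> \<Longrightarrow> 0 < Re z \<Longrightarrow> z \<in> W"
    "\<And>z. z \<in> ball (Complex 0 y) \<delta> \<Longrightarrow> Re z < 0 \<Longrightarrow> z + 1 \<in> W"
    "\<And>z. z \<in> ball (Complex 0 y) \<delta> \<Longrightarrow> Re z = 0 \<Longrightarrow> z \<in> J_minus a b"
proof -
  define \<epsilon> where "\<epsilon> = min (y - a) (b - y)"
  have \<epsilon>: "\<epsilon> > 0"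
    using assms by (simp add: \<epsilon>_def)
  have c: "Complex x y + \<i> * of_real \<tau> = Complex x (y + \<tau>)" for x \<tau>
    by (simp add: complex_eq_iff)
  obtain \<delta>0 where 0: "\<delta>0 > 0" "ball (Complex 0 y) \<delta>0 \<inter> {z. 0 < 1 * (Re z - Re (Complex 0 y))} \<subseteq> W"
    by (rule lipschitz_half_disc[OF lip_W \<epsilon>, of "Complex 0 y" 1])
       (use W_strip in \<open>auto simp: c \<epsilon>_def intro!: J_frontier\<close>)
  obtain \<delta>1 where 1: "\<delta>1 > 0" "ball (Complex 1 y) \<delta>1 \<inter> {z. 0 < -1 * (Re z - Re (Complex 1 y))} \<subseteq> W"
    by (rule lipschitz_half_disc[OF lip_W \<epsilon>, of "Complex 1 y" "-1"])
       (use W_strip in \<open>auto simp: c \<epsilon>_def intro!: J_frontier\<close>)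
  define \<delta> where "\<delta> = min (min \<delta>0 \<delta>1) (min \<epsilon> (1/4))"
  show ?thesis
  proof (rule that[of \<delta>])
    show "\<delta> > 0" "\<delta> < 1/2"
      using 0 1 \<epsilon> by (auto simp: \<delta>_def)
    fix z assume z: "z \<in> ball (Complex 0 y) \<delta>"
    show "z \<in> W" if "0 < Re z"
      using z that 0(2) by (auto simp: \<delta>_def)
    have "dist (Complex 1 y) (z + 1) = dist (Complex 0 y) z"
      by (simp add: dist_norm) (metis Complex_eq_1 add.commute add_diff_cancel_left add_diff_eq complex_add add_0 add.right_neutral)
    then show "z + 1 \<in> W" if "Re z < 0"
      using z that 1(2) by (auto simp: \<delta>_def)
    show "z \<in> J_minus a b" if "Re z = 0"
    proof -
      have "\<bar>y - Im z\<bar> < \<epsilon>"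
        using z abs_Im_le_cmod[of "Complex 0 y - z"] by (auto simp: \<delta>_def dist_norm)
      then show ?thesis
        unfolding J_minus_def \<epsilon>_def using that by (auto intro!: exI[of _ "Im z"] simp: complex_eq_iff)
    qed
  qed
qed

text \<open>The union of the integer translates of the cell with its open sides. It takes the place
  of the periodic domain: it is contained in that domain, it contains
  \<open>closure W \<inter> periodic_domain W\<close>, and as a preimage under \<open>E\<close> it
  is periodic and the natural domain of \<open>\<phi> \<circ> E\<close>.\<close>

definition P :: "complex set" where "P = E -` ring_domain a b W"

lemma J_plus_iff: "z \<in> J_plus a b \<longleftrightarrow> z - 1 \<in> J_minus a b"
  by (auto simp: J_plus_def J_minus_def complex_eq_iff)

lemma mem_P: "z \<in> P \<longleftrightarrow> (\<exists>m::int. z - of_int m \<in> W \<union> J_minus a b)"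
proof -
  have "z \<in> P \<longleftrightarrow> (\<exists>w \<in> W \<union> J_plus a b \<union> J_minus a b. \<exists>m::int. z = w + of_int m)"
    by (simp only: P_def ring_domain_def vimage_eq image_iff E_eq_iff)
  also have "\<dots> \<longleftrightarrow> (\<exists>m::int. z - of_int m \<in> W \<union> J_plus a b \<union> J_minus a b)"
    by (metis add_diff_cancel diff_add_cancel)
  also have "\<dots> \<longleftrightarrow> (\<exists>m::int. z - of_int m \<in> W \<union> J_minus a b)"
  proof -
    have "z - of_int m \<in> J_plus a b \<longleftrightarrow> z - of_int (m + 1) \<in> J_minus a b" for m
      unfolding J_plus_iff by (simp add: algebra_simps)
    then show ?thesis
      by (metis Un_iff)
  qed
  finally show ?thesis .
qed

lemma P_shift: "z + of_int m \<in> P \<longleftrightarrow> z \<in> P"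
  unfolding P_def by (simp add: E_eq_iff[of "z + of_int m" z, THEN iffD2])

lemma W_P: "W \<subseteq> P" and J_minus_P: "J_minus a b \<subseteq> P" and J_plus_P: "J_plus a b \<subseteq> P"
  unfolding P_def ring_domain_def by auto

lemma open_P: "open P"
proof (rule openI)
  have loc: "\<exists>e>0. ball z e \<subseteq> P" if z: "z \<in> W \<union> J_minus a b" for z
  proof (cases "z \<in> W")
    case True
    then show ?thesis
      using open_W W_P open_contains_ball by (meson subset_trans)
  next
    case False
    then obtain y where y: "z = Complex 0 y" "a < y" "y < b"
      using z by (auto simp: J_minus_def)
    obtain \<delta> where d: "\<delta> > 0"
      "\<And>w. w \<in> ball (Complex 0 y) \<delta> \<Longrightarrow> 0 < Re w \<Longrightarrow> w \<in> W"
      "\<And>w. w \<in> ball (Complex 0 y) \<delta> \<Longrightarrow> Re w < 0 \<Longrightarrow> w + 1 \<in> W"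
      "\<And>w. w \<in> ball (Complex 0 y) \<delta> \<Longrightarrow> Re w = 0 \<Longrightarrow> w \<in> J_minus a b"
      using half_discs[OF y(2,3)] by metis
    have "w \<in> P" if w: "w \<in> ball z \<delta>" for w
    proof (cases "Re w" "0::real" rule: linorder_cases)
      case less
      then have "w + of_int 1 \<in> P"
        using d(3)[of w] w y W_P by auto
      then show ?thesis
        by (simp only: P_shift)
    qed (use d w y W_P J_minus_P in auto)
    then show ?thesis
      using d(1) by blast
  qed
  fix z assume "z \<in> P"
  then obtain m :: int where "z - of_int m \<in> W \<union> J_minus a b"
    using mem_P by blast
  then obtain e where e: "e > 0" "ball (z - of_int m) e \<subseteq> P"
    using loc by blast
  have "ball z e \<subseteq> P"
  proof
    fix w assume "w \<in> ball z e"
    then have "w - of_int m \<in> ball (z - of_int m) e"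
      by (simp add: dist_norm algebra_simps)
    then have "w - of_int m + of_int m \<in> P"
      using e(2) P_shift by blast
    then show "w \<in> P"
      by simp
  qed
  then show "\<exists>e>0. ball z e \<subseteq> P"
    using e(1) by blast
qed

text \<open>\<open>E\<close> is locally injective and therefore maps small discs onto open sets.
  Openness turns holomorphy of \<open>\<phi>\<close> on the ring into differentiability at each of
  its points.\<close>

lemma open_ring_domain: "open (ring_domain a b W)"
proof -
  have "ring_domain a b W = E ` P"
    unfolding P_def ring_domain_def by auto
  moreover have "open (E ` P)"
  proof (rule openI)
    fix \<zeta> assume "\<zeta> \<in> E ` P"
    then obtain z where z: "z \<in> P" "\<zeta> = E z"
      by blast
    have "deriv E z \<noteq> 0"
      using DERIV_imp_deriv[OF E_has_field_derivative[of z]] by (simp add: E_def)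
    then obtain r where r: "r > 0" "ball z r \<subseteq> P" "inj_on E (ball z r)"
      using has_complex_derivative_locally_injective[OF E_holomorphic z(1) open_P] by metis
    have "open (E ` ball z r)"
      by (rule open_mapping_thm3[OF E_holomorphic _ r(3)]) auto
    moreover have "\<zeta> \<in> E ` ball z r" "E ` ball z r \<subseteq> E ` P"
      using z r by auto
    ultimately show "\<exists>e>0. ball \<zeta> e \<subseteq> E ` P"
      using open_contains_ball by (meson subset_trans)
  qed
  ultimately show ?thesis
    by simp
qed

lemma closure_translate_cell: "closure (translate_cell m W) = (\<lambda>z. z + of_int m) ` closure W"
proof -
  have "translate_cell m W = (\<lambda>z. of_int m + z) ` W" "(\<lambda>z. z + of_int m) ` closure W = (\<lambda>z. of_int m + z) ` closure W"
    by (auto simp: translate_cell_def add.commute)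
  then show ?thesis
    by (simp add: closure_translation)
qed

lemma P_subset: "P \<subseteq> periodic_domain W"
  unfolding periodic_domain_def
proof (rule interior_maximal[OF _ open_P], rule subsetI)
  fix z assume "z \<in> P"
  then obtain m :: int where m: "z - of_int m \<in> W \<union> J_minus a b"
    using mem_P by blast
  have "J_minus a b \<subseteq> closure W"
    using J_frontier(1) frontier_W by (auto simp: J_minus_def)
  then have "z - of_int m \<in> closure W"
    using m closure_subset by blast
  then have "z \<in> closure (translate_cell m W)"
    unfolding closure_translate_cell by (intro image_eqI[where x = "z - of_int m"]) auto
  then show "z \<in> (\<Union>m. closure (translate_cell m W))"
    by blast
qed

lemma periodic_domain_translate:
  assumes "z \<in> periodic_domain W"
  obtains m :: int where "z - of_int m \<in> closure W"
proof -
  obtain m where "z \<in> closure (translate_cell m W)"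
    using assms interior_subset unfolding periodic_domain_def by blast
  then show ?thesis
    using that[of m] unfolding closure_translate_cell by auto
qed

text \<open>On the vertical lines an interior point of the periodic domain can be moved up and down,
  which excludes the corners. Between the lines a boundary point of \<open>W\<close> that is
  interior to the periodic domain would have a disc inside \<open>closure W\<close>; a Lipschitz
  chart excludes this, because points below the graph lie outside the closure. In particular there
  are no slits.\<close>

lemma closure_Int_periodic_domain:
  "closure W \<inter> periodic_domain W \<subseteq> W \<union> J_plus a b \<union> J_minus a b"
proof
  fix p assume p: "p \<in> closure W \<inter> periodic_domain W"
  have op: "open (periodic_domain W)"
    by (simp add: periodic_domain_def)
  show "p \<in> W \<union> J_plus a b \<union> J_minus a b"
  proof (cases "Re p = 0 \<or> Re p = 1")
    case True
    obtain e where e: "e > 0" "ball p e \<subseteq> periodic_domain W"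
      using op p open_contains_ball by blast
    \<comment> \<open>Vertical moves keep the real part an integer, so the moved point still lies on
      a closed side of a translated cell.\<close>
    have *: "a \<le> Im p + s \<and> Im p + s \<le> b" if "\<bar>s\<bar> < e" for s
    proof -
      have "p + \<i> * of_real s \<in> ball p e"
        using that by (simp add: dist_norm norm_mult)
      then obtain m :: int where m: "p + \<i> * of_real s - of_int m \<in> closure W"
        using e(2) periodic_domain_translate by blast
      have "0 \<le> Re p - of_int m" "Re p - of_int m \<le> 1"
        using closure_W_strip[OF m] by auto
      then have "Re p - of_int m = 0 \<or> Re p - of_int m = 1"
        using True by auto
      then show ?thesis
        using closure_W_left[OF m] closure_W_right[OF m] by auto
    qed
    have "a < Im p" "Im p < b"
      using *[of "e/2"] *[of "-e/2"] e(1) by auto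
    then show ?thesis
      using True by (auto simp: J_plus_def J_minus_def complex_eq_iff intro: exI[of _ "Im p"])
  next
    case False
    show ?thesis
    proof (rule ccontr)
      assume "p \<notin> W \<union> J_plus a b \<union> J_minus a b"
      then have pf: "p \<in> frontier W" "p \<notin> W"
        using p by (auto simp: frontier_W)
      have "p \<in> periodic_domain W \<inter> {z. 0 < Re z \<and> Re z < 1}"
        using False closure_W_strip[of p] p by auto
      moreover have "open (periodic_domain W \<inter> {z. 0 < Re z \<and> Re z < 1})"
        by (intro open_Int op open_Collect_conj open_Collect_less continuous_intros)
      ultimately obtain e where e: "e > 0" "ball p e \<subseteq> periodic_domain W \<inter> {z. 0 < Re z \<and> Re z < 1}"
        using open_contains_ball by blast
      have sub: "ball p e \<subseteq> closure W"
      proof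
        fix q assume "q \<in> ball p e"
        then have q: "q \<in> periodic_domain W" "0 < Re q" "Re q < 1"
          using e(2) by auto
        then obtain m :: int where m: "q - of_int m \<in> closure W"
          using periodic_domain_translate by blast
        have "m = 0"
          using closure_W_strip[OF m] q by auto
        then show "q \<in> closure W"
          using m by simp
      qed
      obtain u r h g where u: "norm u = 1" and rh: "0 < r" "0 < h"
        and iff: "\<And>s t. \<bar>s\<bar> < r \<Longrightarrow> \<bar>t\<bar> < h \<Longrightarrow> p + u * Complex s t \<in> W \<longleftrightarrow> g s < t"
        and cl: "\<And>s t. \<bar>s\<bar> < r \<Longrightarrow> \<bar>t\<bar> < h \<Longrightarrow> p + u * Complex s t \<in> closure W \<Longrightarrow> g s \<le> t"
        using lipschitz_chart[OF lip_W pf(1)] by metis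
      have "g 0 \<ge> 0"
        using iff[of 0 0] rh pf(2) by (simp add: complex_eq_iff flip: zero_complex.code)
      \<comment> \<open>A point of the disc strictly below the graph, since \<open>g 0\<close> is
        nonnegative.\<close>
      define t where "t = - min e h / 2"
      have t: "t < 0" "\<bar>t\<bar> < e" "\<bar>t\<bar> < h"
        using e(1) rh by (auto simp: t_def)
      have "norm (Complex 0 t) = \<bar>t\<bar>"
        by (simp add: cmod_def)
      then have "p + u * Complex 0 t \<in> ball p e"
        using u t by (simp add: dist_norm norm_mult)
      then have "g 0 \<le> t"
        using cl[of 0 t] sub t rh by auto
      then show False
        using t \<open>g 0 \<ge> 0\<close> by simp
    qed
  qed
qed

end

section \<open>The logarithm of the conformal map\<close>

text \<open>Near \<open>p\<close> the values of \<open>L\<close> stay within \<pi> of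
  \<open>L p\<close>, so there \<open>L\<close> equals \<open>L p + Ln (f z / f p)\<close>, with the
  principal logarithm taken near 1.\<close>

lemma holomorphic_log:
  assumes S: "open S" and f: "f holomorphic_on S" and L: "continuous_on S L"
    and exp: "\<And>z. z \<in> S \<Longrightarrow> exp (L z) = f z"
  shows "L holomorphic_on S"
proof -
  have "L field_differentiable (at p)" if p: "p \<in> S" for p
  proof -
    have fp: "f p \<noteq> 0"
      using exp[OF p] by auto
    have "isCont L p"
      using L S p continuous_on_eq_continuous_at by blast
    then have "(L \<longlongrightarrow> L p) (nhds p)"
      by (simp add: isCont_def tendsto_at_iff_tendsto_nhds)
    then have "\<forall>\<^sub>F z in nhds p. dist (L z) (L p) < pi"
      by (rule tendstoD) simp
    then have "\<forall>\<^sub>F z in nhds p. L z = L p + Ln (f z / f p)"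
      using eventually_nhds_in_open[OF S p]
    proof eventually_elim
      case (elim z)
      have "\<bar>Im (L z - L p)\<bar> < pi"
        using elim(1) abs_Im_le_cmod[of "L z - L p"] by (simp add: dist_norm)
      then have "Ln (exp (L z - L p)) = L z - L p"
        by (intro Ln_exp) auto
      then show ?case
        using exp[OF p] exp[OF elim(2)] by (simp add: exp_diff)
    qed
    moreover obtain d where "((\<lambda>z. L p + Ln (f z / f p)) has_field_derivative d) (at p)"
    proof -
      have "f field_differentiable (at p)"
        using f S p holomorphic_on_imp_differentiable_at by blast
      moreover have "f p / f p \<notin> \<real>\<^sub>\<le>\<^sub>0"
        using fp by simp
      ultimately have "(\<lambda>z. L p + Ln (f z / f p)) field_differentiable (at p)"
        using fp by (intro derivative_intros field_differentiable_compose[of "\<lambda>z. f z / f p" p Ln, unfolded o_def]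
            field_differentiable_within_Ln) auto
      then show ?thesis
        using that by (auto simp: field_differentiable_def)
    qed
    ultimately have "(L has_field_derivative d) (at p)"
      using DERIV_cong_ev[of p p L "\<lambda>z. L p + Ln (f z / f p)" d d] by blast
    then show ?thesis
      by (auto simp: field_differentiable_def)
  qed
  then show ?thesis
    by (simp add: holomorphic_on_def field_differentiable_at_within)
qed

locale annular_cell = cell M a b W for M a b W +
  fixes \<rho> :: real and \<phi> :: "complex \<Rightarrow> complex" and \<theta> :: "complex \<Rightarrow> real"
  assumes rho: "\<rho> > 1" and conf: "conformal_onto_annulus (ring_domain a b W) \<rho> \<phi>"
    and asm_A: "assumption_A a b W \<phi>" and branch: "is_arg_branch a b W \<phi> \<theta>"
begin

definition \<Phi> :: "complex \<Rightarrow> complex" where "\<Phi> z = \<phi> (E z)"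

text \<open>On the lines where the real part is an integer, which \<open>\<phi> \<circ> E\<close> maps to \<open>\<Gamma>\<close>, the branch \<open>\<theta>\<close> is not
  available. There assumption (A) makes the principal logarithm the continuous continuation of the
  branch on the left half of the adjacent cell.\<close>

definition \<Lambda> :: "complex \<Rightarrow> complex" where
  "\<Lambda> z = (if Re z = of_int \<lfloor>Re z\<rfloor> then Ln (\<Phi> z) else log_branch \<theta> (\<Phi> z)) + 2 * of_real pi * \<i> * of_int \<lfloor>Re z\<rfloor>"

lemma phi_holomorphic: "\<phi> holomorphic_on ring_domain a b W"
  and phi_inj: "inj_on \<phi> (ring_domain a b W)"
  and phi_image: "\<phi> ` ring_domain a b W = annulus \<rho>"
  using conf unfolding conformal_onto_annulus_def bij_betw_def by auto

lemma \<Phi>_holomorphic: "\<Phi> holomorphic_on P"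
  unfolding \<Phi>_def
  by (rule holomorphic_on_compose_gen[OF E_holomorphic phi_holomorphic, unfolded o_def]) (auto simp: P_def)

lemma \<Phi>_annulus: "z \<in> P \<Longrightarrow> \<Phi> z \<in> annulus \<rho>"
  using phi_image unfolding \<Phi>_def P_def by auto

lemma annulus_nonzero: "\<omega> \<in> annulus \<rho> \<Longrightarrow> \<omega> \<noteq> 0"
  using rho by (auto simp: annulus_def)

lemma \<Phi>_nonzero: "z \<in> P \<Longrightarrow> \<Phi> z \<noteq> 0"
  using \<Phi>_annulus annulus_nonzero by blast

lemma \<Phi>_shift: "\<Phi> (z + of_int m) = \<Phi> z"
  unfolding \<Phi>_def using E_eq_iff by metis

lemma \<Phi>_eq_iff: "z \<in> P \<Longrightarrow> w \<in> P \<Longrightarrow> \<Phi> z = \<Phi> w \<longleftrightarrow> (\<exists>m::int. z = w + of_int m)"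
  using inj_on_eq_iff[OF phi_inj, of "E z" "E w"] E_eq_iff[of z w] by (simp add: \<Phi>_def P_def)

text \<open>The cell with its left side only is a fundamental domain of \<open>P\<close> for integer
  translations.\<close>

lemma \<Phi>_inj: "inj_on \<Phi> (W \<union> J_minus a b)"
proof (rule inj_onI)
  fix z w assume zw: "z \<in> W \<union> J_minus a b" "w \<in> W \<union> J_minus a b" and eq: "\<Phi> z = \<Phi> w"
  have "z \<in> P" "w \<in> P"
    using zw W_P J_minus_P by auto
  then obtain m :: int where m: "z = w + of_int m"
    using eq \<Phi>_eq_iff by blast
  have "0 \<le> Re z" "Re z < 1" "0 \<le> Re w" "Re w < 1"
    using zw W_strip by (auto simp: J_minus_def less_imp_le)
  with m have "m = 0"
    by auto
  with m show "z = w"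
    by simp
qed

lemma \<Phi>_surj: "\<omega> \<in> annulus \<rho> \<Longrightarrow> \<exists>z \<in> W \<union> J_minus a b. \<Phi> z = \<omega>"
proof -
  assume "\<omega> \<in> annulus \<rho>"
  then have "\<omega> \<in> \<phi> ` ring_domain a b W"
    by (simp add: phi_image)
  then obtain d where d: "d \<in> ring_domain a b W" "\<phi> d = \<omega>"
    by (elim imageE) simp
  then obtain z where e: "d = E z"
    unfolding ring_domain_def by blast
  have z: "z \<in> P" "\<Phi> z = \<omega>"
    using d unfolding e by (simp_all add: \<Phi>_def P_def)
  then obtain m :: int where "z - of_int m \<in> W \<union> J_minus a b"
    using mem_P by blast
  moreover have "\<Phi> (z - of_int m) = \<Phi> z"
    using \<Phi>_shift[of "z - of_int m" m] by simp
  ultimately show ?thesis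
    using z by blast
qed

lemma \<Phi>_deriv: "z \<in> P \<Longrightarrow> (\<Phi> has_field_derivative deriv \<phi> (E z) * (2 * of_real pi * \<i> * E z)) (at z)"
  unfolding \<Phi>_def
  by (rule DERIV_chain2[OF holomorphic_derivI[OF phi_holomorphic open_ring_domain] E_has_field_derivative])
     (simp add: P_def)

lemma phi_deriv_nonzero: "z \<in> P \<Longrightarrow> deriv \<phi> (E z) \<noteq> 0"
  using holomorphic_injective_imp_regular[OF phi_holomorphic open_ring_domain phi_inj] by (simp add: P_def)

lemma deriv_\<Phi>: "z \<in> P \<Longrightarrow> deriv \<Phi> z = deriv \<phi> (E z) * (2 * of_real pi * \<i> * E z)"
  using \<Phi>_deriv DERIV_imp_deriv by blast

lemma deriv_\<Phi>_nonzero: "z \<in> P \<Longrightarrow> deriv \<Phi> z \<noteq> 0"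
  using deriv_\<Phi> phi_deriv_nonzero by (simp add: E_def)

lemma exp_log_branch: "z \<in> W \<Longrightarrow> exp (log_branch \<theta> (\<Phi> z)) = \<Phi> z"
proof -
  assume z: "z \<in> W"
  then have "\<Phi> z \<in> \<phi> ` E ` W"
    by (auto simp: \<Phi>_def)
  then have "\<Phi> z = of_real (norm (\<Phi> z)) * cis (\<theta> (\<Phi> z))"
    using branch unfolding is_arg_branch_def by blast
  moreover have "norm (\<Phi> z) > 0"
    using \<Phi>_nonzero z W_P by auto
  moreover have "exp (log_branch \<theta> (\<Phi> z)) = of_real (exp (ln (norm (\<Phi> z)))) * cis (\<theta> (\<Phi> z))"
    by (simp only: log_branch_def exp_add cis_conv_exp exp_of_real)
  ultimately show ?thesis
    by simp
qed

lemma \<theta>_range: "z \<in> W \<Longrightarrow> 0 \<le> \<theta> (\<Phi> z)" "z \<in> W \<Longrightarrow> \<theta> (\<Phi> z) \<le> 3 * pi"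
  using branch unfolding is_arg_branch_def \<Phi>_def by auto

lemma \<Lambda>_shift: "\<Lambda> (z + of_int m) = \<Lambda> z + 2 * of_real pi * \<i> * of_int m"
  unfolding \<Lambda>_def by (simp add: \<Phi>_shift algebra_simps)

lemma \<Lambda>_W: "z \<in> W \<Longrightarrow> \<Lambda> z = log_branch \<theta> (\<Phi> z)"
proof -
  assume "z \<in> W"
  then have "0 < Re z" "Re z < 1"
    using W_strip by auto
  then have "\<lfloor>Re z\<rfloor> = 0"
    by (simp add: floor_eq_iff)
  then show ?thesis
    using \<open>0 < Re z\<close> by (simp add: \<Lambda>_def)
qed

lemma \<Lambda>_J: "z \<in> J_minus a b \<Longrightarrow> \<Lambda> z = Ln (\<Phi> z)"
  by (auto simp: \<Lambda>_def J_minus_def)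

lemma exp_\<Lambda>: "z \<in> P \<Longrightarrow> exp (\<Lambda> z) = \<Phi> z"
proof -
  assume z: "z \<in> P"
  then obtain m :: int where m: "z - of_int m \<in> W \<union> J_minus a b"
    using mem_P by blast
  have "exp (\<Lambda> (z - of_int m)) = \<Phi> (z - of_int m)"
    using m \<Lambda>_W \<Lambda>_J exp_log_branch J_minus_P \<Phi>_nonzero by auto
  moreover have "\<Phi> (z - of_int m) = \<Phi> z" "\<Lambda> z = \<Lambda> (z - of_int m) + 2 * of_real pi * \<i> * of_int m"
    using \<Phi>_shift[of "z - of_int m" m] \<Lambda>_shift[of "z - of_int m" m] by auto
  moreover have "exp (2 * of_real pi * \<i> * of_int m) = 1"
    using exp_integer_2pi[of "of_int m"] by (simp add: mult_ac)
  ultimately show ?thesis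
    by (simp add: exp_add)
qed

lemma J_minus_upper_half:
  assumes "p \<in> J_minus a b"
  shows "\<Phi> p \<in> Gamma_curve a b W \<phi>" "0 < Im (\<Phi> p)"
proof -
  have "E p \<in> ring_domain a b W"
    using J_minus_P assms by (auto simp: P_def)
  moreover have "E p \<in> positive_axis"
  proof -
    obtain y where y: "p = Complex 0 y"
      using assms by (auto simp: J_minus_def)
    have "E p = of_real (exp (- 2 * pi * y))"
      unfolding E_def y exp_of_real[symmetric] by (rule arg_cong[of _ _ exp]) (simp add: complex_eq_iff)
    then show ?thesis
      by (auto simp: positive_axis_def)
  qed
  ultimately show G: "\<Phi> p \<in> Gamma_curve a b W \<phi>"
    by (auto simp: Gamma_curve_def \<Phi>_def)
  obtain \<delta> where "0 < \<delta>" "\<delta> < Arg (\<Phi> p)" "Arg (\<Phi> p) < pi - \<delta>"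
    using asm_A G unfolding assumption_A_def by blast
  then have "0 < Arg (\<Phi> p)" "Arg (\<Phi> p) < pi"
    by linarith+
  then show "0 < Im (\<Phi> p)"
    using Arg_lt_pi by blast
qed

text \<open>Near a point of the left side all pieces of \<open>\<Lambda>\<close> agree with
  \<open>Ln \<circ> \<Phi>\<close>. On the right the argument lies in [0, \<pi>). On the left the
  point belongs to the previous cell, where the argument lies in (2\<pi>, 3\<pi>] and the floor -1
  takes off 2\<pi>. Both ranges fit the principal branch, which is holomorphic since
  \<open>\<Phi>\<close> has values in the upper half plane there.\<close>

lemma \<Lambda>_near_J:
  assumes p: "p \<in> J_minus a b"
  obtains e where "e > 0" "ball p e \<subseteq> P" "\<Lambda> holomorphic_on ball p e"
proof -
  obtain y where y: "p = Complex 0 y" "a < y" "y < b"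
    using p by (auto simp: J_minus_def)
  obtain \<delta> where d: "\<delta> > 0" "\<delta> < 1/2"
      "\<And>w. w \<in> ball p \<delta> \<Longrightarrow> 0 < Re w \<Longrightarrow> w \<in> W"
      "\<And>w. w \<in> ball p \<delta> \<Longrightarrow> Re w < 0 \<Longrightarrow> w + 1 \<in> W"
      "\<And>w. w \<in> ball p \<delta> \<Longrightarrow> Re w = 0 \<Longrightarrow> w \<in> J_minus a b"
    using half_discs[OF y(2,3)] unfolding y(1) by metis
  have pP: "p \<in> P"
    using p J_minus_P by blast
  have "\<forall>\<^sub>F \<omega> in nhds (\<Phi> p). (\<omega> \<in> \<phi> ` E ` cell_left W \<longrightarrow> \<theta> \<omega> < pi) \<and> (\<omega> \<in> \<phi> ` E ` cell_right W \<longrightarrow> \<theta> \<omega> > 2 * pi)"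
    using branch J_minus_upper_half(1)[OF p] unfolding is_arg_branch_def by blast
  moreover have "\<forall>\<^sub>F \<omega> in nhds (\<Phi> p). 0 < Im \<omega>"
    using J_minus_upper_half(2)[OF p]
    by (intro eventually_nhds_in_open[of "{\<omega>. 0 < Im \<omega>}", simplified]) (auto intro: open_halfspace_Im_gt)
  ultimately obtain N where N: "open N" "\<Phi> p \<in> N"
    "\<And>\<omega>. \<omega> \<in> N \<Longrightarrow> 0 < Im \<omega>"
    "\<And>\<omega>. \<omega> \<in> N \<Longrightarrow> \<omega> \<in> \<phi> ` E ` cell_left W \<Longrightarrow> \<theta> \<omega> < pi"
    "\<And>\<omega>. \<omega> \<in> N \<Longrightarrow> \<omega> \<in> \<phi> ` E ` cell_right W \<Longrightarrow> \<theta> \<omega> > 2 * pi"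
    using eventually_conj unfolding eventually_nhds by (smt (verit, best) Int_iff open_Int)
  have "open (P \<inter> \<Phi> -` N)"
    using continuous_open_preimage[OF holomorphic_on_imp_continuous_on[OF \<Phi>_holomorphic] open_P N(1)] .
  then obtain e0 where e0: "e0 > 0" "ball p e0 \<subseteq> P \<inter> \<Phi> -` N"
    using pP N(2) open_contains_ball by (metis IntI vimageI)
  define e where "e = min e0 \<delta>"
  have e: "e > 0" "ball p e \<subseteq> P" "\<And>z. z \<in> ball p e \<Longrightarrow> \<Phi> z \<in> N" "ball p e \<subseteq> ball p \<delta>"
    using e0 d(1) by (auto simp: e_def)
  have Ln: "\<Lambda> z = Ln (\<Phi> z)" if z: "z \<in> ball p e" for z
  proof (cases "Re z" "0::real" rule: linorder_cases)
    case equal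
    then show ?thesis
      using d(5) z e(4) \<Lambda>_J by blast
  next
    case greater
    then have zW: "z \<in> W"
      using d(3) z e(4) by blast
    have "Re z < 1/2"
      using z d(2) abs_Re_le_cmod[of "p - z"] y(1) by (auto simp: e_def dist_norm)
    then have "\<Phi> z \<in> \<phi> ` E ` cell_left W"
      using zW by (auto simp: \<Phi>_def cell_left_def cell_right_def)
    then have "\<theta> (\<Phi> z) < pi" "0 \<le> \<theta> (\<Phi> z)"
      using N(4) e(3) z \<theta>_range zW by auto
    then have "Ln (exp (log_branch \<theta> (\<Phi> z))) = log_branch \<theta> (\<Phi> z)"
      by (intro Ln_exp) (auto simp: log_branch_def intro: less_le_trans[of _ 0])
    then show ?thesis
      using exp_log_branch[OF zW] \<Lambda>_W[OF zW] by simp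
  next
    case less
    then have zW: "z + 1 \<in> W"
      using d(4) z e(4) by blast
    have "Re z > - (1/2)"
      using z d(2) abs_Re_le_cmod[of "p - z"] y(1) by (auto simp: e_def dist_norm)
    then have c: "z + 1 \<in> cell_right W"
      using zW by (auto simp: cell_right_def)
    have \<Phi>1: "\<Phi> (z + 1) = \<Phi> z"
      using \<Phi>_shift[of z 1] by simp
    then have "\<Phi> z \<in> \<phi> ` E ` cell_right W"
      using c by (metis \<Phi>_def imageI)
    then have "\<theta> (\<Phi> z) > 2 * pi" "\<theta> (\<Phi> z) \<le> 3 * pi"
      using N(5) e(3) z \<theta>_range(2)[OF zW] \<Phi>1 by auto
    then have "Ln (exp (log_branch \<theta> (\<Phi> z) - 2 * of_real pi * \<i>)) = log_branch \<theta> (\<Phi> z) - 2 * of_real pi * \<i>"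
      by (intro Ln_exp) (auto simp: log_branch_def intro: less_le_trans[of _ 0])
    moreover have "exp (log_branch \<theta> (\<Phi> z) - 2 * of_real pi * \<i>) = \<Phi> z"
      using exp_log_branch[OF zW] \<Phi>1 exp_two_pi_i by (simp add: exp_diff)
    moreover have "\<Lambda> z = log_branch \<theta> (\<Phi> z) - 2 * of_real pi * \<i>"
      using \<Lambda>_shift[of z 1] \<Lambda>_W[OF zW] \<Phi>1 by (simp add: algebra_simps)
    ultimately show ?thesis
      by simp
  qed
  have "(\<lambda>z. Ln (\<Phi> z)) holomorphic_on ball p e"
  proof (rule holomorphic_on_Ln')
    show "\<Phi> holomorphic_on ball p e"
      using \<Phi>_holomorphic e(2) holomorphic_on_subset by blast
    show "\<Phi> z \<notin> \<real>\<^sub>\<le>\<^sub>0" if "z \<in> ball p e" for z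
      using N(3)[OF e(3)[OF that]] by (auto simp: complex_nonpos_Reals_iff)
  qed
  then have "\<Lambda> holomorphic_on ball p e"
    by (rule holomorphic_transform) (use Ln in simp)
  then show ?thesis
    using that e by blast
qed

text \<open>Integer translations only add a constant to \<open>\<Lambda>\<close>, so
  differentiability at the points of \<open>W\<close> and of its left side suffices.\<close>

lemma \<Lambda>_holomorphic: "\<Lambda> holomorphic_on P"
proof -
  have hW: "\<Lambda> holomorphic_on W"
  proof (rule holomorphic_log[OF open_W holomorphic_on_subset[OF \<Phi>_holomorphic W_P]])
    have c: "continuous_on W \<Phi>"
      using \<Phi>_holomorphic W_P holomorphic_on_imp_continuous_on holomorphic_on_subset by blast
    have "continuous_on W (\<lambda>z. \<theta> (\<Phi> z))"
      by (rule continuous_on_compose2[OF _ c, of "\<phi> ` E ` W"])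
         (use branch in \<open>auto simp: is_arg_branch_def \<Phi>_def\<close>)
    then have "continuous_on W (\<lambda>z. log_branch \<theta> (\<Phi> z))"
      unfolding log_branch_def using c \<Phi>_nonzero W_P by (intro continuous_intros) auto
    then show "continuous_on W \<Lambda>"
      by (rule continuous_on_eq) (simp add: \<Lambda>_W)
    show "exp (\<Lambda> z) = \<Phi> z" if "z \<in> W" for z
      using exp_\<Lambda> that W_P by blast
  qed
  have "\<Lambda> field_differentiable (at z)" if z: "z \<in> P" for z
  proof -
    obtain m :: int where m: "z - of_int m \<in> W \<union> J_minus a b"
      using z mem_P by blast
    have "\<Lambda> field_differentiable (at (z - of_int m))"
    proof (cases "z - of_int m \<in> W")
      case True
      then show ?thesis
        using hW open_W holomorphic_on_imp_differentiable_at by blast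
    next
      case False
      then have "z - of_int m \<in> J_minus a b"
        using m by blast
      then obtain e where "e > 0" "\<Lambda> holomorphic_on ball (z - of_int m) e"
        using \<Lambda>_near_J by blast
      then show ?thesis
        using holomorphic_on_imp_differentiable_at by (metis centre_in_ball open_ball)
    qed
    then obtain d where "(\<Lambda> has_field_derivative d) (at (z - of_int m))"
      by (auto simp: field_differentiable_def)
    then have "((\<lambda>w. \<Lambda> (w + (- of_int m))) has_field_derivative d) (at z)"
      by (subst DERIV_shift[symmetric]) simp
    then have "((\<lambda>w. \<Lambda> (w - of_int m) + 2 * of_real pi * \<i> * of_int m) has_field_derivative d) (at z)"
      using DERIV_add[OF _ DERIV_const] by fastforce
    moreover have "(\<lambda>w. \<Lambda> (w - of_int m) + 2 * of_real pi * \<i> * of_int m) = \<Lambda>"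
    proof
      show "\<Lambda> (w - of_int m) + 2 * of_real pi * \<i> * of_int m = \<Lambda> w" for w
        using \<Lambda>_shift[of "w - of_int m" m] by simp
    qed
    ultimately show ?thesis
      unfolding field_differentiable_def by metis
  qed
  then show ?thesis
    by (simp add: holomorphic_on_def field_differentiable_at_within)
qed

lemma deriv_\<Lambda>_mult: "z \<in> P \<Longrightarrow> deriv \<Phi> z = \<Phi> z * deriv \<Lambda> z"
proof -
  assume z: "z \<in> P"
  have "((\<lambda>w. exp (\<Lambda> w)) has_field_derivative exp (\<Lambda> z) * deriv \<Lambda> z) (at z)"
    by (rule DERIV_chain2[OF DERIV_exp holomorphic_derivI[OF \<Lambda>_holomorphic open_P z]])
  then have "(\<Phi> has_field_derivative exp (\<Lambda> z) * deriv \<Lambda> z) (at z)"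
    by (rule has_field_derivative_transform_within_open[OF _ open_P z]) (rule exp_\<Lambda>)
  then show ?thesis
    using exp_\<Lambda>[OF z] DERIV_imp_deriv by metis
qed

lemma deriv_\<Lambda>_nonzero: "z \<in> P \<Longrightarrow> deriv \<Lambda> z \<noteq> 0"
  using deriv_\<Lambda>_mult deriv_\<Phi>_nonzero by fastforce

lemma deriv_\<Lambda>_holomorphic: "deriv \<Lambda> holomorphic_on P"
  by (rule holomorphic_deriv[OF \<Lambda>_holomorphic open_P])

lemma deriv_\<Lambda>_shift: "z \<in> P \<Longrightarrow> deriv \<Lambda> (z + 1) = deriv \<Lambda> z"
proof -
  assume z: "z \<in> P"
  then have z1: "z + 1 \<in> P"
    using P_shift[of z 1] by simp
  have "((\<lambda>w. \<Lambda> (w + 1) - 2 * of_real pi * \<i>) has_field_derivative deriv \<Lambda> (z + 1)) (at z)"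
    using holomorphic_derivI[OF \<Lambda>_holomorphic open_P z1, of UNIV]
    by (auto intro!: derivative_eq_intros simp: DERIV_shift)
  moreover have "(\<lambda>w. \<Lambda> (w + 1) - 2 * of_real pi * \<i>) = \<Lambda>"
    using \<Lambda>_shift[of _ 1] by (auto simp: fun_eq_iff)
  ultimately show ?thesis
    using DERIV_imp_deriv by fastforce
qed

lemma Re_\<Lambda>: "z \<in> P \<Longrightarrow> Re (\<Lambda> z) = ln (norm (\<Phi> z))"
  using exp_\<Lambda>[of z] by (metis norm_exp_eq_Re ln_exp)

lemma Re_\<Lambda>_bound: "z \<in> P \<Longrightarrow> \<bar>Re (\<Lambda> z)\<bar> < ln \<rho>"
proof -
  assume z: "z \<in> P"
  have "1 / \<rho> < norm (\<Phi> z)" "norm (\<Phi> z) < \<rho>"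
    using \<Phi>_annulus[OF z] by (auto simp: annulus_def)
  then have "ln (1 / \<rho>) < ln (norm (\<Phi> z))" "ln (norm (\<Phi> z)) < ln \<rho>"
    using rho \<Phi>_nonzero[OF z] by (subst ln_less_cancel_iff; simp)+
  then show ?thesis
    using Re_\<Lambda>[OF z] rho by (simp add: ln_div)
qed

end

section \<open>The orthogonal basis\<close>

context annular_cell
begin

definition Q :: "complex set" where
  "Q = {s. - ln \<rho> < Re s \<and> Re s < ln \<rho> \<and> 0 < Im s \<and> Im s < 2 * pi}"

lemma open_Q: "open Q"
  unfolding Q_def by (intro open_Collect_conj open_Collect_less continuous_intros)

lemma exp_Q: "s \<in> Q \<Longrightarrow> exp s \<in> annulus \<rho>" "s \<in> Q \<Longrightarrow> exp s \<notin> \<real>\<^sub>\<ge>\<^sub>0"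
proof -
  assume s: "s \<in> Q"
  have "exp (- ln \<rho>) < exp (Re s)" "exp (Re s) < exp (ln \<rho>)"
    using s by (auto simp: Q_def)
  then show "exp s \<in> annulus \<rho>"
    using rho by (simp add: annulus_def norm_exp_eq_Re exp_minus inverse_eq_divide)
  show "exp s \<notin> \<real>\<^sub>\<ge>\<^sub>0"
  proof
    assume "exp s \<in> \<real>\<^sub>\<ge>\<^sub>0"
    then have "sin (Im s) = 0" "cos (Im s) \<ge> 0"
      by (auto simp: complex_nonneg_Reals_iff Re_exp Im_exp zero_le_mult_iff)
    then have "cos (Im s) = 1"
      using sin_cos_squared_add[of "Im s"] by (simp add: power2_eq_1_iff)
    then obtain n :: int where n: "Im s = of_int n * (2 * pi)"
      using cos_one_2pi_int[of "Im s"] by auto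
    have "0 < of_int n * (2 * pi)" "of_int n * (2 * pi) < 1 * (2 * pi)"
      using s n by (auto simp: Q_def)
    then have "0 < (of_int n :: real)" "(of_int n :: real) < 1"
      by (simp_all add: zero_less_mult_iff)
    then show False
      by simp
  qed
qed

lemma negligible_real_axis: "negligible {z. Im z = 0}"
proof -
  have "{z. Im z = 0} = {z. inner \<i> z = 0}"
    by (auto simp: inner_complex_def)
  then show ?thesis
    using negligible_hyperplane[of \<i> 0] by simp
qed

text \<open>The branch of the logarithm with imaginary part in \<open>]0, 2 * pi[\<close>. Its cut, the positive axis,
  avoids \<open>\<Gamma>\<close>.\<close>

definition \<Lambda>0 :: "complex \<Rightarrow> complex" where "\<Lambda>0 \<omega> = Ln (- \<omega>) + \<i> * of_real pi"

lemma exp_\<Lambda>0: "\<omega> \<noteq> 0 \<Longrightarrow> exp (\<Lambda>0 \<omega>) = \<omega>"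
  by (simp add: \<Lambda>0_def exp_add mult.commute)

lemma \<Lambda>0_holomorphic: "\<Lambda>0 holomorphic_on - \<real>\<^sub>\<ge>\<^sub>0"
  unfolding \<Lambda>0_def
  by (intro holomorphic_intros) (auto simp: complex_nonpos_Reals_iff complex_nonneg_Reals_iff)

lemma \<Lambda>0_exp: "s \<in> Q \<Longrightarrow> \<Lambda>0 (exp s) = s"
proof -
  assume "s \<in> Q"
  then have "Ln (exp (s - \<i> * of_real pi)) = s - \<i> * of_real pi"
    by (intro Ln_exp) (auto simp: Q_def)
  moreover have "exp (s - \<i> * of_real pi) = - exp s"
    by (simp add: exp_diff mult.commute)
  ultimately show ?thesis
    by (simp add: \<Lambda>0_def)
qed

lemma \<Lambda>0_Q:
  assumes "\<omega> \<in> annulus \<rho>" "\<omega> \<notin> \<real>\<^sub>\<ge>\<^sub>0"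
  shows "\<Lambda>0 \<omega> \<in> Q"
proof -
  have nz: "\<omega> \<noteq> 0"
    using assms annulus_nonzero by blast
  have "1 / \<rho> < norm \<omega>" "norm \<omega> < \<rho>"
    using assms by (auto simp: annulus_def)
  then have "ln (1 / \<rho>) < ln (norm \<omega>)" "ln (norm \<omega>) < ln \<rho>"
    using rho nz by (subst ln_less_cancel_iff; simp)+
  then have "- ln \<rho> < Re (\<Lambda>0 \<omega>)" "Re (\<Lambda>0 \<omega>) < ln \<rho>"
    using rho nz by (auto simp: \<Lambda>0_def ln_div)
  moreover have "- pi < Im (Ln (- \<omega>))" "Im (Ln (- \<omega>)) \<le> pi"
    using nz mpi_less_Im_Ln[of "- \<omega>"] Im_Ln_le_pi[of "- \<omega>"] by auto
  moreover have "Im (Ln (- \<omega>)) \<noteq> pi"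
  proof
    assume "Im (Ln (- \<omega>)) = pi"
    then have "Re (- \<omega>) < 0 \<and> Im (- \<omega>) = 0"
      using Im_Ln_eq_pi[of "- \<omega>"] nz by auto
    then show False
      using assms(2) by (auto simp: complex_nonneg_Reals_iff)
  qed
  ultimately show ?thesis
    by (auto simp: Q_def \<Lambda>0_def)
qed

text \<open>The substitution is \<open>L = \<Lambda>0 \<circ> \<Phi>\<close>, which takes its values
  in \<open>Q\<close> and has the derivative of \<open>\<Lambda>\<close>, since both are logarithms
  of \<open>\<Phi>\<close>. It is injective because \<open>\<Phi>\<close> is. Exceptional sets arise
  on both sides: the points of \<open>W\<close> over the cut of \<open>\<Lambda>0\<close>, and the
  points of \<open>Q\<close> that come from the side of the cell.\<close>

lemma change_to_rectangle:
  fixes G :: "complex \<Rightarrow> complex"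
  assumes G: "continuous_on (annulus \<rho>) G"
  shows "integrable (lebesgue_on W) (\<lambda>z. (norm (deriv \<Lambda> z))\<^sup>2 *\<^sub>R G (\<Phi> z)) \<longleftrightarrow>
           integrable (lebesgue_on Q) (\<lambda>s. G (exp s))"
    and "integral\<^sup>L (lebesgue_on W) (\<lambda>z. (norm (deriv \<Lambda> z))\<^sup>2 *\<^sub>R G (\<Phi> z)) =
           integral\<^sup>L (lebesgue_on Q) (\<lambda>s. G (exp s))"
proof -
  have hW: "\<Phi> holomorphic_on W"
    using \<Phi>_holomorphic W_P holomorphic_on_subset by blast
  have injW: "inj_on \<Phi> W"
    using \<Phi>_inj inj_on_subset by blast
  define V where "V = W \<inter> \<Phi> -` (- \<real>\<^sub>\<ge>\<^sub>0)"
  have op: "open V"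
    unfolding V_def
    by (rule continuous_open_preimage[OF holomorphic_on_imp_continuous_on[OF hW] open_W]) (simp add: open_Compl)
  have VW: "V \<subseteq> W"
    by (auto simp: V_def)
  have VP: "V \<subseteq> P"
    using VW W_P by blast
  define L where "L = (\<lambda>z. \<Lambda>0 (\<Phi> z))"
  have holL: "L holomorphic_on V"
    unfolding L_def
    by (rule holomorphic_on_compose_gen[OF holomorphic_on_subset[OF hW VW] \<Lambda>0_holomorphic, unfolded o_def])
       (auto simp: V_def)
  have expL: "exp (L z) = \<Phi> z" if "z \<in> V" for z
    using that VP \<Phi>_nonzero exp_\<Lambda>0 unfolding L_def by blast
  have injL: "inj_on L V"
    by (rule inj_onI) (metis expL injW VW inj_onD subsetD)
  have dL: "deriv L z = deriv \<Lambda> z" if z: "z \<in> V" for z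
  proof -
    have "((\<lambda>w. exp (L w)) has_field_derivative exp (L z) * deriv L z) (at z)"
      by (rule DERIV_chain2[OF DERIV_exp holomorphic_derivI[OF holL op z]])
    then have "(\<Phi> has_field_derivative exp (L z) * deriv L z) (at z)"
      by (rule has_field_derivative_transform_within_open[OF _ op z]) (rule expL)
    then have "\<Phi> z * deriv L z = deriv \<Phi> z"
      using expL[OF z] DERIV_imp_deriv by metis
    then show ?thesis
      using deriv_\<Lambda>_mult[of z] \<Phi>_nonzero[of z] z VP by auto
  qed
  \<comment> \<open>The removed set is the image of a piece of the real axis under the inverse of
    \<open>\<Phi>\<close>, and differentiable maps of the plane preserve null sets.\<close>
  have negW: "negligible (W - V)"
  proof -
    obtain g where g: "g holomorphic_on \<Phi> ` W" "\<And>z. z \<in> W \<Longrightarrow> g (\<Phi> z) = z"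
      using holomorphic_has_inverse[OF hW open_W injW] by metis
    have "negligible (g ` (\<Phi> ` W \<inter> {z. Im z = 0}))"
    proof (rule negligible_differentiable_image_negligible)
      show "negligible (\<Phi> ` W \<inter> {z. Im z = 0})"
        by (rule negligible_subset[OF negligible_real_axis]) auto
      have "g differentiable_on \<Phi> ` W"
        using g(1) holomorphic_on_imp_differentiable_on by blast
      then show "g differentiable_on (\<Phi> ` W \<inter> {z. Im z = 0})"
        by (rule differentiable_on_subset) auto
    qed simp
    moreover have "W - V \<subseteq> g ` (\<Phi> ` W \<inter> {z. Im z = 0})"
    proof
      fix z assume "z \<in> W - V"
      then have z: "z \<in> W" "Im (\<Phi> z) = 0"
        by (auto simp: V_def complex_nonneg_Reals_iff)
      then show "z \<in> g ` (\<Phi> ` W \<inter> {z. Im z = 0})"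
        using g(2)[OF z(1)] by (intro image_eqI[where x = "\<Phi> z"]) auto
    qed
    ultimately show ?thesis
      using negligible_subset by blast
  qed
  have LQ: "L ` V \<subseteq> Q"
    using \<Lambda>0_Q \<Phi>_annulus VP by (auto simp: L_def V_def)
  have negQ: "negligible (Q - L ` V)"
  proof -
    define X where "X = ring_domain a b W \<inter> positive_axis"
    have nX: "negligible X"
      unfolding X_def positive_axis_def by (rule negligible_subset[OF negligible_real_axis]) auto
    have up: "0 < Im (\<phi> x)" if x: "x \<in> X" for x
    proof -
      have "\<phi> x \<in> Gamma_curve a b W \<phi>"
        using x by (auto simp: X_def Gamma_curve_def)
      then obtain \<delta> where "0 < \<delta>" "\<delta> < Arg (\<phi> x)" "Arg (\<phi> x) < pi - \<delta>"
        using asm_A unfolding assumption_A_def by blast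
      then have "0 < Arg (\<phi> x)" "Arg (\<phi> x) < pi"
        by linarith+
      then show ?thesis
        using Arg_lt_pi by blast
    qed
    define Y where "Y = ring_domain a b W \<inter> \<phi> -` (- \<real>\<^sub>\<ge>\<^sub>0)"
    have opY: "open Y"
      unfolding Y_def
      by (rule continuous_open_preimage[OF holomorphic_on_imp_continuous_on[OF phi_holomorphic] open_ring_domain])
         (simp add: open_Compl)
    have "\<phi> holomorphic_on Y"
      by (rule holomorphic_on_subset[OF phi_holomorphic]) (auto simp: Y_def)
    then have "(\<lambda>x. \<Lambda>0 (\<phi> x)) holomorphic_on Y"
      by (rule holomorphic_on_compose_gen[OF _ \<Lambda>0_holomorphic, unfolded o_def]) (auto simp: Y_def)
    then have "(\<lambda>x. \<Lambda>0 (\<phi> x)) differentiable_on Y"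
      using holomorphic_on_imp_differentiable_on by blast
    moreover have "X \<subseteq> Y"
      using up by (force simp: X_def Y_def complex_nonneg_Reals_iff)
    ultimately have "(\<lambda>x. \<Lambda>0 (\<phi> x)) differentiable_on X"
      using differentiable_on_subset by blast
    then have "negligible ((\<lambda>x. \<Lambda>0 (\<phi> x)) ` X)"
      by (rule negligible_differentiable_image_negligible[OF order_refl nX])
    moreover have "Q - L ` V \<subseteq> (\<lambda>x. \<Lambda>0 (\<phi> x)) ` X"
    proof
      fix s assume s: "s \<in> Q - L ` V"
      then obtain z where z: "z \<in> W \<union> J_minus a b" "\<Phi> z = exp s"
        using \<Phi>_surj exp_Q(1) by (metis DiffD1)
      have sL: "s = \<Lambda>0 (\<Phi> z)"
        using z(2) \<Lambda>0_exp s by simp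
      have "z \<notin> W"
      proof
        assume "z \<in> W"
        then have "z \<in> V"
          using z(2) exp_Q(2) s by (auto simp: V_def)
        then show False
          using s sL by (auto simp: L_def)
      qed
      then have zJ: "z \<in> J_minus a b"
        using z(1) by blast
      then have "\<Phi> z \<in> \<phi> ` X"
        using J_minus_upper_half(1)[OF zJ] by (simp add: Gamma_curve_def X_def)
      then show "s \<in> (\<lambda>x. \<Lambda>0 (\<phi> x)) ` X"
        using sL by auto
    qed
    ultimately show ?thesis
      using negligible_subset by blast
  qed
  have opLV: "open (L ` V)"
    using open_mapping_thm3[OF holL op injL] .
  have cont: "continuous_on (L ` V) (\<lambda>s. G (exp s))"
    by (rule continuous_on_compose2[OF G]) (use LQ exp_Q in \<open>auto intro!: continuous_intros\<close>)
  have eqV: "(norm (deriv L z))\<^sup>2 *\<^sub>R G (exp (L z)) = (norm (deriv \<Lambda> z))\<^sup>2 *\<^sub>R G (\<Phi> z)" if "z \<in> V" for z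
    using that dL expL by simp
  note cov = holomorphic_change_of_variables[OF op holL injL cont]
  have "integrable (lebesgue_on W) (\<lambda>z. (norm (deriv \<Lambda> z))\<^sup>2 *\<^sub>R G (\<Phi> z)) \<longleftrightarrow>
      integrable (lebesgue_on V) (\<lambda>z. (norm (deriv \<Lambda> z))\<^sup>2 *\<^sub>R G (\<Phi> z))"
    using op open_W VW negW by (intro integrable_lebesgue_on_negligible_diff) auto
  also have "\<dots> \<longleftrightarrow> integrable (lebesgue_on V) (\<lambda>z. (norm (deriv L z))\<^sup>2 *\<^sub>R G (exp (L z)))"
    by (rule Bochner_Integration.integrable_cong) (simp_all add: eqV)
  also have "\<dots> \<longleftrightarrow> integrable (lebesgue_on (L ` V)) (\<lambda>s. G (exp s))"
    by (rule cov(1))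
  also have "\<dots> \<longleftrightarrow> integrable (lebesgue_on Q) (\<lambda>s. G (exp s))"
    using opLV open_Q LQ negQ by (intro integrable_lebesgue_on_negligible_diff(1)[symmetric]) auto
  finally show "integrable (lebesgue_on W) (\<lambda>z. (norm (deriv \<Lambda> z))\<^sup>2 *\<^sub>R G (\<Phi> z)) \<longleftrightarrow>
      integrable (lebesgue_on Q) (\<lambda>s. G (exp s))" .
  have "integral\<^sup>L (lebesgue_on W) (\<lambda>z. (norm (deriv \<Lambda> z))\<^sup>2 *\<^sub>R G (\<Phi> z)) =
      integral\<^sup>L (lebesgue_on V) (\<lambda>z. (norm (deriv \<Lambda> z))\<^sup>2 *\<^sub>R G (\<Phi> z))"
    using op open_W VW negW by (intro integrable_lebesgue_on_negligible_diff) auto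
  also have "\<dots> = integral\<^sup>L (lebesgue_on V) (\<lambda>z. (norm (deriv L z))\<^sup>2 *\<^sub>R G (exp (L z)))"
    by (rule Bochner_Integration.integral_cong) (simp_all add: eqV)
  also have "\<dots> = integral\<^sup>L (lebesgue_on (L ` V)) (\<lambda>s. G (exp s))"
    by (rule cov(2))
  also have "\<dots> = integral\<^sup>L (lebesgue_on Q) (\<lambda>s. G (exp s))"
    using opLV open_Q LQ negQ by (intro integrable_lebesgue_on_negligible_diff(2)[symmetric]) auto
  finally show "integral\<^sup>L (lebesgue_on W) (\<lambda>z. (norm (deriv \<Lambda> z))\<^sup>2 *\<^sub>R G (\<Phi> z)) =
      integral\<^sup>L (lebesgue_on Q) (\<lambda>s. G (exp s))" .
qed

end

section \<open>Laurent coefficients of powers and squared norms of exponentials\<close>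

lemma laurent_coeff_power_int:
  assumes r: "r > 0"
  shows "laurent_coeff (\<lambda>w. w powi k) r n = (if n = k then 1 else 0)"
proof -
  define j where "j = k - n - 1"
  have nz: "w \<noteq> 0" if "w \<in> path_image (circlepath 0 r)" for w
    using that r by auto
  have "contour_integral (circlepath 0 r) (\<lambda>w. w powi k / w powi (n + 1)) =
      contour_integral (circlepath 0 r) (\<lambda>w. w powi j)"
  proof (rule contour_integral_eq)
    fix w assume "w \<in> path_image (circlepath 0 r)"
    then show "w powi k / w powi (n + 1) = w powi j"
      using nz[of w] power_int_diff[of w k "n + 1"] unfolding j_def by (simp add: algebra_simps)
  qed
  also have "\<dots> = (if n = k then 2 * of_real pi * \<i> else 0)"
  proof (cases "n = k")
    case True
    then show ?thesis
      using contour_integral_circlepath[OF r, of 0] by (simp add: j_def power_int_minus inverse_eq_divide)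
  next
    case False
    then have j: "(of_int (j + 1) :: complex) \<noteq> 0"
      unfolding j_def of_int_eq_0_iff by simp
    have "((\<lambda>w. w powi j) has_contour_integral 0) (circlepath 0 r)"
    proof (rule Cauchy_theorem_primitive[where S = "- {0}"])
      fix w :: complex assume "w \<in> - {0}"
      then have w: "w \<noteq> 0"
        by simp
      show "((\<lambda>w. w powi (j + 1) / of_int (j + 1)) has_field_derivative w powi j) (at w within - {0})"
        using DERIV_cdivide[OF DERIV_power_int[OF DERIV_ident, of "j + 1" w "- {0}"], of "of_int (j + 1)"] w j
        by (simp del: of_int_add)
    next
      show "path_image (circlepath 0 r) \<subseteq> - {0}"
        using nz by blast
    qed simp_all
    then show ?thesis
      using False by (simp add: contour_integral_unique)
  qed
  finally show ?thesis
    by (simp add: laurent_coeff_def)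
qed

text \<open>The integral of \<open>exp (s * Re \<zeta>)\<close> over the rectangle ]-R, R[ x ]0,
  2\<pi>[. For \<open>R = ln \<rho>\<close> and \<open>s = 2 * n + \<eta> / pi\<close> it is the
  squared norm of the n-th basis function.\<close>

definition exp_mass :: "real \<Rightarrow> real \<Rightarrow> real" where
  "exp_mass R s = (LBINT u:{-R<..<R}. 2 * pi * exp (s * u))"

lemma exp_mass_eq:
  assumes R: "R > 0"
  shows "exp_mass R s = (if s = 0 then 4 * pi * R else 2 * pi * (exp (s * R) - exp (- s * R)) / s)"
proof -
  define F where "F = (\<lambda>u. if s = 0 then 2 * pi * u else 2 * pi * exp (s * u) / s)"
  have "set_integrable lborel {-R..R} (\<lambda>u. 2 * pi * exp (s * u))"
    by (rule borel_integrable_atLeastAtMost') (intro continuous_intros)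
  then have "set_integrable lborel {-R<..<R} (\<lambda>u. 2 * pi * exp (s * u))"
    by (rule set_integrable_subset) auto
  then have "exp_mass R s = integral {-R..R} (\<lambda>u. 2 * pi * exp (s * u))"
    unfolding exp_mass_def by (simp add: set_borel_integral_eq_integral(2) integral_open_interval_real)
  also have "((\<lambda>u. 2 * pi * exp (s * u)) has_integral (F R - F (- R))) {-R..R}"
  proof (rule fundamental_theorem_of_calculus)
    fix u show "(F has_vector_derivative 2 * pi * exp (s * u)) (at u within {- R..R})"
      unfolding F_def has_real_derivative_iff_has_vector_derivative[symmetric]
      by (cases "s = 0") (auto intro!: derivative_eq_intros)
  qed (use R in simp)
  then have "integral {-R..R} (\<lambda>u. 2 * pi * exp (s * u)) = F R - F (- R)"
    by (rule integral_unique)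
  also have "\<dots> = (if s = 0 then 4 * pi * R else 2 * pi * (exp (s * R) - exp (- s * R)) / s)"
    by (simp add: F_def diff_divide_distrib right_diff_distrib)
  finally show ?thesis .
qed

text \<open>Lowering the growth rate from \<open>R\<close> to any \<open>r < R\<close> buys a
  constant that does not degenerate for large or vanishing \<open>s\<close>. On a compact set
  \<open>\<bar>Re (\<Lambda> z)\<bar>\<close> stays away from \<open>ln \<rho>\<close>, so there is
  room for this loss.\<close>

lemma exp_mass_lower:
  assumes r: "0 \<le> r" "r < R"
  shows "exp_mass R s \<ge> 2 * pi * (R - r) * exp (\<bar>s\<bar> * r)"
proof -
  have pos: "(exp (t * R) - exp (- t * R)) / t \<ge> (R - r) * exp (t * r)" if t: "t > 0" for t
  proof -
    \<comment> \<open>After multiplication by \<open>exp (t * r)\<close>, the summand 1 becomes the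
      term that absorbs \<open>exp (- t * R)\<close>.\<close>
    have "t * (R - r) + 1 \<le> exp (t * (R - r))"
      using exp_ge_add_one_self[of "t * (R - r)"] by (simp add: add.commute)
    then have "(t * (R - r) + 1) * exp (t * r) \<le> exp (t * (R - r)) * exp (t * r)"
      by (rule mult_right_mono) simp
    also have "\<dots> = exp (t * R)"
      by (simp add: exp_add[symmetric] algebra_simps)
    finally have "t * ((R - r) * exp (t * r)) + exp (t * r) \<le> exp (t * R)"
      by (simp add: algebra_simps)
    moreover have "0 \<le> t * (R + r)"
      using t r by simp
    then have "- t * R \<le> t * r"
      by (simp add: algebra_simps)
    then have "exp (- t * R) \<le> exp (t * r)"
      by simp
    ultimately have "t * ((R - r) * exp (t * r)) \<le> exp (t * R) - exp (- t * R)"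
      by linarith
    then show ?thesis
      using t by (simp add: pos_le_divide_eq mult.commute)
  qed
  have R: "R > 0"
    using r by linarith
  have pi2: "2 * pi * x \<le> 2 * pi * y" if "x \<le> y" for x y
    using that by simp
  consider "s = 0" | "s > 0" | "s < 0"
    by linarith
  then show ?thesis
  proof cases
    case 1
    then show ?thesis
      using r R by (simp add: exp_mass_eq)
  next
    case 2
    then show ?thesis
      using pi2[OF pos[of s]] R by (simp add: exp_mass_eq mult.assoc)
  next
    case 3
    have eq: "(x - y) / (- s) = (y - x) / s" for x y
      by (simp add: diff_divide_distrib)
    have "(R - r) * exp (- s * r) \<le> (exp (- s * R) - exp (- (- s) * R)) / (- s)"
      by (rule pos) (use 3 in simp)
    then have "(R - r) * exp (- s * r) \<le> (exp (s * R) - exp (- s * R)) / s"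
      unfolding eq minus_minus .
    then show ?thesis
      using pi2[of "(R - r) * exp (- s * r)" "(exp (s * R) - exp (- s * R)) / s"] R 3
      by (simp add: exp_mass_eq mult.assoc)
  qed
qed

lemma exp_mass_pos: "R > 0 \<Longrightarrow> exp_mass R s > 0"
  using less_le_trans[of 0 "2 * pi * R" "exp_mass R s"] exp_mass_lower[of 0 R s] by simp

text \<open>The range of \<open>\<eta>\<close> enters here: since
  \<open>\<bar>\<eta> / pi\<bar> \<le> 1 < 2\<close>, the exponent
  \<open>2 * n + \<eta> / pi\<close> vanishes only for \<open>\<eta> = 0\<close> and
  \<open>n = 0\<close>, the case given its limit value in the definition.\<close>

lemma kernel_coeff_eq:
  assumes "\<rho> > 1" "- pi \<le> \<eta>" "\<eta> \<le> pi"
  shows "kernel_coeff \<rho> \<eta> n = 1 / exp_mass (ln \<rho>) (2 * of_int n + \<eta> / pi)"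
proof -
  define s where "s = 2 * of_int n + \<eta> / pi"
  have R: "ln \<rho> > 0"
    using assms by simp
  have s0: "s = 0 \<longleftrightarrow> \<eta> = 0 \<and> n = 0"
  proof
    assume s: "s = 0"
    have "\<bar>\<eta> / pi\<bar> \<le> 1"
      using assms by (simp add: abs_le_iff field_simps)
    then have "\<bar>2 * of_int n\<bar> \<le> (1::real)"
      using s unfolding s_def by linarith
    then have "n = 0"
      by linarith
    then show "\<eta> = 0 \<and> n = 0"
      using s by (simp add: s_def)
  qed (auto simp: s_def)
  have p: "\<rho> powr (2 * of_int n + \<eta> / pi) = exp (s * ln \<rho>)"
    "\<rho> powr (- 2 * of_int n - \<eta> / pi) = exp (- s * ln \<rho>)"
    using assms by (simp_all add: powr_def s_def algebra_simps)
  show ?thesis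
    unfolding kernel_coeff_def p unfolding s_def[symmetric] s0[symmetric] exp_mass_eq[OF R] by simp
qed

section \<open>The quasiperiodic basis functions\<close>

context annular_cell
begin

definition basis :: "real \<Rightarrow> int \<Rightarrow> complex \<Rightarrow> complex" where
  "basis \<eta> n z = deriv \<Lambda> z * exp (of_real (of_int n + \<eta> / (2 * pi)) * \<Lambda> z)"

lemma basis_holomorphic: "basis \<eta> n holomorphic_on P"
  unfolding basis_def by (intro holomorphic_intros deriv_\<Lambda>_holomorphic \<Lambda>_holomorphic)

text \<open>The power of \<open>\<Phi>\<close> descends to the annulus; the remaining factor carries
  the multiplier and is common to all \<open>n\<close>.\<close>

lemma basis_factorization:
  "z \<in> P \<Longrightarrow> basis \<eta> n z = \<Phi> z powi n * exp (of_real (\<eta> / (2 * pi)) * \<Lambda> z) * deriv \<Lambda> z"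
  unfolding exp_\<Lambda>[symmetric] exp_power_int basis_def
  by (simp add: exp_add[symmetric] algebra_simps)

lemma norm_basis:
  "(norm (basis \<eta> n z))\<^sup>2 = (norm (deriv \<Lambda> z))\<^sup>2 * exp ((2 * of_int n + \<eta> / pi) * Re (\<Lambda> z))"
proof -
  have "2 * ((of_int n + \<eta> / (2 * pi)) * Re (\<Lambda> z)) = (2 * of_int n + \<eta> / pi) * Re (\<Lambda> z)"
    by (simp add: field_simps)
  then have "(exp ((of_int n + \<eta> / (2 * pi)) * Re (\<Lambda> z)))\<^sup>2 = exp ((2 * of_int n + \<eta> / pi) * Re (\<Lambda> z))"
    by (simp only: exp_double[symmetric])
  moreover have "norm (deriv \<Lambda> z * exp (of_real c * \<Lambda> z)) = norm (deriv \<Lambda> z) * exp (c * Re (\<Lambda> z))" for c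
    by (simp add: norm_mult)
  then have "norm (basis \<eta> n z) = norm (deriv \<Lambda> z) * exp ((of_int n + \<eta> / (2 * pi)) * Re (\<Lambda> z))"
    unfolding basis_def .
  ultimately show ?thesis
    by (simp only: power_mult_distrib)
qed

lemma basis_shift:
  assumes "z \<in> P"
  shows "basis \<eta> n (z + 1) = exp (\<i> * of_real \<eta>) * basis \<eta> n z"
proof -
  have "of_real (of_int n + \<eta> / (2 * pi)) * (2 * of_real pi * \<i>) = \<i> * of_real \<eta> + 2 * of_int n * of_real pi * \<i>"
    by (simp add: field_simps)
  moreover have "exp (2 * of_int n * of_real pi * \<i>) = 1"
    using exp_integer_2pi[of "of_int n"] by (simp add: mult_ac)
  ultimately have "exp (of_real (of_int n + \<eta> / (2 * pi)) * (2 * of_real pi * \<i>)) = exp (\<i> * of_real \<eta>)"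
    by (simp add: exp_add)
  moreover have "\<Lambda> (z + 1) = \<Lambda> z + 2 * of_real pi * \<i>"
    using \<Lambda>_shift[of z 1] by simp
  ultimately show ?thesis
    unfolding basis_def deriv_\<Lambda>_shift[OF assms] by (simp add: distrib_left exp_add)
qed

lemma integrable_exp_Q: "integrable (lebesgue_on Q) (\<lambda>s. exp (c * Re s))"
proof -
  have "(\<lambda>s. exp (c * Re s)) absolutely_integrable_on cbox (Complex (- ln \<rho>) 0) (Complex (ln \<rho>) (2 * pi))"
    by (intro absolutely_integrable_continuous continuous_intros)
  moreover have "Q \<subseteq> cbox (Complex (- ln \<rho>) 0) (Complex (ln \<rho>) (2 * pi))"
    by (auto simp: Q_def in_cbox_complex_iff)
  ultimately have "(\<lambda>s. exp (c * Re s)) absolutely_integrable_on Q"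
    using open_Q by (intro set_integrable_subset[of lebesgue _ _ Q]) auto
  then show ?thesis
    using open_Q by (subst integrable_restrict_space) (auto simp: set_integrable_def)
qed

text \<open>On the rectangle the squared modulus becomes \<open>exp (c * Re s)\<close>, which is
  bounded there.\<close>

lemma basis_L2: "basis \<eta> n \<in> L2 W"
proof -
  define c where "c = 2 * of_int n + \<eta> / pi"
  define G where "G = (\<lambda>\<omega>::complex. complex_of_real (exp (c * ln (norm \<omega>))))"
  have G: "continuous_on (annulus \<rho>) G"
    unfolding G_def using annulus_nonzero by (intro continuous_intros) auto
  have "integrable (lebesgue_on Q) (\<lambda>s. G (exp s))"
    unfolding G_def complex_of_real_integrable_eq using integrable_exp_Q[of c] by simp
  then have "integrable (lebesgue_on W) (\<lambda>z. (norm (deriv \<Lambda> z))\<^sup>2 *\<^sub>R G (\<Phi> z))"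
    using change_to_rectangle(1)[OF G] by blast
  moreover have "integrable (lebesgue_on W) (\<lambda>z. (norm (deriv \<Lambda> z))\<^sup>2 *\<^sub>R G (\<Phi> z)) \<longleftrightarrow>
     integrable (lebesgue_on W) (\<lambda>z. complex_of_real ((norm (basis \<eta> n z))\<^sup>2))"
  proof (rule Bochner_Integration.integrable_cong[OF refl])
    fix z assume "z \<in> space (lebesgue_on W)"
    then have "z \<in> P"
      using W_P by auto
    then show "(norm (deriv \<Lambda> z))\<^sup>2 *\<^sub>R G (\<Phi> z) = complex_of_real ((norm (basis \<eta> n z))\<^sup>2)"
      unfolding norm_basis G_def Re_\<Lambda>[OF \<open>z \<in> P\<close>] c_def[symmetric]
      by (simp add: scaleR_conv_of_real)
  qed
  ultimately have "integrable (lebesgue_on W) (\<lambda>z. (norm (basis \<eta> n z))\<^sup>2)"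
    unfolding complex_of_real_integrable_eq by blast
  moreover have "basis \<eta> n \<in> borel_measurable (lebesgue_on W)"
    using open_W holomorphic_on_subset[OF basis_holomorphic W_P] by (rule holomorphic_borel_measurable_lebesgue_on)
  ultimately show ?thesis
    by (simp add: L2_def)
qed

text \<open>The squared modulus of \<open>exp (\<eta> / (2 * pi) * \<Lambda>)\<close> depends on the
  modulus of \<open>\<Phi>\<close> only, so the product is the Jacobian times a single-valued
  function of \<open>\<Phi>\<close>. On the rectangle the angular integral yields a Laurent
  coefficient, the same for every radius, and the radial integral yields \<open>exp_mass\<close>.
  The same formula gives orthogonality (with \<open>h\<close> a power) and all Fourier coefficients.
  Radius 1 lies in every annulus considered.\<close>

lemma L2_inner_basis:
  assumes h: "h holomorphic_on annulus \<rho>" and f: "f \<in> L2 W"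
    and fh: "\<And>z. z \<in> W \<Longrightarrow> f z = h (\<Phi> z) * exp (of_real (\<eta> / (2 * pi)) * \<Lambda> z) * deriv \<Lambda> z"
  shows "L2_inner W f (basis \<eta> n) =
    laurent_coeff h 1 n * of_real (exp_mass (ln \<rho>) (2 * of_int n + \<eta> / pi))"
proof -
  define c where "c = laurent_coeff h 1 n"
  define G where "G = (\<lambda>\<omega>. h \<omega> * cnj (\<omega> powi n) * of_real (exp (\<eta> / pi * ln (norm \<omega>))))"
  have G: "continuous_on (annulus \<rho>) G"
    unfolding G_def using annulus_nonzero holomorphic_on_imp_continuous_on[OF h]
    by (intro continuous_intros) auto
  have pt: "f z * cnj (basis \<eta> n z) = (norm (deriv \<Lambda> z))\<^sup>2 *\<^sub>R G (\<Phi> z)" if z: "z \<in> W" for z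
  proof -
    have zP: "z \<in> P"
      using z W_P by blast
    define x where "x = exp (of_real (\<eta> / (2 * pi)) * \<Lambda> z)"
    have "norm x = exp (\<eta> / (2 * pi) * Re (\<Lambda> z))"
      by (simp add: x_def norm_exp_eq_Re)
    then have "(norm x)\<^sup>2 = exp (\<eta> / pi * ln (norm (\<Phi> z)))"
      by (simp add: Re_\<Lambda>[OF zP] exp_double[symmetric])
    then have x: "x * cnj x = of_real (exp (\<eta> / pi * ln (norm (\<Phi> z))))"
      by (metis complex_norm_square)
    have "f z * cnj (basis \<eta> n z) =
        h (\<Phi> z) * cnj (\<Phi> z powi n) * (x * cnj x) * (deriv \<Lambda> z * cnj (deriv \<Lambda> z))"
      unfolding fh[OF z] basis_factorization[OF zP] x_def[symmetric] complex_cnj_mult by (simp only: mult_ac)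
    also have "\<dots> = (norm (deriv \<Lambda> z))\<^sup>2 *\<^sub>R G (\<Phi> z)"
      unfolding x unfolding G_def complex_norm_square[symmetric] by (simp add: scaleR_conv_of_real)
    finally show ?thesis .
  qed
  have "integrable (lebesgue_on W) (\<lambda>z. f z * cnj (basis \<eta> n z))"
    by (rule L2_mult_integrable[OF f basis_L2])
  then have "integrable (lebesgue_on W) (\<lambda>z. (norm (deriv \<Lambda> z))\<^sup>2 *\<^sub>R G (\<Phi> z))"
    by (subst (asm) Bochner_Integration.integrable_cong[OF refl, of _ _ "\<lambda>z. (norm (deriv \<Lambda> z))\<^sup>2 *\<^sub>R G (\<Phi> z)"])
       (simp_all add: pt)
  then have intQ: "integrable (lebesgue_on Q) (\<lambda>s. G (exp s))"
    using change_to_rectangle(1)[OF G] by blast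
  have contQ: "continuous_on Q (\<lambda>s. G (exp s))"
    by (rule continuous_on_compose2[OF G]) (use exp_Q in \<open>auto intro!: continuous_intros\<close>)
  have inner: "(LBINT v:{0<..<2*pi}. G (exp (Complex u v))) =
      of_real (2 * pi * exp ((2 * of_int n + \<eta> / pi) * u)) * c" if u: "u \<in> {- ln \<rho><..<ln \<rho>}" for u
  proof -
    define r where "r = exp u"
    have r: "r > 0" "1 / \<rho> < r" "r < \<rho>"
    proof -
      have "exp (- ln \<rho>) < exp u" "exp u < exp (ln \<rho>)"
        using u by auto
      then show "1 / \<rho> < r" "r < \<rho>"
        using rho by (auto simp: r_def exp_minus inverse_eq_divide)
    qed (simp add: r_def)
    have "G (exp (Complex u v)) =
        of_real (r powi n * exp (\<eta> / pi * u)) * (h (of_real r * cis v) * cis (- of_int n * v))" for v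
    proof -
      have e: "exp (Complex u v) = of_real r * cis v"
        by (simp add: exp_eq_polar r_def)
      have nrm: "norm (of_real r * cis v) = exp u"
        using r by (simp add: norm_mult r_def)
      have "cnj ((of_real r * cis v) powi n) = of_real (r powi n) * cis (- of_int n * v)"
        by (simp add: power_int_mult_distrib cis_power_int cis_cnj)
      then show ?thesis
        unfolding G_def e nrm by simp
    qed
    then have "(LBINT v:{0<..<2*pi}. G (exp (Complex u v))) =
        of_real (r powi n * exp (\<eta> / pi * u)) * (LBINT v:{0<..<2*pi}. h (of_real r * cis v) * cis (- of_int n * v))"
      by simp
    also have "(LBINT v:{0<..<2*pi}. h (of_real r * cis v) * cis (- of_int n * v)) =
        2 * of_real pi * of_real (r powi n) * laurent_coeff h r n"
    proof (rule laurent_coeff_eq_integral[OF r(1)])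
      show "continuous_on (sphere 0 r) h"
        by (rule continuous_on_subset[OF holomorphic_on_imp_continuous_on[OF h]]) (use r in \<open>auto simp: annulus_def\<close>)
    qed
    also have "laurent_coeff h r n = c"
      unfolding c_def
      by (rule laurent_coeff_indep[of h "1 / \<rho>" \<rho>]) (use h r rho in \<open>auto simp: annulus_def\<close>)
    also have "of_real (r powi n * exp (\<eta> / pi * u)) * (2 * of_real pi * of_real (r powi n) * c) =
        of_real (2 * pi * (r powi n * r powi n * exp (\<eta> / pi * u))) * c"
      by simp
    \<comment> \<open>One factor \<open>r powi n\<close> stems from the conjugated power in
      \<open>G\<close>, the other from the normalization of the Laurent coefficient.\<close>
    also have "r powi n * r powi n * exp (\<eta> / pi * u) = exp ((2 * of_int n + \<eta> / pi) * u)"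
      unfolding r_def exp_power_int by (simp add: exp_add[symmetric] algebra_simps)
    finally show ?thesis .
  qed
  have "L2_inner W f (basis \<eta> n) = integral\<^sup>L (lebesgue_on W) (\<lambda>z. (norm (deriv \<Lambda> z))\<^sup>2 *\<^sub>R G (\<Phi> z))"
    unfolding L2_inner_def by (rule Bochner_Integration.integral_cong) (simp_all add: pt)
  also have "\<dots> = integral\<^sup>L (lebesgue_on Q) (\<lambda>s. G (exp s))"
    by (rule change_to_rectangle(2)[OF G])
  also have "\<dots> = (LBINT u:{- ln \<rho><..<ln \<rho>}. (LBINT v:{0<..<2*pi}. G (exp (Complex u v))))"
    unfolding Q_def by (rule Fubini_rectangle) (use intQ contQ in \<open>simp_all add: Q_def\<close>)
  also have "\<dots> = (LBINT u:{- ln \<rho><..<ln \<rho>}. of_real (2 * pi * exp ((2 * of_int n + \<eta> / pi) * u)) * c)"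
    by (rule set_lebesgue_integral_cong) (use inner in auto)
  also have "\<dots> = (LBINT u:{- ln \<rho><..<ln \<rho>}. of_real (2 * pi * exp ((2 * of_int n + \<eta> / pi) * u))) * c"
    by (rule set_integral_mult_left)
  also have "(LBINT u:{- ln \<rho><..<ln \<rho>}. complex_of_real (2 * pi * exp ((2 * of_int n + \<eta> / pi) * u))) =
     of_real (exp_mass (ln \<rho>) (2 * of_int n + \<eta> / pi))"
    unfolding exp_mass_def by (rule set_integral_complex_of_real)
  finally show ?thesis
    by (simp add: c_def mult.commute)
qed

lemma basis_orthogonal:
  "L2_inner W (basis \<eta> m) (basis \<eta> n) =
    (if m = n then of_real (exp_mass (ln \<rho>) (2 * of_int n + \<eta> / pi)) else 0)"
proof -
  have "(\<lambda>w. w powi m) holomorphic_on annulus \<rho>"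
    using annulus_nonzero by (intro holomorphic_intros) auto
  then have "L2_inner W (basis \<eta> m) (basis \<eta> n) =
      laurent_coeff (\<lambda>w. w powi m) 1 n * of_real (exp_mass (ln \<rho>) (2 * of_int n + \<eta> / pi))"
    by (rule L2_inner_basis[OF _ basis_L2]) (use basis_factorization W_P in blast)
  then show ?thesis
    by (simp add: laurent_coeff_power_int)
qed

lemma basis_A2_ext: "basis \<eta> n \<in> A2_ext a b W \<eta>"
  unfolding A2_ext_def mem_Collect_eq
proof (intro conjI exI)
  show "basis \<eta> n \<in> A2 W"
    using basis_L2 holomorphic_on_subset[OF basis_holomorphic W_P] by (simp add: A2_def)
  show "open P" "P \<subseteq> periodic_domain W" "basis \<eta> n holomorphic_on P"
    by (rule open_P P_subset basis_holomorphic)+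
  show "closure W \<inter> periodic_domain W \<subseteq> P"
    using closure_Int_periodic_domain W_P J_minus_P J_plus_P by blast
  show "\<forall>z\<in>W. basis \<eta> n z = basis \<eta> n z"
    by simp
  show "\<forall>y. a < y \<and> y < b \<longrightarrow> basis \<eta> n (Complex 1 y) = exp (\<i> * of_real \<eta>) * basis \<eta> n (Complex 0 y)"
  proof (intro allI impI)
    fix y assume "a < y \<and> y < b"
    then have "Complex 0 y \<in> P"
      using J_minus_P by (auto simp: J_minus_def)
    moreover have "Complex 1 y = Complex 0 y + 1"
      by (simp add: complex_eq_iff)
    ultimately show "basis \<eta> n (Complex 1 y) = exp (\<i> * of_real \<eta>) * basis \<eta> n (Complex 0 y)"
      using basis_shift by simp
  qed
qed

end

section \<open>Completeness and the kernel formula\<close>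

text \<open>Absolute summability along the enumeration turns the series into an unordered sum over
  the integers, which may be split into nonnegative and negative indices; these parts agree with the
  given one-sided sums.\<close>

lemma sums_int_decode:
  fixes f :: "int \<Rightarrow> complex"
  assumes sm: "summable (\<lambda>k. norm (f (int_decode k)))"
    and S1: "(\<lambda>n. f (int n)) sums S1" and S2: "(\<lambda>n. f (- int n - 1)) sums S2"
  shows "(\<lambda>k. f (int_decode k)) sums (S1 + S2)"
proof -
  obtain S where S: "(\<lambda>k. f (int_decode k)) sums S"
    using summable_norm_cancel[OF sm] by (auto simp: summable_def)
  have "((\<lambda>k. f (int_decode k)) has_sum S) UNIV"
    by (rule norm_summable_imp_has_sum[OF sm S])
  then have fS: "(f has_sum S) UNIV"
    by (simp add: has_sum_reindex_bij_betw[OF bij_int_decode])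
  then have "f summable_on range int" "f summable_on range (\<lambda>n. - int n - 1)"
    by (auto intro: summable_on_subset_banach[of f UNIV] has_sum_imp_summable)
  then obtain T1 T2 where T: "(f has_sum T1) (range int)" "(f has_sum T2) (range (\<lambda>n. - int n - 1))"
    by (auto simp: summable_on_def)
  have "(f \<circ> int) sums T1" "(f \<circ> (\<lambda>n. - int n - 1)) sums T2"
    using T by (auto intro!: has_sum_imp_sums simp: has_sum_reindex inj_on_def)
  then have eq: "T1 = S1" "T2 = S2"
    using S1 S2 by (auto simp: o_def sums_iff)
  have dis: "range int \<inter> range (\<lambda>n. - int n - 1) = {}"
    by auto
  have un: "range int \<union> range (\<lambda>n. - int n - 1) = UNIV"
  proof -
    have "i \<in> range int \<union> range (\<lambda>n. - int n - 1)" for i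
    proof (cases "i \<ge> 0")
      case True
      then show ?thesis
        by (intro UnI1 image_eqI[where x = "nat i"]) auto
    next
      case False
      then show ?thesis
        by (intro UnI2 image_eqI[where x = "nat (- i - 1)"]) auto
    qed
    then show ?thesis
      by blast
  qed
  have "(f has_sum (T1 + T2)) UNIV"
    using has_sum_Un_disjoint[OF T dis] un by simp
  then show ?thesis
    using S fS has_sum_unique eq by metis
qed

text \<open>The enumeration runs 0, -1, 1, -2, 2, and so on. The bound converts exponential decay in
  the integer index into a geometric series in \<open>k\<close>.\<close>

lemma le_int_decode: "real k \<le> 2 * \<bar>real_of_int (int_decode k)\<bar>"
proof (cases "even k")
  case True
  then show ?thesis
    by (auto simp: int_decode_def sum_decode_def elim!: evenE)
next
  case False
  then show ?thesis
    by (auto simp: int_decode_def sum_decode_def elim!: oddE)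
qed

context annular_cell
begin

definition mass :: "real \<Rightarrow> int \<Rightarrow> real" where
  "mass \<eta> n = exp_mass (ln \<rho>) (2 * of_int n + \<eta> / pi)"

lemma mass_pos: "mass \<eta> n > 0"
  unfolding mass_def using rho by (intro exp_mass_pos) simp

definition onb :: "real \<Rightarrow> nat \<Rightarrow> complex \<Rightarrow> complex" where
  "onb \<eta> k z = of_real (1 / sqrt (mass \<eta> (int_decode k))) * basis \<eta> (int_decode k) z"

lemma onb_mult_cnj:
  "onb \<eta> k z * cnj (onb \<eta> k w) =
     basis \<eta> (int_decode k) z * cnj (basis \<eta> (int_decode k) w) / of_real (mass \<eta> (int_decode k))"
proof -
  have "complex_of_real (sqrt (mass \<eta> (int_decode k))) * of_real (sqrt (mass \<eta> (int_decode k))) =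
      of_real (mass \<eta> (int_decode k))"
    using mass_pos[of \<eta> "int_decode k"] by (simp flip: of_real_mult)
  then show ?thesis
    by (simp add: onb_def field_simps)
qed

lemma onb_orthonormal: "orthonormal_on W (onb \<eta>)"
  unfolding orthonormal_on_def
proof (intro conjI allI)
  show "onb \<eta> k \<in> L2 W" for k
    unfolding onb_def by (rule L2_cmult[OF basis_L2])
  show "L2_inner W (onb \<eta> j) (onb \<eta> k) = (if j = k then 1 else 0)" for j k
  proof -
    have "int_decode j = int_decode k \<longleftrightarrow> j = k"
      using inj_int_decode by (auto dest: injD)
    moreover have "complex_of_real (1 / sqrt (mass \<eta> n)) * (of_real (1 / sqrt (mass \<eta> n)) * of_real (mass \<eta> n)) = 1" for n
      using mass_pos[of \<eta> n] by (simp flip: of_real_mult)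
    ultimately show ?thesis
      unfolding onb_def L2_inner_cmult_left L2_inner_cmult_right basis_orthogonal mass_def[symmetric]
        complex_cnj_complex_of_real
      by (cases "j = k") (simp_all only: if_True if_False mult_zero_right simp_thms)
  qed
qed

lemma onb_A2_ext: "onb \<eta> k \<in> A2_ext a b W \<eta>"
  using A2_ext_linear_combination[where c = "of_real (1 / sqrt (mass \<eta> (int_decode k)))" and d = 0,
      OF basis_A2_ext[of \<eta> "int_decode k"] A2_ext_zero]
  unfolding onb_def by (simp only: mult_zero_left add_0_right)

text \<open>On a compact set the numerator of the squared modulus grows at most like
  \<open>exp (\<bar>s\<bar> * r)\<close> with \<open>r < ln \<rho>\<close>, while the mass in the
  denominator grows faster than \<open>exp (\<bar>s\<bar> * r')\<close> for a suitable
  \<open>r' > r\<close>. The quotient is dominated by a geometric series.\<close>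

lemma onb_bound:
  assumes \<eta>: "- pi \<le> \<eta>" "\<eta> \<le> pi" and C: "compact C" "C \<subseteq> W"
  shows "\<exists>B. \<forall>z\<in>C. \<forall>N. (\<Sum>k<N. (norm (onb \<eta> k z))\<^sup>2) \<le> B"
proof (cases "C = {}")
  case False
  define R where "R = ln \<rho>"
  have CP: "C \<subseteq> P"
    using C W_P by blast
  have "continuous_on C (\<lambda>z. \<bar>Re (\<Lambda> z)\<bar>)"
    by (intro continuous_intros continuous_on_subset[OF holomorphic_on_imp_continuous_on[OF \<Lambda>_holomorphic] CP])
  then obtain z0 where z0: "z0 \<in> C" "\<forall>z\<in>C. \<bar>Re (\<Lambda> z)\<bar> \<le> \<bar>Re (\<Lambda> z0)\<bar>"
    using continuous_attains_sup[OF C(1) False] by blast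
  have "continuous_on C (\<lambda>z. (norm (deriv \<Lambda> z))\<^sup>2)"
    by (intro continuous_intros continuous_on_subset[OF holomorphic_on_imp_continuous_on[OF deriv_\<Lambda>_holomorphic] CP])
  then obtain z1 where z1: "\<forall>z\<in>C. (norm (deriv \<Lambda> z))\<^sup>2 \<le> (norm (deriv \<Lambda> z1))\<^sup>2"
    using continuous_attains_sup[OF C(1) False] by blast
  define A where "A = (norm (deriv \<Lambda> z1))\<^sup>2"
  define r where "r = \<bar>Re (\<Lambda> z0)\<bar>"
  \<comment> \<open>Halfway between \<open>r\<close> and \<open>R\<close>: one half of the gap gives
    the decay \<open>d\<close>, the other keeps \<open>R - r'\<close> positive in the bound for the
    mass.\<close>
  define r' where "r' = (r + R) / 2"
  define d where "d = r' - r"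
  have r: "0 \<le> r" "r < R"
    using Re_\<Lambda>_bound z0(1) CP by (auto simp: r_def R_def)
  have r': "0 \<le> r'" "r' < R" "d > 0"
    using r by (auto simp: r'_def d_def)
  \<comment> \<open>The factor \<open>exp d\<close> makes up for the off-by-one in
    \<open>\<bar>s\<bar> \<ge> real k - 1\<close>, where \<open>\<eta> / pi\<close> costs up to
    1.\<close>
  define c where "c = A / (2 * pi * (R - r')) * exp d"
  have c: "c \<ge> 0"
    using r' by (simp add: c_def A_def)
  define q where "q = exp (- d)"
  have q: "0 \<le> q" "q < 1"
    using r' by (auto simp: q_def)
  have le_geometric: "(norm (onb \<eta> k z))\<^sup>2 \<le> c * q ^ k" if z: "z \<in> C" for k z
  proof -
    define n where "n = int_decode k"
    define s where "s = 2 * of_int n + \<eta> / pi"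
    have "\<bar>\<eta> / pi\<bar> \<le> 1"
      using \<eta> by (simp add: abs_le_iff field_simps)
    then have s: "\<bar>s\<bar> \<ge> real k - 1"
      using le_int_decode[of k] unfolding s_def n_def by linarith
    have low: "2 * pi * (R - r') * exp (\<bar>s\<bar> * r') \<le> mass \<eta> n"
      unfolding mass_def s_def[symmetric] R_def[symmetric] by (rule exp_mass_lower[OF r'(1,2)])
    have low0: "0 < 2 * pi * (R - r') * exp (\<bar>s\<bar> * r')"
      using r' by simp
    have "s * Re (\<Lambda> z) \<le> \<bar>s\<bar> * \<bar>Re (\<Lambda> z)\<bar>"
      by (metis abs_ge_self abs_mult)
    also have "\<dots> \<le> \<bar>s\<bar> * r"
      unfolding r_def using z0(2) z by (intro mult_left_mono) auto
    finally have e: "exp (s * Re (\<Lambda> z)) \<le> exp (\<bar>s\<bar> * r)"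
      by simp
    have "(norm (complex_of_real (1 / sqrt (mass \<eta> n))))\<^sup>2 = 1 / mass \<eta> n"
      using mass_pos[of \<eta> n] by (simp add: norm_divide power_divide)
    then have "(norm (onb \<eta> k z))\<^sup>2 = (norm (deriv \<Lambda> z))\<^sup>2 * exp (s * Re (\<Lambda> z)) / mass \<eta> n"
      unfolding onb_def norm_mult power_mult_distrib n_def[symmetric] norm_basis s_def[symmetric] by simp
    also have "\<dots> \<le> A * exp (\<bar>s\<bar> * r) / (2 * pi * (R - r') * exp (\<bar>s\<bar> * r'))"
      using z1 z e low low0 unfolding A_def by (intro frac_le mult_mono) auto
    also have "\<dots> = A / (2 * pi * (R - r')) * (exp (\<bar>s\<bar> * r) / exp (\<bar>s\<bar> * r'))"
      by simp
    also have "exp (\<bar>s\<bar> * r) / exp (\<bar>s\<bar> * r') = exp (- (\<bar>s\<bar> * d))"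
      unfolding exp_diff[symmetric] d_def by (simp add: algebra_simps)
    also have "A / (2 * pi * (R - r')) * exp (- (\<bar>s\<bar> * d)) \<le> A / (2 * pi * (R - r')) * exp (- ((real k - 1) * d))"
      using s r' by (intro mult_left_mono) (auto simp: A_def)
    also have "exp (- ((real k - 1) * d)) = exp d * q ^ k"
      unfolding q_def by (simp add: exp_of_nat_mult[symmetric] exp_add[symmetric] algebra_simps)
    finally show ?thesis
      by (simp add: c_def mult.assoc)
  qed
  have "(\<Sum>k<N. (norm (onb \<eta> k z))\<^sup>2) \<le> c * (1 / (1 - q))" if z: "z \<in> C" for z N
  proof -
    have "(\<Sum>k<N. (norm (onb \<eta> k z))\<^sup>2) \<le> (\<Sum>k<N. c * q ^ k)"
      by (intro sum_mono le_geometric z)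
    also have "\<dots> = c * (\<Sum>k<N. q ^ k)"
      by (simp add: sum_distrib_left)
    also have "(\<Sum>k<N. q ^ k) \<le> (\<Sum>k. q ^ k)"
      by (rule sum_le_suminf) (use q in \<open>auto intro: summable_geometric\<close>)
    also have "(\<Sum>k. q ^ k) = 1 / (1 - q)"
      by (rule suminf_geometric) (use q in auto)
    finally show ?thesis
      using c by (simp add: mult_left_mono)
  qed
  then show ?thesis
    by blast
qed auto

text \<open>Dividing by \<open>exp (\<eta> * \<Lambda> / (2 * pi)) * \<Lambda>'\<close> removes the multiplier \<open>exp (\<i> * \<eta>)\<close>, so that the quotient is
  invariant under the unit translation and descends to the annulus.\<close>

lemma A2_ext_descends:
  assumes g: "g \<in> A2_ext a b W \<eta>"
  obtains h where "h holomorphic_on annulus \<rho>"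
    and "\<And>z. z \<in> W \<Longrightarrow> g z = h (\<Phi> z) * exp (of_real (\<eta> / (2 * pi)) * \<Lambda> z) * deriv \<Lambda> z"
proof -
  obtain U g1 where U: "open U" "closure W \<inter> periodic_domain W \<subseteq> U" "g1 holomorphic_on U" "\<forall>z\<in>W. g1 z = g z"
     and jump: "\<forall>y. a < y \<and> y < b \<longrightarrow> g1 (Complex 1 y) = exp (\<i> * of_real \<eta>) * g1 (Complex 0 y)"
    using g unfolding A2_ext_def by blast
  define c where "c = complex_of_real (\<eta> / (2 * pi))"
  define G where "G = (\<lambda>z. g1 z / (exp (c * \<Lambda> z) * deriv \<Lambda> z))"
  define V where "V = U \<inter> P"
  have V: "open V"
    unfolding V_def using U(1) open_P by (rule open_Int)
  have "g1 holomorphic_on V" "\<Lambda> holomorphic_on V" "deriv \<Lambda> holomorphic_on V"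
    using U(3) \<Lambda>_holomorphic deriv_\<Lambda>_holomorphic unfolding V_def by (meson holomorphic_on_subset inf_le1 inf_le2)+
  moreover from this have "(\<lambda>z. exp (c * \<Lambda> z)) holomorphic_on V"
    by (intro holomorphic_intros)
  ultimately have holG: "G holomorphic_on V"
    unfolding G_def using deriv_\<Lambda>_nonzero
    by (intro holomorphic_on_divide holomorphic_on_mult) (auto simp: V_def)
  have sub: "W \<union> J_plus a b \<union> J_minus a b \<subseteq> V"
  proof -
    have J: "J_plus a b \<union> J_minus a b \<subseteq> closure W"
      using J_frontier frontier_W by (auto simp: J_plus_def J_minus_def)
    have "W \<union> J_plus a b \<union> J_minus a b \<subseteq> P"
      using W_P J_plus_P J_minus_P by blast
    then show ?thesis
      using U(2) P_subset J closure_subset[of W] unfolding V_def by blast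
  qed
  have GJ: "G (z + 1) = G z" if z: "z \<in> J_minus a b" for z
  proof -
    obtain y where y: "z = Complex 0 y" "a < y" "y < b"
      using z by (auto simp: J_minus_def)
    have z1: "z + 1 = Complex 1 y"
      by (simp add: y complex_eq_iff)
    have c1: "c * (2 * of_real pi * \<i>) = \<i> * of_real \<eta>"
      by (simp add: c_def)
    have "\<Lambda> (z + 1) = \<Lambda> z + 2 * of_real pi * \<i>"
      using \<Lambda>_shift[of z 1] by simp
    then have "exp (c * \<Lambda> (z + 1)) = exp (\<i> * of_real \<eta>) * exp (c * \<Lambda> z)"
      by (simp only: distrib_left exp_add c1) (rule mult.commute)
    moreover have "deriv \<Lambda> (z + 1) = deriv \<Lambda> z"
      using deriv_\<Lambda>_shift J_minus_P z by blast
    moreover have "g1 (z + 1) = exp (\<i> * of_real \<eta>) * g1 z"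
      using jump y z1 by simp
    ultimately show ?thesis
      by (simp add: G_def)
  qed
  \<comment> \<open>The chosen preimage lies in the fundamental domain; agreement with the other
    preimages, and with it continuity across \<Gamma>, remains to be shown.\<close>
  define h where "h = (\<lambda>\<omega>. G (inv_into (W \<union> J_minus a b) \<Phi> \<omega>))"
  have h: "h (\<Phi> z) = G z" if "z \<in> W \<union> J_minus a b" for z
    unfolding h_def using inv_into_f_f[OF \<Phi>_inj that] by simp
  \<comment> \<open>Only the left side of the cell needs work. There a point with negative real part
    has the representative \<open>w + 1\<close>, so \<open>G (w + 1) = G w\<close> is required on a
    full disc.\<close>
  have loc: "\<exists>e>0. ball z e \<subseteq> V \<and> (\<forall>w\<in>ball z e. h (\<Phi> w) = G w)" if z: "z \<in> W \<union> J_minus a b" for z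
  proof (cases "z \<in> W")
    case True
    then obtain e where "e > 0" "ball z e \<subseteq> W"
      using open_W open_contains_ball by blast
    then show ?thesis
      using sub h by (intro exI[of _ e]) blast
  next
    case False
    then have zJ: "z \<in> J_minus a b"
      using z by blast
    then obtain y where y: "z = Complex 0 y" "a < y" "y < b"
      by (auto simp: J_minus_def)
    obtain \<delta> where d: "\<delta> > 0" "\<delta> < 1/2"
      "\<And>w. w \<in> ball z \<delta> \<Longrightarrow> 0 < Re w \<Longrightarrow> w \<in> W"
      "\<And>w. w \<in> ball z \<delta> \<Longrightarrow> Re w < 0 \<Longrightarrow> w + 1 \<in> W"
      "\<And>w. w \<in> ball z \<delta> \<Longrightarrow> Re w = 0 \<Longrightarrow> w \<in> J_minus a b"
      using half_discs[OF y(2,3)] unfolding y(1) by metis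
    have "z \<in> V" "z + 1 \<in> V"
      using zJ sub J_plus_iff[of "z + 1"] by auto
    then obtain e1 e2 where e: "e1 > 0" "ball z e1 \<subseteq> V" "e2 > 0" "ball (z + 1) e2 \<subseteq> V"
      using V open_contains_ball by metis
    define e where "e = min \<delta> (min e1 e2)"
    define S where "S = ball z e"
    have e0: "e > 0" and SV: "S \<subseteq> V" and Sd: "S \<subseteq> ball z \<delta>"
      using d(1) e by (auto simp: e_def S_def)
    have S1: "w + 1 \<in> V" if "w \<in> S" for w
    proof -
      have "dist (z + 1) (w + 1) = dist z w"
        by (simp add: dist_norm)
      then have "w + 1 \<in> ball (z + 1) e2"
        using that by (simp add: S_def e_def)
      then show ?thesis
        using e(4) by blast
    qed
    have hol: "(\<lambda>w. G (w + 1) - G w) holomorphic_on S"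
    proof (intro holomorphic_intros)
      show "G holomorphic_on S"
        by (rule holomorphic_on_subset[OF holG SV])
      show "(\<lambda>w. G (w + 1)) holomorphic_on S"
        by (rule holomorphic_on_compose_gen[OF _ holG, unfolded o_def]) (use S1 in \<open>auto intro!: holomorphic_intros\<close>)
    qed
    \<comment> \<open>The jump condition gives the equality on a vertical segment only; as this
      segment accumulates at \<open>z\<close>, the identity theorem extends it to the disc.\<close>
    have per: "G (w + 1) = G w" if w: "w \<in> S" for w
    proof -
      have "z islimpt (S \<inter> {w. Re w = 0})"
        unfolding islimpt_approachable
      proof (intro allI impI)
        fix t :: real assume "t > 0"
        define \<tau> where "\<tau> = min t e / 2"
        have \<tau>: "0 < \<tau>" "\<tau> < t" "\<tau> < e"
          using \<open>t > 0\<close> e0 by (auto simp: \<tau>_def)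
        then show "\<exists>w\<in>S \<inter> {w. Re w = 0}. w \<noteq> z \<and> dist w z < t"
          by (intro bexI[of _ "z + \<i> * of_real \<tau>"]) (auto simp: S_def dist_norm norm_mult y)
      qed
      moreover have "G (w + 1) - G w = 0" if "w \<in> S \<inter> {w. Re w = 0}" for w
        using that GJ d(5) Sd by auto
      ultimately have "G (w + 1) - G w = 0"
        using analytic_continuation[OF hol, of "S \<inter> {w. Re w = 0}" z w] w e0 by (auto simp: S_def)
      then show ?thesis
        by simp
    qed
    have "h (\<Phi> w) = G w" if w: "w \<in> S" for w
    proof (cases "Re w < 0")
      case True
      then have "w + 1 \<in> W"
        using d(4) w Sd by blast
      then have "h (\<Phi> (w + 1)) = G (w + 1)"
        using h by blast
      then show ?thesis
        using per[OF w] \<Phi>_shift[of w 1] by simp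
    next
      case False
      then have "w \<in> W \<union> J_minus a b"
        using d(3,5) w Sd by (metis UnI1 UnI2 linorder_neqE_linordered_idom subsetD)
      then show ?thesis
        by (rule h)
    qed
    then show ?thesis
      using e0 SV unfolding S_def by blast
  qed
  have "h field_differentiable (at \<omega>)" if \<omega>: "\<omega> \<in> annulus \<rho>" for \<omega>
  proof -
    obtain z where z: "z \<in> W \<union> J_minus a b" "\<Phi> z = \<omega>"
      using \<Phi>_surj[OF \<omega>] by blast
    obtain e where e: "e > 0" "ball z e \<subseteq> V" "\<And>w. w \<in> ball z e \<Longrightarrow> h (\<Phi> w) = G w"
      using loc[OF z(1)] by blast
    have eP: "ball z e \<subseteq> P"
      using e(2) by (auto simp: V_def)
    have hol\<Phi>: "\<Phi> holomorphic_on ball z e"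
      by (rule holomorphic_on_subset[OF \<Phi>_holomorphic eP])
    have "deriv \<Phi> z \<noteq> 0"
      using deriv_\<Phi>_nonzero eP e(1) centre_in_ball by blast
    then obtain r where r: "r > 0" "ball z r \<subseteq> ball z e" "inj_on \<Phi> (ball z r)"
      using has_complex_derivative_locally_injective[OF hol\<Phi> _ open_ball] e(1) by (metis centre_in_ball)
    have hol\<Phi>r: "\<Phi> holomorphic_on ball z r"
      by (rule holomorphic_on_subset[OF hol\<Phi> r(2)])
    \<comment> \<open>With a local inverse of \<open>\<Phi>\<close> the function \<open>h\<close>
      becomes \<open>G \<circ> \<psi>\<close> near \<open>\<omega>\<close>.\<close>
    obtain \<psi> where \<psi>: "\<psi> holomorphic_on \<Phi> ` ball z r" "\<And>w. w \<in> ball z r \<Longrightarrow> \<psi> (\<Phi> w) = w"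
      using holomorphic_has_inverse[OF hol\<Phi>r open_ball r(3)] by metis
    have "(\<lambda>\<zeta>. G (\<psi> \<zeta>)) holomorphic_on \<Phi> ` ball z r"
      by (rule holomorphic_on_compose_gen[OF \<psi>(1) holG, unfolded o_def]) (use \<psi>(2) r(2) e(2) in auto)
    then have "h holomorphic_on \<Phi> ` ball z r"
      by (rule holomorphic_transform) (use \<psi>(2) r(2) e(3) in auto)
    moreover have "open (\<Phi> ` ball z r)"
      by (rule open_mapping_thm3[OF hol\<Phi>r open_ball r(3)])
    moreover have "\<omega> \<in> \<Phi> ` ball z r"
      using z(2) r(1) by (intro image_eqI[where x = z]) auto
    ultimately show ?thesis
      using holomorphic_on_imp_differentiable_at by blast
  qed
  then have "h holomorphic_on annulus \<rho>"
    by (simp add: holomorphic_on_def field_differentiable_at_within)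
  moreover have "g z = h (\<Phi> z) * exp (of_real (\<eta> / (2 * pi)) * \<Lambda> z) * deriv \<Lambda> z" if z: "z \<in> W" for z
  proof -
    have "deriv \<Lambda> z \<noteq> 0"
      using deriv_\<Lambda>_nonzero z W_P by blast
    then have "G z * exp (c * \<Lambda> z) * deriv \<Lambda> z = g1 z"
      by (simp add: G_def)
    then show ?thesis
      using h z U(4) by (simp add: c_def)
  qed
  ultimately show ?thesis
    using that by blast
qed

text \<open>The two normalizing factors cancel the mass in the Fourier coefficient, so each term is
  a Laurent term times a factor that does not depend on the index.\<close>

lemma onb_complete:
  assumes \<eta>: "- pi \<le> \<eta>" "\<eta> \<le> pi" and g: "g \<in> A2_ext a b W \<eta>" and z: "z \<in> W"
  shows "(\<lambda>k. L2_inner W g (onb \<eta> k) * onb \<eta> k z) sums g z"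
proof -
  obtain h where h: "h holomorphic_on annulus \<rho>"
    and gh: "\<And>z. z \<in> W \<Longrightarrow> g z = h (\<Phi> z) * exp (of_real (\<eta> / (2 * pi)) * \<Lambda> z) * deriv \<Lambda> z"
    using A2_ext_descends[OF g] by blast
  have gL: "g \<in> L2 W"
    by (rule A2_extD(1)[OF g])
  have zP: "z \<in> P"
    using z W_P by blast
  define x where "x = exp (of_real (\<eta> / (2 * pi)) * \<Lambda> z) * deriv \<Lambda> z"
  define f where "f = (\<lambda>n. laurent_coeff h 1 n * \<Phi> z powi n * x)"
  have eq: "L2_inner W g (onb \<eta> k) * onb \<eta> k z = f (int_decode k)" for k
  proof -
    define n where "n = int_decode k"
    define s where "s = complex_of_real (1 / sqrt (mass \<eta> n))"
    have s: "s * s * of_real (mass \<eta> n) = 1"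
      using mass_pos[of \<eta> n] by (simp add: s_def flip: of_real_mult)
    have cs: "cnj s = s"
      by (simp add: s_def)
    have "L2_inner W g (basis \<eta> n) = laurent_coeff h 1 n * of_real (mass \<eta> n)"
      unfolding mass_def by (rule L2_inner_basis[OF h gL gh])
    then have "L2_inner W g (onb \<eta> k) = s * (laurent_coeff h 1 n * of_real (mass \<eta> n))"
      unfolding onb_def n_def[symmetric] s_def[symmetric] L2_inner_cmult_right cs by simp
    then have "L2_inner W g (onb \<eta> k) * onb \<eta> k z = (s * s * of_real (mass \<eta> n)) * (laurent_coeff h 1 n * basis \<eta> n z)"
      unfolding onb_def n_def[symmetric] s_def[symmetric] by (simp only: mult_ac)
    then show ?thesis
      unfolding s f_def n_def[symmetric] x_def basis_factorization[OF zP] by (simp add: mult.assoc)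
  qed
  have bd: "\<exists>B. \<forall>w\<in>{z}. \<forall>N. (\<Sum>k<N. (norm (onb \<eta> k w))\<^sup>2) \<le> B"
    using onb_bound[OF \<eta>, of "{z}"] z by simp
  have sq: "summable (\<lambda>k. (norm (onb \<eta> k z))\<^sup>2)"
  proof -
    obtain B where "\<forall>N. (\<Sum>k<N. (norm (onb \<eta> k z))\<^sup>2) \<le> B"
      using bd by blast
    then show ?thesis
      by (intro summableI_nonneg_bounded[where x = B]) auto
  qed
  \<comment> \<open>Absolute convergence comes from Bessel's inequality and the pointwise bound, so
    the one-sided Laurent series can be merged in the order of \<open>int_decode\<close>.\<close>
  have "summable (\<lambda>k. norm (L2_inner W g (onb \<eta> k) * onb \<eta> k z))"
    by (rule summable_mult_of_square_summable[OF Bessel_summable[OF onb_orthonormal gL] sq])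
  then have sm: "summable (\<lambda>k. norm (f (int_decode k)))"
    by (simp only: eq)
  have ann: "annulus \<rho> = {z. 1 / \<rho> < norm z \<and> norm z < \<rho>}"
    by (simp add: annulus_def)
  have \<Phi>z: "1 / \<rho> < norm (\<Phi> z)" "norm (\<Phi> z) < \<rho>"
    using \<Phi>_annulus[OF zP] by (auto simp: annulus_def)
  obtain S1 S2 where S: "(\<lambda>n. laurent_coeff h 1 (int n) * \<Phi> z ^ n) sums S1"
    "(\<lambda>n. laurent_coeff h 1 (- int n - 1) * \<Phi> z powi (- int n - 1)) sums S2" "h (\<Phi> z) = S1 + S2"
    by (rule laurent_expansion[OF h[unfolded ann] _ \<Phi>z, of 1]) (use rho in auto)
  have "(\<lambda>n. f (int n)) sums (S1 * x)" "(\<lambda>n. f (- int n - 1)) sums (S2 * x)"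
    using sums_mult2[OF S(1), of x] sums_mult2[OF S(2), of x] by (simp_all add: f_def)
  then have "(\<lambda>k. f (int_decode k)) sums (S1 * x + S2 * x)"
    by (rule sums_int_decode[OF sm])
  moreover have "S1 * x + S2 * x = g z"
    unfolding gh[OF z] S(3) x_def by (simp add: algebra_simps)
  ultimately show ?thesis
    by (simp only: eq)
qed

lemma projection_kernel_onb:
  assumes \<eta>: "- pi \<le> \<eta>" "\<eta> \<le> pi"
  shows "is_projection_kernel a b W \<eta> (\<lambda>z w. \<Sum>k. onb \<eta> k z * cnj (onb \<eta> k w))"
    and "z \<in> W \<Longrightarrow> w \<in> W \<Longrightarrow> summable (\<lambda>k. norm (onb \<eta> k z * cnj (onb \<eta> k w)))"
  by (rule projection_kernel_orthonormal[OF open_W onb_orthonormal onb_A2_ext onb_bound[OF \<eta>] onb_complete[OF \<eta>]]; assumption)+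

text \<open>Differentiating \<open>\<phi> \<circ> E = exp \<circ> \<Lambda>\<close> in two ways
  shows that \<open>K_tilde\<close> is \<open>deriv \<Lambda> z * cnj (deriv \<Lambda> w)\<close>
  times \<open>\<Phi> z * cnj (\<Phi> w)\<close>. The shift \<open>n - 1\<close> in the exponential
  contributes the reciprocal of exactly this last product.\<close>

lemma K_tilde_term:
  assumes \<eta>: "- pi \<le> \<eta>" "\<eta> \<le> pi" and z: "z \<in> W" and w: "w \<in> W"
  shows "K_tilde \<phi> z w * (of_real (kernel_coeff \<rho> \<eta> n) *
           exp (\<i> * of_real (2 * pi * (of_int n - 1) + \<eta>) * (varphi \<phi> \<theta> z - cnj (varphi \<phi> \<theta> w)))) =
         basis \<eta> n z * cnj (basis \<eta> n w) / of_real (mass \<eta> n)"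
proof -
  have P: "z \<in> P" "w \<in> P"
    using z w W_P by auto
  define c where "c = complex_of_real (of_int n + \<eta> / (2 * pi))"
  have vp: "varphi \<phi> \<theta> u = \<Lambda> u / (\<i> * 2 * of_real pi)" if "u \<in> W" for u
    using \<Lambda>_W[OF that] by (simp add: varphi_def \<Phi>_def)
  have cc: "cnj c = c"
    by (simp add: c_def)
  have diff: "varphi \<phi> \<theta> z - cnj (varphi \<phi> \<theta> w) = (\<Lambda> z + cnj (\<Lambda> w)) / (\<i> * 2 * of_real pi)"
    unfolding vp[OF z] vp[OF w] by (simp add: add_divide_distrib)
  have lin: "\<i> * of_real (2 * pi * (of_int n - 1) + \<eta>) = (c - 1) * (\<i> * 2 * of_real pi)"
    by (simp add: c_def algebra_simps)
  have "\<i> * of_real (2 * pi * (of_int n - 1) + \<eta>) * (varphi \<phi> \<theta> z - cnj (varphi \<phi> \<theta> w)) =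
      (c - 1) * (\<Lambda> z + cnj (\<Lambda> w))"
    unfolding diff lin by simp
  also have "\<dots> = c * \<Lambda> z + cnj (c * \<Lambda> w) - \<Lambda> z - cnj (\<Lambda> w)"
    by (simp add: cc algebra_simps)
  finally have ex: "\<i> * of_real (2 * pi * (of_int n - 1) + \<eta>) * (varphi \<phi> \<theta> z - cnj (varphi \<phi> \<theta> w)) =
      c * \<Lambda> z + cnj (c * \<Lambda> w) - \<Lambda> z - cnj (\<Lambda> w)" .
  have "exp (cnj (\<Lambda> w)) = cnj (\<Phi> w)"
    using exp_\<Lambda>[OF P(2)] by (simp flip: exp_cnj)
  then have e: "exp (\<i> * of_real (2 * pi * (of_int n - 1) + \<eta>) * (varphi \<phi> \<theta> z - cnj (varphi \<phi> \<theta> w))) =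
      exp (c * \<Lambda> z) * cnj (exp (c * \<Lambda> w)) / (\<Phi> z * cnj (\<Phi> w))"
    unfolding ex exp_cnj using exp_\<Lambda>[OF P(1)] by (simp add: exp_diff exp_add)
  have d: "\<Phi> u * deriv \<Lambda> u = deriv \<phi> (E u) * (2 * of_real pi * \<i> * E u)" if "u \<in> P" for u
    using deriv_\<Lambda>_mult[OF that] deriv_\<Phi>[OF that] by simp
  have EE: "exp (\<i> * 2 * of_real pi * (z - cnj w)) = E z * cnj (E w)"
    unfolding E_def exp_cnj exp_add[symmetric] by (rule arg_cong[of _ _ exp]) (simp add: algebra_simps)
  have "K_tilde \<phi> z w = (deriv \<phi> (E z) * (2 * of_real pi * \<i> * E z)) * cnj (deriv \<phi> (E w) * (2 * of_real pi * \<i> * E w))"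
    unfolding K_tilde_def EE by (simp add: power2_eq_square)
  also have "\<dots> = (\<Phi> z * deriv \<Lambda> z) * cnj (\<Phi> w * deriv \<Lambda> w)"
    unfolding d[OF P(1)] d[OF P(2)] ..
  finally have K: "K_tilde \<phi> z w = (\<Phi> z * cnj (\<Phi> w)) * (deriv \<Lambda> z * cnj (deriv \<Lambda> w))"
    by simp
  have nz: "\<Phi> z * cnj (\<Phi> w) \<noteq> 0"
    using \<Phi>_nonzero P by simp
  have coeff: "complex_of_real (kernel_coeff \<rho> \<eta> n) = 1 / of_real (mass \<eta> n)"
    unfolding kernel_coeff_eq[OF rho \<eta>] mass_def by simp
  show ?thesis
    unfolding K e coeff basis_def c_def[symmetric] complex_cnj_mult using nz by (simp add: field_simps)
qed

lemma K_tilde_nonzero: "z \<in> W \<Longrightarrow> w \<in> W \<Longrightarrow> K_tilde \<phi> z w \<noteq> 0"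
  using phi_deriv_nonzero W_P by (auto simp: K_tilde_def)

lemma projection_kernel_formula:
  assumes \<eta>: "- pi \<le> \<eta>" "\<eta> \<le> pi" and z: "z \<in> W" and w: "w \<in> W"
    and K: "is_projection_kernel a b W \<eta> K"
  defines "t \<equiv> \<lambda>n::int. of_real (kernel_coeff \<rho> \<eta> n) *
           exp (\<i> * of_real (2 * pi * (of_int n - 1) + \<eta>) * (varphi \<phi> \<theta> z - cnj (varphi \<phi> \<theta> w)))"
  shows "t summable_on UNIV" and "K z w = K_tilde \<phi> z w * (\<Sum>\<^sub>\<infinity>n. t n)"
proof -
  have eq: "onb \<eta> k z * cnj (onb \<eta> k w) = K_tilde \<phi> z w * t (int_decode k)" for k
    unfolding onb_mult_cnj t_def K_tilde_term[OF \<eta> z w] ..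
  have "summable (\<lambda>k. norm (K_tilde \<phi> z w * t (int_decode k)))"
    using projection_kernel_onb(2)[OF \<eta> z w] unfolding eq .
  \<comment> \<open>\<open>K_tilde\<close> does not vanish, so summability passes from the kernel
    series to \<open>t\<close>.\<close>
  then have sm: "summable (\<lambda>k. norm (t (int_decode k)))"
    unfolding norm_mult using K_tilde_nonzero[OF z w] by (simp add: summable_cmult_iff)
  then have s: "(\<lambda>k. t (int_decode k)) sums (\<Sum>k. t (int_decode k))"
    by (rule summable_sums[OF summable_norm_cancel])
  have "((\<lambda>k. t (int_decode k)) has_sum (\<Sum>k. t (int_decode k))) UNIV"
    by (rule norm_summable_imp_has_sum[OF sm s])
  then have ts: "(t has_sum (\<Sum>k. t (int_decode k))) UNIV"
    by (simp add: has_sum_reindex_bij_betw[OF bij_int_decode])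
  then show "t summable_on UNIV"
    by (rule has_sum_imp_summable)
  have "K z w = (\<Sum>k. onb \<eta> k z * cnj (onb \<eta> k w))"
    by (rule projection_kernel_unique[OF open_W K projection_kernel_onb(1)[OF \<eta>] z w])
  also have "\<dots> = K_tilde \<phi> z w * (\<Sum>k. t (int_decode k))"
    unfolding eq by (rule suminf_mult[OF sums_summable[OF s]])
  finally show "K z w = K_tilde \<phi> z w * (\<Sum>\<^sub>\<infinity>n. t n)"
    using infsumI[OF ts] by simp
qed

end

theorem theorem6p4:
  fixes M a b \<eta> \<rho> :: real and W :: "complex set"
    and \<phi> :: "complex \<Rightarrow> complex" and \<theta> :: "complex \<Rightarrow> real"
  assumes "M > 0" and "a < b"
    and "periodic_cell M a b W"
    and "simply_connected W"
    and "\<rho> > 1"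
    and "conformal_onto_annulus (ring_domain a b W) \<rho> \<phi>"
    and "assumption_A a b W \<phi>"
    and "is_arg_branch a b W \<phi> \<theta>"
    and "- pi \<le> \<eta>" and "\<eta> \<le> pi"
  shows "(\<exists>K. is_projection_kernel a b W \<eta> K) \<and>
    (\<forall>K. is_projection_kernel a b W \<eta> K \<longrightarrow>
      (\<forall>z\<in>W. \<forall>w\<in>W.
        (\<lambda>n::int. of_real (kernel_coeff \<rho> \<eta> n) *
           exp (\<i> * of_real (2 * pi * (of_int n - 1) + \<eta>) * (varphi \<phi> \<theta> z - cnj (varphi \<phi> \<theta> w))))
          summable_on UNIV \<and>
        K z w = K_tilde \<phi> z w *
          (\<Sum>\<^sub>\<infinity>n::int. of_real (kernel_coeff \<rho> \<eta> n) *
             exp (\<i> * of_real (2 * pi * (of_int n - 1) + \<eta>) * (varphi \<phi> \<theta> z - cnj (varphi \<phi> \<theta> w))))))"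
proof -
  interpret annular_cell M a b W \<rho> \<phi> \<theta>
    by unfold_locales (use assms in auto)
  note \<eta> = assms(9,10)
  show ?thesis
  proof (intro conjI allI impI ballI)
    show "\<exists>K. is_projection_kernel a b W \<eta> K"
      using projection_kernel_onb(1)[OF \<eta>] by blast
  qed (use projection_kernel_formula[OF \<eta>] in blast)+
qed

end
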